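(* Let $E$ and $F$ be two objects of $\mathcal{T}c$. Assume $E$ is bornological and $F$ is complete. Then $$\mathrm{IB}(\mathrm{L}_b(E,F))\simeq\mathrm{L}(\mathrm{IB}(E),\mathrm{IB}(F)).$$
   Context: $\mathcal{T}c$ is the category of complex locally convex topological vector spaces (not necessarily Hausdorff) and continuous linear maps; "complete" includes Hausdorff. $E$ is bornological if any absolutely convex subset of $E$ that absorbs every bounded subset is a neighborhood of zero. $\mathrm{L}_b(E,F)$ is the vector space $\mathrm{Hom}_{\mathcal{T}c}(E,F)$ with the semi-norms $p_B(f)=\sup_{e\in B}p(f(e))$, $p$ a continuous semi-norm of $F$ and $B$ a bounded subset of $E$. $\mathcal{B}an$ is the category of complex Banach spaces and continuous linear maps, with internal Hom $\mathrm{L}(E,F)$ (continuous linear maps with operator norm); $\mathrm{Ind}(\mathcal{B}an)$ is its category of ind-objects (formal filtered inductive limits $``\varinjlim"_iE_i$ with $\mathrm{Hom}(``\varinjlim"_iE_i,``\varinjlim"_jF_j)=\varprojlim_i\varinjlim_j\mathrm{Hom}(E_i,F_j)$), with internal Hom $\mathrm{L}(``\varinjlim"_iE_i,``\varinjlim"_jF_j)=\varprojlim_i\varinjlim_j``\mathrm{L}(E_i,F_j)"$, where $``E"$ is the constant ind-object and limits are taken in $\mathrm{Ind}(\mathcal{B}an)$. For $E$ in $\mathcal{T}c$, $\mathrm{IB}(E)=``\varinjlim"_B\widehat{E}_B$, where $B$ runs over the absolutely convex bounded subsets of $E$ (ordered by inclusion), $E_B$ is the linear hull of $B$ with the gauge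 semi-norm of $B$, and $\widehat{E}_B$ its completion. *)

theory Defs
  imports "HOL-Analysis.Analysis" "HOL-Algebra.Module"
begin

section \<open>Complex locally convex spaces\<close>

text \<open>
  Vector spaces are \<open>HOL-Algebra\<close> modules over the complex numbers, with explicit carriers
  (the fields \<open>mult\<close> and \<open>one\<close> inherited from rings play no role). All maps between them are
  extensional, so that equality of maps is equality on the carrier of the source.
\<close>

definition complex_ring :: "complex ring" where
  "complex_ring = \<lparr>carrier = UNIV, mult = (*), one = 1, zero = 0, add = (+)\<rparr>"

definition complex_vs :: "(complex, 'a, 'r) module_scheme \<Rightarrow> bool" where
  "complex_vs V \<longleftrightarrow> Module.module complex_ring V"

record 'a lcs = "(complex, 'a) module" +
  lctop :: "'a topology"

record 'a nspace = "(complex, 'a) module" +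
  nrm :: "'a \<Rightarrow> real"

definition with_topology :: "(complex, 'a, 'r) module_scheme \<Rightarrow> 'a topology \<Rightarrow> 'a lcs" where
  "with_topology V T =
     \<lparr>carrier = carrier V, mult = mult V, one = one V, zero = zero V, add = add V,
      smult = smult V, lctop = T\<rparr>"

definition with_norm :: "(complex, 'a, 'r) module_scheme \<Rightarrow> ('a \<Rightarrow> real) \<Rightarrow> 'a nspace" where
  "with_norm V n =
     \<lparr>carrier = carrier V, mult = mult V, one = one V, zero = zero V, add = add V,
      smult = smult V, nrm = n\<rparr>"

definition seminorm :: "(complex, 'a, 'r) module_scheme \<Rightarrow> ('a \<Rightarrow> real) \<Rightarrow> bool" where
  "seminorm V p \<longleftrightarrow>
     (\<forall>x\<in>carrier V. 0 \<le> p x) \<and>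
     (\<forall>x\<in>carrier V. \<forall>y\<in>carrier V. p (x \<oplus>\<^bsub>V\<^esub> y) \<le> p x + p y) \<and>
     (\<forall>c. \<forall>x\<in>carrier V. p (c \<odot>\<^bsub>V\<^esub> x) = cmod c * p x)"

definition seminorm_topology ::
  "(complex, 'a, 'r) module_scheme \<Rightarrow> ('a \<Rightarrow> real) set \<Rightarrow> 'a topology" where
  "seminorm_topology V P = topology_generated_by
     {{y \<in> carrier V. p (y \<ominus>\<^bsub>V\<^esub> x) < r} | p x r. p \<in> P \<and> x \<in> carrier V \<and> 0 < r}"

definition nbhd0 :: "'a lcs \<Rightarrow> 'a set \<Rightarrow> bool" where
  "nbhd0 E N \<longleftrightarrow> N \<subseteq> carrier E \<and> (\<exists>U. openin (lctop E) U \<and> \<zero>\<^bsub>E\<^esub> \<in> U \<and> U \<subseteq> N)"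

definition convex_subset :: "(complex, 'a, 'r) module_scheme \<Rightarrow> 'a set \<Rightarrow> bool" where
  "convex_subset V A \<longleftrightarrow> A \<subseteq> carrier V \<and>
     (\<forall>x\<in>A. \<forall>y\<in>A. \<forall>t::real. 0 \<le> t \<and> t \<le> 1 \<longrightarrow>
        (complex_of_real t \<odot>\<^bsub>V\<^esub> x) \<oplus>\<^bsub>V\<^esub> (complex_of_real (1 - t) \<odot>\<^bsub>V\<^esub> y) \<in> A)"

definition abs_convex :: "(complex, 'a, 'r) module_scheme \<Rightarrow> 'a set \<Rightarrow> bool" where
  "abs_convex V A \<longleftrightarrow> A \<subseteq> carrier V \<and> A \<noteq> {} \<and>
     (\<forall>x\<in>A. \<forall>y\<in>A. \<forall>a b. cmod a + cmod b \<le> 1 \<longrightarrow> (a \<odot>\<^bsub>V\<^esub> x) \<oplus>\<^bsub>V\<^esub> (b \<odot>\<^bsub>V\<^esub> y) \<in> A)"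

definition locally_convex :: "'a lcs \<Rightarrow> bool" where
  "locally_convex E \<longleftrightarrow>
     complex_vs E \<and> topspace (lctop E) = carrier E \<and>
     continuous_map (prod_topology (lctop E) (lctop E)) (lctop E) (\<lambda>(x, y). x \<oplus>\<^bsub>E\<^esub> y) \<and>
     continuous_map (prod_topology euclidean (lctop E)) (lctop E) (\<lambda>(c, x). c \<odot>\<^bsub>E\<^esub> x) \<and>
     (\<forall>N. nbhd0 E N \<longrightarrow> (\<exists>C. nbhd0 E C \<and> convex_subset E C \<and> C \<subseteq> N))"

definition absorbs :: "(complex, 'a, 'r) module_scheme \<Rightarrow> 'a set \<Rightarrow> 'a set \<Rightarrow> bool" where
  "absorbs V A B \<longleftrightarrow> (\<exists>r>0. \<forall>c. r \<le> cmod c \<longrightarrow> B \<subseteq> (\<lambda>x. c \<odot>\<^bsub>V\<^esub> x) ` A)"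

definition vbounded :: "'a lcs \<Rightarrow> 'a set \<Rightarrow> bool" where
  "vbounded E B \<longleftrightarrow> B \<subseteq> carrier E \<and> (\<forall>N. nbhd0 E N \<longrightarrow> absorbs E N B)"

definition bornological :: "'a lcs \<Rightarrow> bool" where
  "bornological E \<longleftrightarrow>
     (\<forall>A. abs_convex E A \<and> (\<forall>B. vbounded E B \<longrightarrow> absorbs E A B) \<longrightarrow> nbhd0 E A)"

definition cauchy_filter :: "'a lcs \<Rightarrow> 'a filter \<Rightarrow> bool" where
  "cauchy_filter E \<Phi> \<longleftrightarrow>
     \<Phi> \<noteq> bot \<and> eventually (\<lambda>x. x \<in> carrier E) \<Phi> \<and>
     (\<forall>N. nbhd0 E N \<longrightarrow>
        (\<exists>A. eventually (\<lambda>x. x \<in> A) \<Phi> \<and> (\<forall>x\<in>A. \<forall>y\<in>A. x \<ominus>\<^bsub>E\<^esub> y \<in> N)))"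

definition complete_lcs :: "'a lcs \<Rightarrow> bool" where
  "complete_lcs E \<longleftrightarrow> Hausdorff_space (lctop E) \<and>
     (\<forall>\<Phi>. cauchy_filter E \<Phi> \<longrightarrow> (\<exists>x. limitin (lctop E) (\<lambda>y. y) x \<Phi>))"

definition linear_maps ::
  "(complex, 'a, 'r) module_scheme \<Rightarrow> (complex, 'b, 's) module_scheme \<Rightarrow> ('a \<Rightarrow> 'b) set" where
  "linear_maps V W = {f \<in> carrier V \<rightarrow>\<^sub>E carrier W.
     (\<forall>x\<in>carrier V. \<forall>y\<in>carrier V. f (x \<oplus>\<^bsub>V\<^esub> y) = f x \<oplus>\<^bsub>W\<^esub> f y) \<and>
     (\<forall>c. \<forall>x\<in>carrier V. f (c \<odot>\<^bsub>V\<^esub> x) = c \<odot>\<^bsub>W\<^esub> f x)}"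

definition hom_module ::
  "(complex, 'a, 'r) module_scheme \<Rightarrow> (complex, 'b, 's) module_scheme \<Rightarrow> ('a \<Rightarrow> 'b) set
    \<Rightarrow> (complex, 'a \<Rightarrow> 'b) module" where
  "hom_module V W H =
     \<lparr>carrier = H, mult = undefined, one = undefined,
      zero = (\<lambda>x\<in>carrier V. \<zero>\<^bsub>W\<^esub>),
      add = (\<lambda>f g. \<lambda>x\<in>carrier V. f x \<oplus>\<^bsub>W\<^esub> g x),
      smult = (\<lambda>c f. \<lambda>x\<in>carrier V. c \<odot>\<^bsub>W\<^esub> f x)\<rparr>"

definition tc_hom :: "'a lcs \<Rightarrow> 'b lcs \<Rightarrow> ('a \<Rightarrow> 'b) set" where
  "tc_hom E F = {f \<in> linear_maps E F. continuous_map (lctop E) (lctop F) f}"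

definition L_b :: "'a lcs \<Rightarrow> 'b lcs \<Rightarrow> ('a \<Rightarrow> 'b) lcs" where
  "L_b E F = with_topology (hom_module E F (tc_hom E F))
     (seminorm_topology (hom_module E F (tc_hom E F))
       {(\<lambda>f. SUP e\<in>B. p (f e)) | p B.
          seminorm F p \<and> continuous_map (lctop F) euclideanreal p \<and> vbounded E B \<and> B \<noteq> {}})"


section \<open>Banach spaces\<close>

definition cauchy_seqs :: "'a nspace \<Rightarrow> (nat \<Rightarrow> 'a) set" where
  "cauchy_seqs V = {s. range s \<subseteq> carrier V \<and>
     (\<forall>\<epsilon>>0. \<exists>N. \<forall>m\<ge>N. \<forall>n\<ge>N. nrm V (s m \<ominus>\<^bsub>V\<^esub> s n) < \<epsilon>)}"

definition banach_space :: "'a nspace \<Rightarrow> bool" where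
  "banach_space V \<longleftrightarrow>
     complex_vs V \<and> seminorm V (nrm V) \<and> (\<forall>x\<in>carrier V. nrm V x = 0 \<longrightarrow> x = \<zero>\<^bsub>V\<^esub>) \<and>
     (\<forall>s\<in>cauchy_seqs V. \<exists>x\<in>carrier V. (\<lambda>n. nrm V (s n \<ominus>\<^bsub>V\<^esub> x)) \<longlonglongrightarrow> 0)"

definition ban_hom :: "'a nspace \<Rightarrow> 'b nspace \<Rightarrow> ('a \<Rightarrow> 'b) set" where
  "ban_hom V W = {f \<in> linear_maps V W.
     continuous_map (seminorm_topology V {nrm V}) (seminorm_topology W {nrm W}) f}"

definition ban_L :: "'a nspace \<Rightarrow> 'b nspace \<Rightarrow> ('a \<Rightarrow> 'b) nspace" where
  "ban_L V W = with_norm (hom_module V W (ban_hom V W))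
     (\<lambda>f. SUP x\<in>{x \<in> carrier V. nrm V x \<le> 1}. nrm W (f x))"

text \<open>The (Hausdorff) completion of a semi-normed space: Cauchy sequences modulo null sequences.\<close>

definition null_rel :: "'a nspace \<Rightarrow> ((nat \<Rightarrow> 'a) \<times> (nat \<Rightarrow> 'a)) set" where
  "null_rel V = {(s, t). s \<in> cauchy_seqs V \<and> t \<in> cauchy_seqs V \<and>
     (\<lambda>n. nrm V (s n \<ominus>\<^bsub>V\<^esub> t n)) \<longlonglongrightarrow> 0}"

definition completion :: "'a nspace \<Rightarrow> (nat \<Rightarrow> 'a) set nspace" where
  "completion V =
     \<lparr>carrier = cauchy_seqs V // null_rel V, mult = undefined, one = undefined,
      zero = null_rel V `` {\<lambda>n. \<zero>\<^bsub>V\<^esub>},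
      add = (\<lambda>X Y. null_rel V `` {(\<lambda>n. s n \<oplus>\<^bsub>V\<^esub> t n) | s t. s \<in> X \<and> t \<in> Y}),
      smult = (\<lambda>c X. null_rel V `` {(\<lambda>n. c \<odot>\<^bsub>V\<^esub> s n) | s. s \<in> X}),
      nrm = (\<lambda>X. the_elem ((\<lambda>s. lim (\<lambda>n. nrm V (s n))) ` X))\<rparr>"

definition linear_hull :: "(complex, 'a, 'r) module_scheme \<Rightarrow> 'a set \<Rightarrow> 'a set" where
  "linear_hull V B = (\<lambda>S. submodule S complex_ring V) hull B"

definition gauge_of :: "(complex, 'a, 'r) module_scheme \<Rightarrow> 'a set \<Rightarrow> 'a \<Rightarrow> real" where
  "gauge_of V B x = Inf {r. 0 < r \<and> x \<in> (\<lambda>y. complex_of_real r \<odot>\<^bsub>V\<^esub> y) ` B}"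

definition hull_space :: "'a lcs \<Rightarrow> 'a set \<Rightarrow> 'a nspace" where
  "hull_space E B = with_norm (E\<lparr>carrier := linear_hull E B\<rparr>) (gauge_of E B)"


section \<open>Ind-objects of Banach spaces\<close>

record ('o, 'm) category =
  obj :: "'o set"
  arr :: "'m set"
  src :: "'m \<Rightarrow> 'o"
  tgt :: "'m \<Rightarrow> 'o"
  idn :: "'o \<Rightarrow> 'm"
  cmp :: "'m \<Rightarrow> 'm \<Rightarrow> 'm"  \<comment> \<open>\<open>cmp C b a\<close> is \<open>b\<close> after \<open>a\<close>\<close>

definition category :: "('o, 'm) category \<Rightarrow> bool" where
  "category C \<longleftrightarrow>
     (\<forall>a\<in>arr C. src C a \<in> obj C \<and> tgt C a \<in> obj C) \<and>
     (\<forall>i\<in>obj C. idn C i \<in> arr C \<and> src C (idn C i) = i \<and> tgt C (idn C i) = i) \<and>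
     (\<forall>a\<in>arr C. \<forall>b\<in>arr C. tgt C a = src C b \<longrightarrow>
        cmp C b a \<in> arr C \<and> src C (cmp C b a) = src C a \<and> tgt C (cmp C b a) = tgt C b) \<and>
     (\<forall>a\<in>arr C. cmp C a (idn C (src C a)) = a \<and> cmp C (idn C (tgt C a)) a = a) \<and>
     (\<forall>a\<in>arr C. \<forall>b\<in>arr C. \<forall>c\<in>arr C. tgt C a = src C b \<and> tgt C b = src C c \<longrightarrow>
        cmp C c (cmp C b a) = cmp C (cmp C c b) a)"

definition filtered :: "('o, 'm) category \<Rightarrow> bool" where
  "filtered C \<longleftrightarrow> obj C \<noteq> {} \<and>
     (\<forall>i\<in>obj C. \<forall>j\<in>obj C. \<exists>a\<in>arr C. \<exists>b\<in>arr C.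
        src C a = i \<and> src C b = j \<and> tgt C a = tgt C b) \<and>
     (\<forall>a\<in>arr C. \<forall>b\<in>arr C. src C a = src C b \<and> tgt C a = tgt C b \<longrightarrow>
        (\<exists>c\<in>arr C. src C c = tgt C a \<and> cmp C c a = cmp C c b))"

definition inclusion_category :: "'a set set \<Rightarrow> ('a set, 'a set \<times> 'a set) category" where
  "inclusion_category \<B> =
     \<lparr>obj = \<B>, arr = {(B, C). B \<in> \<B> \<and> C \<in> \<B> \<and> B \<subseteq> C}, src = fst, tgt = snd,
      idn = (\<lambda>B. (B, B)), cmp = (\<lambda>b a. (fst a, snd b))\<rparr>"

record ('o, 'm, 'x) ind =
  idx :: "('o, 'm) category"
  spc :: "'o \<Rightarrow> 'x nspace"
  trn :: "'m \<Rightarrow> 'x \<Rightarrow> 'x"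

definition ind_object :: "('o, 'm, 'x) ind \<Rightarrow> bool" where
  "ind_object X \<longleftrightarrow>
     category (idx X) \<and> filtered (idx X) \<and>
     (\<forall>i\<in>obj (idx X). banach_space (spc X i)) \<and>
     (\<forall>a\<in>arr (idx X). trn X a \<in> ban_hom (spc X (src (idx X) a)) (spc X (tgt (idx X) a))) \<and>
     (\<forall>i\<in>obj (idx X). trn X (idn (idx X) i) = (\<lambda>x\<in>carrier (spc X i). x)) \<and>
     (\<forall>a\<in>arr (idx X). \<forall>b\<in>arr (idx X). tgt (idx X) a = src (idx X) b \<longrightarrow>
        trn X (cmp (idx X) b a) = compose (carrier (spc X (src (idx X) a))) (trn X b) (trn X a))"

text \<open>
  For a Banach space \<open>V\<close>, the set \<open>colim_hom V Y\<close> is the filtered inductive limit of the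
  \<open>Hom(V, Y\<^sub>j)\<close>, and \<open>ind_hom X Y\<close> is the projective limit over \<open>i\<close> of the \<open>colim_hom X\<^sub>i Y\<close>.
  So a morphism assigns to each index \<open>i\<close> of \<open>X\<close> a class of pairs \<open>(j, f)\<close> with \<open>f \<in> Hom(X\<^sub>i, Y\<^sub>j)\<close>.
\<close>

definition germs :: "'v nspace \<Rightarrow> ('j, 'n, 'y) ind \<Rightarrow> ('j \<times> ('v \<Rightarrow> 'y)) set" where
  "germs V Y = (SIGMA j : obj (idx Y). ban_hom V (spc Y j))"

definition germ_rel ::
  "'v nspace \<Rightarrow> ('j, 'n, 'y) ind \<Rightarrow> (('j \<times> ('v \<Rightarrow> 'y)) \<times> ('j \<times> ('v \<Rightarrow> 'y))) set" where
  "germ_rel V Y = {((j, f), (j', f')). (j, f) \<in> germs V Y \<and> (j', f') \<in> germs V Y \<and>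
     (\<exists>a\<in>arr (idx Y). \<exists>b\<in>arr (idx Y).
        src (idx Y) a = j \<and> src (idx Y) b = j' \<and> tgt (idx Y) a = tgt (idx Y) b \<and>
        compose (carrier V) (trn Y a) f = compose (carrier V) (trn Y b) f')}"

definition colim_hom :: "'v nspace \<Rightarrow> ('j, 'n, 'y) ind \<Rightarrow> ('j \<times> ('v \<Rightarrow> 'y)) set set" where
  "colim_hom V Y = germs V Y // germ_rel V Y"

definition ind_hom ::
  "('i, 'm, 'x) ind \<Rightarrow> ('j, 'n, 'y) ind \<Rightarrow> ('i \<Rightarrow> ('j \<times> ('x \<Rightarrow> 'y)) set) set" where
  "ind_hom X Y = {\<phi> \<in> (\<Pi>\<^sub>E i\<in>obj (idx X). colim_hom (spc X i) Y).
     \<forall>a\<in>arr (idx X). \<phi> (src (idx X) a) =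
       germ_rel (spc X (src (idx X) a)) Y ``
         {(j, compose (carrier (spc X (src (idx X) a))) f (trn X a)) | j f.
            (j, f) \<in> \<phi> (tgt (idx X) a)}}"

definition ind_id :: "('i, 'm, 'x) ind \<Rightarrow> 'i \<Rightarrow> ('i \<times> ('x \<Rightarrow> 'x)) set" where
  "ind_id X = (\<lambda>i\<in>obj (idx X). germ_rel (spc X i) X `` {(i, \<lambda>x\<in>carrier (spc X i). x)})"

text \<open>\<open>ind_comp X Z \<psi> \<phi>\<close> is \<open>\<psi>\<close> after \<open>\<phi>\<close>, where \<open>X\<close> is the source of \<open>\<phi>\<close> and \<open>Z\<close> the target of \<open>\<psi>\<close>.\<close>

definition ind_comp ::
  "('i, 'm, 'x) ind \<Rightarrow> ('k, 'l, 'z) ind \<Rightarrow> ('j \<Rightarrow> ('k \<times> ('y \<Rightarrow> 'z)) set)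
    \<Rightarrow> ('i \<Rightarrow> ('j \<times> ('x \<Rightarrow> 'y)) set) \<Rightarrow> 'i \<Rightarrow> ('k \<times> ('x \<Rightarrow> 'z)) set" where
  "ind_comp X Z \<psi> \<phi> = (\<lambda>i\<in>obj (idx X). germ_rel (spc X i) Z ``
     {(k, compose (carrier (spc X i)) g f) | j f k g. (j, f) \<in> \<phi> i \<and> (k, g) \<in> \<psi> j})"

definition ind_iso :: "('i, 'm, 'x) ind \<Rightarrow> ('j, 'n, 'y) ind \<Rightarrow> bool" (infix \<open>\<simeq>\<^sub>I\<close> 50) where
  "X \<simeq>\<^sub>I Y \<longleftrightarrow> (\<exists>\<phi>\<in>ind_hom X Y. \<exists>\<psi>\<in>ind_hom Y X.
     ind_comp X X \<psi> \<phi> = ind_id X \<and> ind_comp Y Y \<phi> \<psi> = ind_id Y)"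

text \<open>
  Projective limits in the category of ind-objects of a functor \<open>(D, T)\<close> on the opposite of \<open>C\<close>;
  an arrow \<open>a : i \<rightarrow> i'\<close> of \<open>C\<close> gives \<open>T a : D i' \<rightarrow> D i\<close>.

  A HOL formula cannot quantify over types, so the universal property is relative to a universe of
  test objects: the ind-objects of the type given by the argument \<open>U\<close>. This \<open>U\<close> is meant to be
  arbitrary. As soon as its types are large enough for copies of the given object and of a
  projective limit to occur in \<open>U\<close>, the relative universal property is the absolute one, since an
  isomorphism with that limit can then be constructed inside \<open>U\<close>.
\<close>

definition ind_cone ::
  "('o, 'm) category \<Rightarrow> ('o \<Rightarrow> ('j, 'n, 'y) ind) \<Rightarrow> ('m \<Rightarrow> 'j \<Rightarrow> ('j \<times> ('y \<Rightarrow> 'y)) set)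
    \<Rightarrow> ('k, 'l, 'z) ind \<Rightarrow> ('o \<Rightarrow> 'k \<Rightarrow> ('j \<times> ('z \<Rightarrow> 'y)) set) \<Rightarrow> bool" where
  "ind_cone C D T Z \<sigma> \<longleftrightarrow>
     (\<forall>i\<in>obj C. \<sigma> i \<in> ind_hom Z (D i)) \<and>
     (\<forall>a\<in>arr C. ind_comp Z (D (src C a)) (T a) (\<sigma> (tgt C a)) = \<sigma> (src C a))"

definition is_ind_limit ::
  "('p, 'q, 'u) ind itself
    \<Rightarrow> ('o, 'm) category \<Rightarrow> ('o \<Rightarrow> ('j, 'n, 'y) ind) \<Rightarrow> ('m \<Rightarrow> 'j \<Rightarrow> ('j \<times> ('y \<Rightarrow> 'y)) set)
    \<Rightarrow> ('k, 'l, 'z) ind \<Rightarrow> ('o \<Rightarrow> 'k \<Rightarrow> ('j \<times> ('z \<Rightarrow> 'y)) set) \<Rightarrow> bool" where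
  "is_ind_limit U C D T H \<pi> \<longleftrightarrow>
     ind_object H \<and> ind_cone C D T H \<pi> \<and>
     (\<forall>(Z :: ('p, 'q, 'u) ind) \<sigma>. ind_object Z \<and> ind_cone C D T Z \<sigma> \<longrightarrow>
        (\<exists>!\<phi>. \<phi> \<in> ind_hom Z H \<and> (\<forall>i\<in>obj C. ind_comp Z (D i) (\<pi> i) \<phi> = \<sigma> i)))"

text \<open>
  \<open>ind_L V Y\<close> is the inductive limit over \<open>j\<close>, in the category of ind-objects, of the constant
  ind-objects \<open>L(V, Y\<^sub>j)\<close>: it is the formal inductive limit of the \<open>L(V, Y\<^sub>j)\<close>. For an arrow
  \<open>a : i \<rightarrow> i'\<close> of the index category of \<open>X\<close>, \<open>ind_L_map X Y a\<close> is the morphism from \<open>ind_L X\<^sub>i\<^sub>' Y\<close>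
  to \<open>ind_L X\<^sub>i Y\<close> given by composition with the transition map \<open>X\<^sub>i \<rightarrow> X\<^sub>i\<^sub>'\<close>.
\<close>

definition ind_L :: "'v nspace \<Rightarrow> ('j, 'n, 'y) ind \<Rightarrow> ('j, 'n, 'v \<Rightarrow> 'y) ind" where
  "ind_L V Y =
     \<lparr>idx = idx Y, spc = (\<lambda>j. ban_L V (spc Y j)),
      trn = (\<lambda>b. \<lambda>u\<in>carrier (ban_L V (spc Y (src (idx Y) b))). compose (carrier V) (trn Y b) u)\<rparr>"

definition ind_L_map ::
  "('i, 'm, 'x) ind \<Rightarrow> ('j, 'n, 'y) ind \<Rightarrow> 'm \<Rightarrow> 'j \<Rightarrow> ('j \<times> (('x \<Rightarrow> 'y) \<Rightarrow> 'x \<Rightarrow> 'y)) set" where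
  "ind_L_map X Y a = (\<lambda>j\<in>obj (idx Y).
     germ_rel (ban_L (spc X (tgt (idx X) a)) (spc Y j)) (ind_L (spc X (src (idx X) a)) Y) ``
       {(j, \<lambda>u\<in>carrier (ban_L (spc X (tgt (idx X) a)) (spc Y j)).
              compose (carrier (spc X (src (idx X) a))) u (trn X a))})"

text \<open>\<open>H\<close> is an internal Hom object \<open>L(X, Y)\<close>; as a projective limit it is unique up to isomorphism.\<close>

definition is_internal_hom ::
  "('p, 'q, 'u) ind itself \<Rightarrow> ('i, 'm, 'x) ind \<Rightarrow> ('j, 'n, 'y) ind \<Rightarrow> ('k, 'l, 'z) ind \<Rightarrow> bool" where
  "is_internal_hom U X Y H \<longleftrightarrow>
     (\<exists>\<pi>. is_ind_limit U (idx X) (\<lambda>i. ind_L (spc X i) Y) (ind_L_map X Y) H \<pi>)"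

definition IB :: "'a lcs \<Rightarrow> ('a set, 'a set \<times> 'a set, (nat \<Rightarrow> 'a) set) ind" where
  "IB E =
     \<lparr>idx = inclusion_category {B. abs_convex E B \<and> vbounded E B},
      spc = (\<lambda>B. completion (hull_space E B)),
      trn = (\<lambda>(B, C). \<lambda>\<xi>\<in>carrier (completion (hull_space E B)). null_rel (hull_space E C) `` \<xi>)\<rparr>"

end

theory Submission
  imports Defs
begin

text \<open>
  The internal Hom object is \<open>IB (L_b E F)\<close> itself, so that the isomorphism is the identity and the
  content is a universal property: \<open>IB (L_b E F)\<close> is the projective limit over the disks \<open>B\<close> of \<open>E\<close>, that is,
  its absolutely convex bounded sets, of the formal inductive limits of the spaces
  \<open>L(E\<^sub>B, F\<^sub>C)\<close>. Here \<open>E\<^sub>B\<close> and \<open>F\<^sub>C\<close> stand for the completed hulls.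

  The idea is to replace classes of germs by honest maps. If \<open>G\<close> is Hausdorff and sequentially complete, then
  the inclusion of the hull of a disk into \<open>G\<close> extends to its completion, and for cofinally many
  disks the extension is injective. It is so for the disks cut out by inequalities \<open>p x \<le> M p\<close>
  between semi-norms and constants, since these contain the limits of their sequences
  (\<open>realize_level_inj\<close>). Hence, for a Banach space \<open>V\<close>, a class of germs from \<open>V\<close> to \<open>IB G\<close> is the same as a linear
  map from \<open>V\<close> to \<open>G\<close> that is bounded on the unit ball. In the same way a class of germs from \<open>V\<close> to the
  inductive limit of the \<open>L(W, F\<^sub>C)\<close> is the same as a bounded bilinear map from \<open>V \<times> W\<close> to \<open>F\<close>
  (\<open>germs_over_ind_L_IB\<close>, \<open>bounded_bilinear_map_if_germ\<close>). The locale \<open>realized_ind\<close> contains the formal part of this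
  translation: morphisms of ind-objects into such targets, their equality and their composition
  are expressed by the underlying maps.

  After translation a cone over the projective system consists of compatible bounded bilinear maps on
  \<open>Z\<^sub>i \<times> E\<^sub>B\<close>. Since the disks cover \<open>E\<close> and are directed, these glue to bilinear maps on \<open>Z\<^sub>i \<times> E\<close>, bounded on the
  product of the unit ball with every bounded subset of \<open>E\<close>. As \<open>E\<close> is bornological, a linear map to \<open>F\<close> that is bounded
  on bounded sets is continuous (\<open>tc_hom_iff\<close>). So the glued maps are bounded linear maps from
  \<open>Z\<^sub>i\<close> to \<open>L_b E F\<close>, and they factor through \<open>IB (L_b E F)\<close> because \<open>L_b E F\<close> is again Hausdorff and
  sequentially complete (\<open>L_b_complete\<close>). The factorization is unique, since a continuous linear map on
  \<open>E\<close> is determined by its extensions to the \<open>E\<^sub>B\<close> (\<open>eq_glue_if_ext_map\<close>).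

  Only bounded sets and convergence of sequences matter for these arguments, and both are described by
  families of semi-norms: the continuous ones for \<open>E\<close> and \<open>F\<close>, the suprema over bounded sets for
  \<open>L_b E F\<close>.
\<close>


section \<open>Complex vector spaces and semi-norms\<close>

locale cvs =
  fixes V :: "(complex, 'a, 'r) module_scheme" (structure)
  assumes cvs: "complex_vs V"
begin

lemma module_axioms': "Module.module complex_ring V"
  using cvs by (simp add: complex_vs_def)

sublocale M: Module.module complex_ring V
  by (rule module_axioms')

lemma smult_closed [simp]: "x \<in> carrier V \<Longrightarrow> c \<odot> x \<in> carrier V"
  using M.smult_closed[of c x] by (simp add: complex_ring_def)

lemma smult_add: "x \<in> carrier V \<Longrightarrow> y \<in> carrier V \<Longrightarrow> c \<odot> (x \<oplus> y) = c \<odot> x \<oplus> c \<odot> y"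
  using M.smult_r_distr[of c x y] by (simp add: complex_ring_def)

lemma add_smult: "x \<in> carrier V \<Longrightarrow> (c + d) \<odot> x = c \<odot> x \<oplus> d \<odot> x"
  using M.smult_l_distr[of c d x] by (simp add: complex_ring_def)

lemma smult_smult [simp]: "x \<in> carrier V \<Longrightarrow> c \<odot> (d \<odot> x) = (c * d) \<odot> x"
  using M.smult_assoc1[of c d x] by (simp add: complex_ring_def)

lemma one_smult [simp]: "x \<in> carrier V \<Longrightarrow> 1 \<odot> x = x"
  using M.smult_one[of x] by (simp add: complex_ring_def)

lemma zero_smult [simp]: "x \<in> carrier V \<Longrightarrow> 0 \<odot> x = \<zero>"
  using M.smult_l_null[of x] by (simp add: complex_ring_def)

lemma smult_zero [simp]: "c \<odot> \<zero> = \<zero>"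
  using M.smult_r_null[of c] by (simp add: complex_ring_def)

lemma minus_eq_smult: "x \<in> carrier V \<Longrightarrow> y \<in> carrier V \<Longrightarrow> x \<ominus> y = x \<oplus> (-1) \<odot> y"
proof -
  assume xy: "x \<in> carrier V" "y \<in> carrier V"
  have "y \<oplus> (-1) \<odot> y = (1 + -1) \<odot> y" using xy by (subst add_smult) auto
  then have "(-1) \<odot> y = \<ominus> y"
    using xy by (metis M.minus_equality M.a_comm add.right_inverse smult_closed zero_smult)
  then show ?thesis by (simp add: a_minus_def)
qed

text \<open>
  Four vectors span an image of \<open>\<complex>\<^sup>4\<close>, so an identity between linear combinations of them reduces to
  identities between their coefficients. Since the witness \<open>L\<close> is opaque, rewriting the vectors
  into values of \<open>L\<close> terminates.
\<close>

lemma linear_combinations: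
  assumes "x \<in> carrier V" "y \<in> carrier V" "z \<in> carrier V" "w \<in> carrier V"
  obtains L :: "complex \<Rightarrow> complex \<Rightarrow> complex \<Rightarrow> complex \<Rightarrow> 'a" where
    "x = L 1 0 0 0" "y = L 0 1 0 0" "z = L 0 0 1 0" "w = L 0 0 0 1" "\<zero> = L 0 0 0 0"
    "\<And>a b c d a' b' c' d'. L a b c d \<oplus> L a' b' c' d' = L (a + a') (b + b') (c + c') (d + d')"
    "\<And>a b c d a' b' c' d'. L a b c d \<ominus> L a' b' c' d' = L (a - a') (b - b') (c - c') (d - d')"
    "\<And>e a b c d. e \<odot> L a b c d = L (e * a) (e * b) (e * c) (e * d)"
    "\<And>a b c d. L a b c d \<in> carrier V"
proof
  let ?L = "\<lambda>a b c d. (a \<odot> x \<oplus> b \<odot> y) \<oplus> (c \<odot> z \<oplus> d \<odot> w)"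
  show "x = ?L 1 0 0 0" "y = ?L 0 1 0 0" "z = ?L 0 0 1 0" "w = ?L 0 0 0 1" "\<zero> = ?L 0 0 0 0"
    using assms by auto
  show add: "?L a b c d \<oplus> ?L a' b' c' d' = ?L (a + a') (b + b') (c + c') (d + d')"
    for a b c d a' b' c' d'
    using assms by (simp add: add_smult M.a_ac)
  show smult: "e \<odot> ?L a b c d = ?L (e * a) (e * b) (e * c) (e * d)" for e a b c d
    using assms by (simp add: smult_add)
  show cl: "?L a b c d \<in> carrier V" for a b c d using assms by simp
  show "?L a b c d \<ominus> ?L a' b' c' d' = ?L (a - a') (b - b') (c - c') (d - d')"
    for a b c d a' b' c' d'
    using add[of a b c d "-a'" "-b'" "-c'" "-d'"] smult[of "-1" a' b' c' d']
    by (subst minus_eq_smult[OF cl cl]) simp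
qed

lemma minus_self [simp]: "x \<in> carrier V \<Longrightarrow> x \<ominus> x = \<zero>"
  by (rule linear_combinations[of x x x x]) simp_all

lemma minus_zero [simp]: "x \<in> carrier V \<Longrightarrow> x \<ominus> \<zero> = x"
  by (simp add: minus_eq_smult)

lemma smult_uminus1_add [simp]: "x \<in> carrier V \<Longrightarrow> (-1) \<odot> x \<oplus> x = \<zero>"
  by (rule linear_combinations[of x x x x]) simp_all

lemma add_smult_uminus1 [simp]: "x \<in> carrier V \<Longrightarrow> x \<oplus> (-1) \<odot> x = \<zero>"
  by (rule linear_combinations[of x x x x]) simp_all

lemma minus_trans:
  assumes "x \<in> carrier V" "y \<in> carrier V" "z \<in> carrier V"
  shows "(x \<ominus> y) \<oplus> (y \<ominus> z) = x \<ominus> z"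
  by (rule linear_combinations[OF assms assms(1)]) simp

lemma minus_add:
  assumes "x \<in> carrier V" "y \<in> carrier V" "z \<in> carrier V" "w \<in> carrier V"
  shows "(x \<oplus> y) \<ominus> (z \<oplus> w) = (x \<ominus> z) \<oplus> (y \<ominus> w)"
  by (rule linear_combinations[OF assms]) simp

lemma smult_minus:
  assumes "x \<in> carrier V" "y \<in> carrier V"
  shows "c \<odot> (x \<ominus> y) = c \<odot> x \<ominus> c \<odot> y"
  by (rule linear_combinations[OF assms assms]) simp

lemma minus_commute:
  assumes "x \<in> carrier V" "y \<in> carrier V"
  shows "y \<ominus> x = (-1) \<odot> (x \<ominus> y)"
  by (rule linear_combinations[OF assms assms]) simp

lemma minus_add_cancel:
  assumes "x \<in> carrier V" "y \<in> carrier V"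
  shows "(x \<ominus> y) \<oplus> y = x"
  by (rule linear_combinations[OF assms assms]) simp

lemma eq_if_minus_eq_zero: "x \<in> carrier V \<Longrightarrow> y \<in> carrier V \<Longrightarrow> x \<ominus> y = \<zero> \<Longrightarrow> x = y"
  using minus_add_cancel[of x y] by simp

end

lemma complex_vsI:
  fixes V :: "(complex, 'a, 'r) module_scheme" (structure)
  assumes "\<zero> \<in> carrier V"
    and "\<And>x y. x \<in> carrier V \<Longrightarrow> y \<in> carrier V \<Longrightarrow> x \<oplus> y \<in> carrier V"
    and "\<And>c x. x \<in> carrier V \<Longrightarrow> c \<odot> x \<in> carrier V"
    and "\<And>x y z. x \<in> carrier V \<Longrightarrow> y \<in> carrier V \<Longrightarrow> z \<in> carrier V
      \<Longrightarrow> (x \<oplus> y) \<oplus> z = x \<oplus> (y \<oplus> z)"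
    and "\<And>x y. x \<in> carrier V \<Longrightarrow> y \<in> carrier V \<Longrightarrow> x \<oplus> y = y \<oplus> x"
    and "\<And>x. x \<in> carrier V \<Longrightarrow> \<zero> \<oplus> x = x"
    and "\<And>x. x \<in> carrier V \<Longrightarrow> (-1) \<odot> x \<oplus> x = \<zero>"
    and "\<And>c d x. x \<in> carrier V \<Longrightarrow> (c + d) \<odot> x = c \<odot> x \<oplus> d \<odot> x"
    and "\<And>c x y. x \<in> carrier V \<Longrightarrow> y \<in> carrier V \<Longrightarrow> c \<odot> (x \<oplus> y) = c \<odot> x \<oplus> c \<odot> y"
    and "\<And>c d x. x \<in> carrier V \<Longrightarrow> (c * d) \<odot> x = c \<odot> (d \<odot> x)"
    and "\<And>x. x \<in> carrier V \<Longrightarrow> 1 \<odot> x = x"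
  shows "complex_vs V"
  unfolding complex_vs_def
proof (rule moduleI)
  have "monoid complex_ring" by unfold_locales (auto simp: complex_ring_def)
  show "cring complex_ring"
  proof (rule cringI)
    show "abelian_group complex_ring"
      by (rule abelian_groupI) (auto simp: complex_ring_def intro: exI[of _ "- x" for x] left_minus)
    show "Group.comm_monoid complex_ring"
      by (rule comm_monoidI) (auto simp: complex_ring_def)
  qed (auto simp: complex_ring_def algebra_simps)
  show "abelian_group V"
  proof (rule abelian_groupI)
    show "\<exists>y\<in>carrier V. y \<oplus> x = \<zero>" if "x \<in> carrier V" for x
      using assms(3,7) that by blast
  qed (use assms in auto)
qed (use assms in \<open>auto simp: complex_ring_def\<close>)

lemma complex_vs_cong:
  assumes "complex_vs V" and "carrier W = carrier V" "zero W = zero V" "add W = add V" "smult W = smult V"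
  shows "complex_vs W"
proof -
  interpret V: cvs V by (rule cvs.intro) fact
  show ?thesis by (rule complex_vsI; simp add: assms(2-) V.M.a_ac V.add_smult V.smult_add)
qed

locale seminormed = cvs +
  fixes p :: "'a \<Rightarrow> real"
  assumes seminorm: "seminorm V p"
begin

lemma nonneg [simp]: "x \<in> carrier V \<Longrightarrow> 0 \<le> p x"
  and triangle: "x \<in> carrier V \<Longrightarrow> y \<in> carrier V \<Longrightarrow> p (x \<oplus> y) \<le> p x + p y"
  and homogeneous [simp]: "x \<in> carrier V \<Longrightarrow> p (c \<odot> x) = cmod c * p x"
  using seminorm by (auto simp: seminorm_def)

lemma at_zero [simp]: "p \<zero> = 0"
  using homogeneous[of \<zero> 0] by simp

lemma minus_sym: "x \<in> carrier V \<Longrightarrow> y \<in> carrier V \<Longrightarrow> p (x \<ominus> y) = p (y \<ominus> x)"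
  by (subst minus_commute[of x y]) (simp_all add: M.minus_closed)

lemma triangle_via:
  assumes "x \<in> carrier V" "y \<in> carrier V" "z \<in> carrier V"
  shows "p (x \<ominus> z) \<le> p (x \<ominus> y) + p (y \<ominus> z)"
  using triangle[of "x \<ominus> y" "y \<ominus> z"] assms by (simp add: minus_trans M.minus_closed)

lemma le_add_minus:
  assumes "x \<in> carrier V" "y \<in> carrier V"
  shows "p x \<le> p y + p (x \<ominus> y)"
  using triangle_via[of x y \<zero>] assms by simp

lemma abs_diff_le:
  assumes "x \<in> carrier V" "y \<in> carrier V"
  shows "\<bar>p x - p y\<bar> \<le> p (x \<ominus> y)"
  using le_add_minus[of x y] le_add_minus[of y x] minus_sym[of x y] assms by simp

lemma add_minus_add_le:
  assumes "x \<in> carrier V" "y \<in> carrier V" "z \<in> carrier V" "w \<in> carrier V"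
  shows "p ((x \<oplus> y) \<ominus> (z \<oplus> w)) \<le> p (x \<ominus> z) + p (y \<ominus> w)"
  using triangle[of "x \<ominus> z" "y \<ominus> w"] assms by (simp add: minus_add M.minus_closed)

lemma smult_minus_smult:
  assumes "x \<in> carrier V" "y \<in> carrier V"
  shows "p (c \<odot> x \<ominus> c \<odot> y) = cmod c * p (x \<ominus> y)"
  using assms homogeneous[of "x \<ominus> y" c] by (simp add: smult_minus M.minus_closed)

lemma tendsto_seminorm:
  assumes "\<And>n. s n \<in> carrier V" "x \<in> carrier V" "(\<lambda>n. p (s n \<ominus> x)) \<longlonglongrightarrow> 0"
  shows "(\<lambda>n. p (s n)) \<longlonglongrightarrow> p x"
proof (rule Lim_null[THEN iffD2], rule Lim_null_comparison[OF _ assms(3)])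
  show "\<forall>\<^sub>F n in sequentially. norm (p (s n) - p x) \<le> p (s n \<ominus> x)"
    using abs_diff_le assms(1,2) by (auto intro: always_eventually)
qed

end

locale snspace = seminormed V "nrm V" for V :: "'a nspace" (structure)

lemma snspaceI: "complex_vs V \<Longrightarrow> seminorm V (nrm V) \<Longrightarrow> snspace V"
  by (simp add: snspace_def seminormed_def seminormed_axioms_def cvs_def)

lemma banach_snspace: "banach_space V \<Longrightarrow> snspace V"
  by (simp add: banach_space_def snspaceI)

section \<open>Bounded linear maps\<close>

lemma linear_mapsD:
  assumes "f \<in> linear_maps V W"
  shows "x \<in> carrier V \<Longrightarrow> f x \<in> carrier W"
    and "x \<in> carrier V \<Longrightarrow> y \<in> carrier V \<Longrightarrow> f (x \<oplus>\<^bsub>V\<^esub> y) = f x \<oplus>\<^bsub>W\<^esub> f y"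
    and "x \<in> carrier V \<Longrightarrow> f (c \<odot>\<^bsub>V\<^esub> x) = c \<odot>\<^bsub>W\<^esub> f x"
    and "f \<in> extensional (carrier V)"
  using assms by (auto simp: linear_maps_def PiE_def)

lemma linear_mapsI:
  assumes "\<And>x. x \<in> carrier V \<Longrightarrow> f x \<in> carrier W"
    and "\<And>x y. x \<in> carrier V \<Longrightarrow> y \<in> carrier V \<Longrightarrow> f (x \<oplus>\<^bsub>V\<^esub> y) = f x \<oplus>\<^bsub>W\<^esub> f y"
    and "\<And>c x. x \<in> carrier V \<Longrightarrow> f (c \<odot>\<^bsub>V\<^esub> x) = c \<odot>\<^bsub>W\<^esub> f x"
    and "f \<in> extensional (carrier V)"
  shows "f \<in> linear_maps V W"
  using assms by (auto simp: linear_maps_def PiE_def)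

lemma linear_minus:
  assumes f: "f \<in> linear_maps V W" and "complex_vs V" "complex_vs W"
    and x: "x \<in> carrier V" and y: "y \<in> carrier V"
  shows "f (x \<ominus>\<^bsub>V\<^esub> y) = f x \<ominus>\<^bsub>W\<^esub> f y"
proof -
  interpret V: cvs V by (rule cvs.intro) fact
  interpret W: cvs W by (rule cvs.intro) fact
  show ?thesis
    using x y linear_mapsD(1-3)[OF f] by (simp add: V.minus_eq_smult W.minus_eq_smult)
qed

lemma linear_zero:
  assumes f: "f \<in> linear_maps V W" and "complex_vs V" "complex_vs W"
  shows "f \<zero>\<^bsub>V\<^esub> = \<zero>\<^bsub>W\<^esub>"
proof -
  interpret V: cvs V by (rule cvs.intro) fact
  interpret W: cvs W by (rule cvs.intro) fact
  show ?thesis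
    using linear_mapsD(3)[OF f, of "\<zero>\<^bsub>V\<^esub>" 0] linear_mapsD(1)[OF f, of "\<zero>\<^bsub>V\<^esub>"] by simp
qed

lemma linear_maps_compose:
  assumes f: "f \<in> linear_maps V W" and g: "g \<in> linear_maps W X" and "complex_vs V"
  shows "compose (carrier V) g f \<in> linear_maps V X"
proof -
  interpret V: cvs V by (rule cvs.intro) fact
  show ?thesis
    by (rule linear_mapsI) (simp_all add: compose_def linear_mapsD[OF f] linear_mapsD(1-3)[OF g])
qed

lemma seminorm_topology_ball:
  assumes "p \<in> P" "x \<in> carrier V" "0 < r"
  shows "openin (seminorm_topology V P) {y \<in> carrier V. p (y \<ominus>\<^bsub>V\<^esub> x) < r}"
  unfolding seminorm_topology_def using assms by (intro topology_generated_by_Basis) auto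

text \<open>
  By the triangle inequality a ball contains a ball around each of its points, so the centers of the
  balls can be moved to the given point. Finitely many semi-norms are enough since the generation of
  open sets from balls only uses finite intersections.
\<close>

lemma seminorm_topology_local:
  assumes "complex_vs V" "\<And>p. p \<in> P \<Longrightarrow> seminorm V p"
    and "openin (seminorm_topology V P) U" "x \<in> U"
  obtains Q r where "finite Q" "Q \<subseteq> P" "0 < r"
    "{y \<in> carrier V. \<forall>p\<in>Q. p (y \<ominus>\<^bsub>V\<^esub> x) < r} \<subseteq> U" "x \<in> carrier V"
proof -
  let ?\<B> = "{{y \<in> carrier V. p (y \<ominus>\<^bsub>V\<^esub> x) < r} | p x r. p \<in> P \<and> x \<in> carrier V \<and> 0 < r}"
  interpret V: cvs V by (rule cvs.intro) fact
  have "generate_topology_on ?\<B> U"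
    using assms(3) by (simp add: seminorm_topology_def openin_topology_generated_by_iff)
  then have "\<forall>x\<in>U. x \<in> carrier V \<and> (\<exists>Q r. finite Q \<and> Q \<subseteq> P \<and> 0 < r \<and>
      {y \<in> carrier V. \<forall>p\<in>Q. p (y \<ominus>\<^bsub>V\<^esub> x) < r} \<subseteq> U)"
  proof induction
    case Empty
    then show ?case by simp
  next
    case (Int A B)
    show ?case
    proof
      fix x assume "x \<in> A \<inter> B"
      then obtain Q r Q' r' where
        "finite Q" "Q \<subseteq> P" "0 < r" "{y \<in> carrier V. \<forall>p\<in>Q. p (y \<ominus>\<^bsub>V\<^esub> x) < r} \<subseteq> A"
        "finite Q'" "Q' \<subseteq> P" "0 < r'" "{y \<in> carrier V. \<forall>p\<in>Q'. p (y \<ominus>\<^bsub>V\<^esub> x) < r'} \<subseteq> B"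
        "x \<in> carrier V"
        using Int.IH by (meson IntD1 IntD2)
      then show "x \<in> carrier V \<and> (\<exists>Q r. finite Q \<and> Q \<subseteq> P \<and> 0 < r \<and>
          {y \<in> carrier V. \<forall>p\<in>Q. p (y \<ominus>\<^bsub>V\<^esub> x) < r} \<subseteq> A \<inter> B)"
        by (intro conjI exI[of _ "Q \<union> Q'"] exI[of _ "min r r'"]) auto
    qed
  next
    case (UN K)
    then show ?case by (meson Union_iff Union_upper subset_trans)
  next
    case (Basis S)
    then obtain p z r where S: "S = {y \<in> carrier V. p (y \<ominus>\<^bsub>V\<^esub> z) < r}"
      and "p \<in> P" "z \<in> carrier V" "0 < r" by auto
    interpret p: seminormed V p
      using assms(2)[OF \<open>p \<in> P\<close>] by unfold_locales
    show ?case
    proof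
      fix x assume x: "x \<in> S"
      have "{y \<in> carrier V. \<forall>q\<in>{p}. q (y \<ominus>\<^bsub>V\<^esub> x) < r - p (x \<ominus>\<^bsub>V\<^esub> z)} \<subseteq> S"
        using p.triangle_via[of _ x z] x \<open>z \<in> carrier V\<close> unfolding S by force
      moreover have "0 < r - p (x \<ominus>\<^bsub>V\<^esub> z)" using x by (auto simp: S)
      ultimately show "x \<in> carrier V \<and> (\<exists>Q r. finite Q \<and> Q \<subseteq> P \<and> 0 < r \<and>
          {y \<in> carrier V. \<forall>p\<in>Q. p (y \<ominus>\<^bsub>V\<^esub> x) < r} \<subseteq> S)"
        using x \<open>p \<in> P\<close> S by (intro conjI exI[of _ "{p}"]) (auto intro!: exI[of _ "r - p (x \<ominus>\<^bsub>V\<^esub> z)"])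
    qed
  qed
  with \<open>x \<in> U\<close> show thesis using that by blast
qed

lemma topspace_seminorm_topology:
  assumes "complex_vs V" "p \<in> P"
  shows "topspace (seminorm_topology V P) = carrier V"
proof
  interpret V: cvs V by (rule cvs.intro) fact
  show "topspace (seminorm_topology V P) \<subseteq> carrier V"
    unfolding seminorm_topology_def by auto
  show "carrier V \<subseteq> topspace (seminorm_topology V P)"
  proof
    fix x assume x: "x \<in> carrier V"
    have "openin (seminorm_topology V P) {y \<in> carrier V. p (y \<ominus>\<^bsub>V\<^esub> x) < \<bar>p (x \<ominus>\<^bsub>V\<^esub> x)\<bar> + 1}"
      using x assms by (intro seminorm_topology_ball) auto
    then show "x \<in> topspace (seminorm_topology V P)" using x
      by (auto dest!: openin_subset)
  qed
qed

lemma seminorm_topology_openinI: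
  assumes "complex_vs V" "seminorm V p" "U \<subseteq> carrier V"
    and "\<And>x. x \<in> U \<Longrightarrow> \<exists>r>0. {y \<in> carrier V. p (y \<ominus>\<^bsub>V\<^esub> x) < r} \<subseteq> U"
  shows "openin (seminorm_topology V {p}) U"
proof (subst openin_subopen, intro ballI)
  interpret seminormed V p using assms by (simp add: seminormed_def seminormed_axioms_def cvs_def)
  fix x assume "x \<in> U"
  with assms(4) obtain r where "r > 0" "{y \<in> carrier V. p (y \<ominus>\<^bsub>V\<^esub> x) < r} \<subseteq> U" by blast
  moreover have "x \<in> carrier V" using \<open>x \<in> U\<close> assms(3) by blast
  ultimately show "\<exists>T. openin (seminorm_topology V {p}) T \<and> x \<in> T \<and> T \<subseteq> U"
    by (intro exI[of _ "{y \<in> carrier V. p (y \<ominus>\<^bsub>V\<^esub> x) < r}"]) (auto intro: seminorm_topology_ball)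
qed

text \<open>
  A continuous linear map sends some ball around zero into the unit ball, and scaling turns this into
  a bound by a multiple of the norm. The summand \<open>e\<close> in the proof keeps
  the scaled vector strictly inside the ball, also when its norm is zero.
\<close>

lemma ban_hom_iff_bounded:
  fixes V :: "'a nspace" and W :: "'b nspace"
  assumes "snspace V" "snspace W"
  shows "f \<in> ban_hom V W \<longleftrightarrow>
    f \<in> linear_maps V W \<and> (\<exists>K\<ge>0. \<forall>x\<in>carrier V. nrm W (f x) \<le> K * nrm V x)"
proof -
  interpret V: snspace V by fact
  interpret W: snspace W by fact
  let ?TV = "seminorm_topology V {nrm V}" and ?TW = "seminorm_topology W {nrm W}"
  have top: "topspace ?TV = carrier V" "topspace ?TW = carrier W"
    by (simp_all add: topspace_seminorm_topology V.cvs W.cvs)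
  have "continuous_map ?TV ?TW f \<longleftrightarrow> (\<exists>K\<ge>0. \<forall>x\<in>carrier V. nrm W (f x) \<le> K * nrm V x)"
    if f: "f \<in> linear_maps V W"
  proof
    assume cont: "continuous_map ?TV ?TW f"
    have f0: "f \<zero>\<^bsub>V\<^esub> = \<zero>\<^bsub>W\<^esub>" using linear_zero[OF f V.cvs W.cvs] .
    let ?U = "{x \<in> carrier V. f x \<in> {y \<in> carrier W. nrm W (y \<ominus>\<^bsub>W\<^esub> \<zero>\<^bsub>W\<^esub>) < 1}}"
    have "openin ?TV ?U"
      using openin_continuous_map_preimage[OF cont seminorm_topology_ball[of "nrm W" "{nrm W}" "\<zero>\<^bsub>W\<^esub>" W 1]]
      by (simp add: top)
    moreover have "\<zero>\<^bsub>V\<^esub> \<in> ?U" by (simp add: f0)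
    ultimately obtain Q r where Q: "finite Q" "Q \<subseteq> {nrm V}" "0 < r"
      "{y \<in> carrier V. \<forall>p\<in>Q. p (y \<ominus>\<^bsub>V\<^esub> \<zero>\<^bsub>V\<^esub>) < r} \<subseteq> ?U"
      by (rule seminorm_topology_local[OF V.cvs, rotated]) (use V.seminorm in auto)
    have ball: "nrm W (f x) < 1" if "x \<in> carrier V" "nrm V x < r" for x
    proof -
      have "x \<in> {y \<in> carrier V. \<forall>p\<in>Q. p (y \<ominus>\<^bsub>V\<^esub> \<zero>\<^bsub>V\<^esub>) < r}" using that Q(2) by auto
      then have "x \<in> ?U" using Q(4) by blast
      then show ?thesis by (auto simp: W.minus_zero)
    qed
    have "nrm W (f x) \<le> 1 / r * nrm V x" if x: "x \<in> carrier V" for x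
    proof (rule field_le_epsilon)
      fix e :: real assume e: "0 < e"
      define t where "t = 1 / r * nrm V x + e"
      have t: "0 < t" using V.nonneg[OF x] \<open>0 < r\<close> e by (simp add: t_def add_nonneg_pos)
      have "nrm V x / t < r"
        using t \<open>0 < r\<close> V.nonneg[OF x] e
        by (simp add: t_def field_simps add_pos_nonneg)
      then have "nrm V ((1 / complex_of_real t) \<odot>\<^bsub>V\<^esub> x) < r"
        using x t by (simp add: norm_divide)
      then have "nrm W (f ((1 / complex_of_real t) \<odot>\<^bsub>V\<^esub> x)) < 1" using ball x by simp
      then have "nrm W (f x) < t"
        using x t linear_mapsD(1,3)[OF f] by (simp add: norm_divide field_simps)
      then show "nrm W (f x) \<le> 1 / r * nrm V x + e" by (simp add: t_def)
    qed
    then show "\<exists>K\<ge>0. \<forall>x\<in>carrier V. nrm W (f x) \<le> K * nrm V x"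
      using \<open>0 < r\<close> by (intro exI[of _ "1 / r"]) auto
  next
    assume "\<exists>K\<ge>0. \<forall>x\<in>carrier V. nrm W (f x) \<le> K * nrm V x"
    then obtain K where K: "K \<ge> 0" "\<And>x. x \<in> carrier V \<Longrightarrow> nrm W (f x) \<le> K * nrm V x" by blast
    show "continuous_map ?TV ?TW f"
      unfolding continuous_map top
    proof (intro conjI allI impI)
      show "f ` carrier V \<subseteq> carrier W" using linear_mapsD(1)[OF f] by auto
      fix U assume U: "openin ?TW U"
      show "openin ?TV {x \<in> carrier V. f x \<in> U}"
      proof (rule seminorm_topology_openinI[OF V.cvs V.seminorm])
        fix x assume x: "x \<in> {x \<in> carrier V. f x \<in> U}"
        then have fU: "f x \<in> U" by simp
        obtain Q r where Q: "Q \<subseteq> {nrm W}" "0 < r"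
          "{y \<in> carrier W. \<forall>p\<in>Q. p (y \<ominus>\<^bsub>W\<^esub> f x) < r} \<subseteq> U"
          by (rule seminorm_topology_local[OF W.cvs _ U fU]) (use W.seminorm in auto)
        have "{y \<in> carrier V. nrm V (y \<ominus>\<^bsub>V\<^esub> x) < r / (K + 1)} \<subseteq> {x \<in> carrier V. f x \<in> U}"
        proof safe
          fix y assume y: "y \<in> carrier V" "nrm V (y \<ominus>\<^bsub>V\<^esub> x) < r / (K + 1)"
          have "nrm W (f y \<ominus>\<^bsub>W\<^esub> f x) \<le> K * nrm V (y \<ominus>\<^bsub>V\<^esub> x)"
            using K(2)[of "y \<ominus>\<^bsub>V\<^esub> x"] x y(1) linear_minus[OF f V.cvs W.cvs]
            by (simp add: V.M.minus_closed)
          also have "\<dots> \<le> (K + 1) * nrm V (y \<ominus>\<^bsub>V\<^esub> x)"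
            using x y(1) by (intro mult_right_mono) (auto simp: V.M.minus_closed)
          also have "\<dots> < r" using y(2) K(1) by (simp add: field_simps)
          finally have "f y \<in> {y \<in> carrier W. \<forall>p\<in>Q. p (y \<ominus>\<^bsub>W\<^esub> f x) < r}"
            using y(1) Q(1) linear_mapsD(1)[OF f] by auto
          then show "f y \<in> U" using Q(3) by blast
        qed
        then show "\<exists>r>0. {y \<in> carrier V. nrm V (y \<ominus>\<^bsub>V\<^esub> x) < r} \<subseteq> {x \<in> carrier V. f x \<in> U}"
          using Q(2) K(1) by (intro exI[of _ "r / (K + 1)"]) auto
      qed auto
    qed
  qed
  then show ?thesis unfolding ban_hom_def by blast
qed

lemma ban_hom_linear: "f \<in> ban_hom V W \<Longrightarrow> f \<in> linear_maps V W"
  by (simp add: ban_hom_def)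

lemma ban_hom_compose:
  assumes "f \<in> ban_hom V W" "g \<in> ban_hom W X" "complex_vs V"
  shows "compose (carrier V) g f \<in> ban_hom V X"
proof -
  have "continuous_map (seminorm_topology V {nrm V}) (seminorm_topology X {nrm X}) (g \<circ> f)"
    using assms(1,2) unfolding ban_hom_def by (auto intro: continuous_map_compose)
  then have "continuous_map (seminorm_topology V {nrm V}) (seminorm_topology X {nrm X})
      (compose (carrier V) g f)"
    by (rule continuous_map_eq)
       (simp add: compose_def topspace_seminorm_topology[OF assms(3), of "nrm V"])
  then show ?thesis
    using assms unfolding ban_hom_def by (auto intro: linear_maps_compose)
qed

section \<open>Completion of a semi-normed space\<close>

text \<open>
  The operations of the completion are images of sets of sequences under the relation. If these
  sequences all lie in one class, then the image is that class.
\<close>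

lemma equiv_Image_subset:
  assumes "equiv A r" "S \<subseteq> r `` {a}" "S \<noteq> {}"
  shows "r `` S = r `` {a}"
proof -
  have "r `` {b} = r `` {a}" if "b \<in> S" for b
    using assms(1,2) that by (metis Image_singleton_iff equiv_class_eq subsetD)
  then show ?thesis using assms(3) by (auto simp: Image_def)
qed

lemma (in cvs) submodule_cvs:
  assumes "submodule H complex_ring V"
  shows "complex_vs (V\<lparr>carrier := H\<rparr>)"
  using submodule.submodule_is_module[OF assms M.module_axioms] by (simp add: complex_vs_def)

context snspace
begin

abbreviation nm :: "'a \<Rightarrow> real" where "nm \<equiv> nrm V"

lemma cauchy_seqs_iff:
  "s \<in> cauchy_seqs V \<longleftrightarrow> (\<forall>n. s n \<in> carrier V) \<and>
     (\<forall>e>0. \<exists>N. \<forall>m\<ge>N. \<forall>n\<ge>N. nm (s m \<ominus> s n) < e)"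
  by (auto simp: cauchy_seqs_def)

lemma cauchy_closed [simp]: "s \<in> cauchy_seqs V \<Longrightarrow> s n \<in> carrier V"
  by (simp add: cauchy_seqs_iff)

lemma minus_closed [simp]: "x \<in> carrier V \<Longrightarrow> y \<in> carrier V \<Longrightarrow> x \<ominus> y \<in> carrier V"
  by (rule M.minus_closed)

lemma cauchy_const [simp]: "x \<in> carrier V \<Longrightarrow> (\<lambda>_. x) \<in> cauchy_seqs V"
  by (simp add: cauchy_seqs_iff)

lemma cauchy_add [simp]:
  assumes "s \<in> cauchy_seqs V" "t \<in> cauchy_seqs V"
  shows "(\<lambda>n. s n \<oplus> t n) \<in> cauchy_seqs V"
  unfolding cauchy_seqs_iff
proof (intro conjI allI impI)
  fix e :: real assume "e > 0"
  then obtain N N' where "\<forall>m\<ge>N. \<forall>n\<ge>N. nm (s m \<ominus> s n) < e/2" "\<forall>m\<ge>N'. \<forall>n\<ge>N'. nm (t m \<ominus> t n) < e/2"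
    using assms unfolding cauchy_seqs_iff by (meson half_gt_zero)
  then have "nm ((s m \<oplus> t m) \<ominus> (s n \<oplus> t n)) < e" if "m \<ge> max N N'" "n \<ge> max N N'" for m n
    using add_minus_add_le[of "s m" "t m" "s n" "t n"] assms that
    by (smt (verit) cauchy_closed field_sum_of_halves max.boundedE)
  then show "\<exists>N. \<forall>m\<ge>N. \<forall>n\<ge>N. nm ((s m \<oplus> t m) \<ominus> (s n \<oplus> t n)) < e" by blast
qed (use assms in auto)

lemma cauchy_smult [simp]:
  assumes "s \<in> cauchy_seqs V"
  shows "(\<lambda>n. c \<odot> s n) \<in> cauchy_seqs V"
  unfolding cauchy_seqs_iff
proof (intro conjI allI impI)
  fix e :: real assume "e > 0"
  then have "e / (cmod c + 1) > 0" by (simp add: add_nonneg_pos)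
  then obtain N where N: "\<forall>m\<ge>N. \<forall>n\<ge>N. nm (s m \<ominus> s n) < e / (cmod c + 1)"
    using assms unfolding cauchy_seqs_iff by blast
  have "nm (c \<odot> s m \<ominus> c \<odot> s n) < e" if "m \<ge> N" "n \<ge> N" for m n
  proof -
    have "nm (c \<odot> s m \<ominus> c \<odot> s n) \<le> (cmod c + 1) * nm (s m \<ominus> s n)"
      using assms by (simp add: smult_minus_smult distrib_right)
    also have "\<dots> < e" using N that by (simp add: pos_less_divide_eq add_nonneg_pos mult.commute)
    finally show ?thesis .
  qed
  then show "\<exists>N. \<forall>m\<ge>N. \<forall>n\<ge>N. nm (c \<odot> s m \<ominus> c \<odot> s n) < e" by blast
qed (use assms in auto)

lemma cauchy_minus [simp]:
  assumes "s \<in> cauchy_seqs V" "t \<in> cauchy_seqs V"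
  shows "(\<lambda>n. s n \<ominus> t n) \<in> cauchy_seqs V"
  using cauchy_add[OF assms(1) cauchy_smult[OF assms(2), of "-1"]] assms
  by (simp add: minus_eq_smult)

lemma null_rel_iff: "(s, t) \<in> null_rel V \<longleftrightarrow>
   s \<in> cauchy_seqs V \<and> t \<in> cauchy_seqs V \<and> (\<lambda>n. nm (s n \<ominus> t n)) \<longlonglongrightarrow> 0"
  by (simp add: null_rel_def)

lemma equiv_null_rel: "equiv (cauchy_seqs V) (null_rel V)"
proof (rule equivI)
  show "refl_on (cauchy_seqs V) (null_rel V)"
    by (rule refl_onI) (auto simp: null_rel_iff)
  show "sym (null_rel V)"
    by (rule symI) (auto simp: null_rel_iff minus_sym[OF cauchy_closed cauchy_closed])
  show "trans (null_rel V)"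
  proof (rule transI)
    fix s t u assume *: "(s, t) \<in> null_rel V" "(t, u) \<in> null_rel V"
    then have "(\<lambda>n. nm (s n \<ominus> t n) + nm (t n \<ominus> u n)) \<longlonglongrightarrow> 0"
      using tendsto_add by (fastforce simp: null_rel_iff)
    then have "(\<lambda>n. nm (s n \<ominus> u n)) \<longlonglongrightarrow> 0"
      by (rule Lim_null_comparison[rotated])
         (use * in \<open>auto intro!: always_eventually triangle_via simp: null_rel_iff\<close>)
    then show "(s, u) \<in> null_rel V" using * by (simp add: null_rel_iff)
  qed
  show "null_rel V \<subseteq> cauchy_seqs V \<times> cauchy_seqs V" by (auto simp: null_rel_iff)
qed

definition cls :: "(nat \<Rightarrow> 'a) \<Rightarrow> (nat \<Rightarrow> 'a) set" where
  "cls s = null_rel V `` {s}"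

lemma mem_cls_iff: "t \<in> cls s \<longleftrightarrow> (s, t) \<in> null_rel V"
  by (simp add: cls_def)

lemma self_in_cls [simp]: "s \<in> cauchy_seqs V \<Longrightarrow> s \<in> cls s"
  by (simp add: mem_cls_iff null_rel_iff)

lemma cls_eq_iff:
  "s \<in> cauchy_seqs V \<Longrightarrow> t \<in> cauchy_seqs V \<Longrightarrow> cls s = cls t \<longleftrightarrow> (\<lambda>n. nm (s n \<ominus> t n)) \<longlonglongrightarrow> 0"
  unfolding cls_def using eq_equiv_class_iff[OF equiv_null_rel] by (simp add: null_rel_iff)

lemma carrier_completion: "carrier (completion V) = cls ` cauchy_seqs V"
  by (auto simp: completion_def quotient_def cls_def)

lemma cls_closed [simp]: "s \<in> cauchy_seqs V \<Longrightarrow> cls s \<in> carrier (completion V)"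
  by (simp add: carrier_completion)

lemma completionE:
  assumes "\<xi> \<in> carrier (completion V)"
  obtains s where "s \<in> cauchy_seqs V" "\<xi> = cls s"
  using assms by (auto simp: carrier_completion)

lemma cls_add:
  assumes "s \<in> cauchy_seqs V" "t \<in> cauchy_seqs V"
  shows "cls s \<oplus>\<^bsub>completion V\<^esub> cls t = cls (\<lambda>n. s n \<oplus> t n)"
proof -
  have "(\<lambda>n. a n \<oplus> b n) \<in> cls (\<lambda>n. s n \<oplus> t n)" if ab: "a \<in> cls s" "b \<in> cls t" for a b
  proof -
    have "(\<lambda>n. nm (s n \<ominus> a n) + nm (t n \<ominus> b n)) \<longlonglongrightarrow> 0"
      using tendsto_add ab by (fastforce simp: null_rel_iff mem_cls_iff)
    then have "(\<lambda>n. nm ((s n \<oplus> t n) \<ominus> (a n \<oplus> b n))) \<longlonglongrightarrow> 0"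
      by (rule Lim_null_comparison[rotated])
         (use ab in \<open>auto intro!: always_eventually add_minus_add_le simp: null_rel_iff mem_cls_iff\<close>)
    then show ?thesis using assms ab by (simp add: null_rel_iff mem_cls_iff)
  qed
  moreover have "{\<lambda>n. a n \<oplus> b n |a b. a \<in> cls s \<and> b \<in> cls t} \<noteq> {}"
    using self_in_cls assms by blast
  ultimately have "null_rel V `` {\<lambda>n. a n \<oplus> b n |a b. a \<in> cls s \<and> b \<in> cls t} = cls (\<lambda>n. s n \<oplus> t n)"
    unfolding cls_def[of "\<lambda>n. s n \<oplus> t n"] by (intro equiv_Image_subset[OF equiv_null_rel]) auto
  then show ?thesis by (simp add: completion_def)
qed

lemma cls_smult:
  assumes "s \<in> cauchy_seqs V"
  shows "c \<odot>\<^bsub>completion V\<^esub> cls s = cls (\<lambda>n. c \<odot> s n)"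
proof -
  have "(\<lambda>n. c \<odot> a n) \<in> cls (\<lambda>n. c \<odot> s n)" if a: "a \<in> cls s" for a
  proof -
    have "(\<lambda>n. cmod c * nm (s n \<ominus> a n)) \<longlonglongrightarrow> 0"
      using a by (auto simp: null_rel_iff mem_cls_iff intro: tendsto_mult_right_zero)
    then show ?thesis using assms a by (simp add: null_rel_iff mem_cls_iff smult_minus_smult)
  qed
  moreover have "{\<lambda>n. c \<odot> a n |a. a \<in> cls s} \<noteq> {}"
    using self_in_cls assms by blast
  ultimately have "null_rel V `` {\<lambda>n. c \<odot> a n |a. a \<in> cls s} = cls (\<lambda>n. c \<odot> s n)"
    unfolding cls_def[of "\<lambda>n. c \<odot> s n"] by (intro equiv_Image_subset[OF equiv_null_rel]) auto
  then show ?thesis by (simp add: completion_def)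
qed

lemma zero_completion: "\<zero>\<^bsub>completion V\<^esub> = cls (\<lambda>_. \<zero>)"
  by (simp add: completion_def cls_def)

lemma nrm_cls_tendsto:
  assumes s: "s \<in> cauchy_seqs V"
  shows "(\<lambda>n. nm (s n)) \<longlonglongrightarrow> nrm (completion V) (cls s)"
proof -
  have "Cauchy (\<lambda>n. nm (s n))"
    unfolding Cauchy_def
  proof (intro allI impI)
    fix e :: real assume "e > 0"
    then obtain N where "\<forall>m\<ge>N. \<forall>n\<ge>N. nm (s m \<ominus> s n) < e"
      using s unfolding cauchy_seqs_iff by blast
    moreover have "dist (nm (s m)) (nm (s n)) \<le> nm (s m \<ominus> s n)" for m n
      using abs_diff_le s unfolding dist_real_def by simp
    ultimately show "\<exists>N. \<forall>m\<ge>N. \<forall>n\<ge>N. dist (nm (s m)) (nm (s n)) < e"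
      by (meson order_le_less_trans)
  qed
  then have conv: "(\<lambda>n. nm (s n)) \<longlonglongrightarrow> lim (\<lambda>n. nm (s n))"
    by (simp add: Cauchy_convergent_iff convergent_LIMSEQ_iff)
  have "lim (\<lambda>n. nm (t n)) = lim (\<lambda>n. nm (s n))" if t: "t \<in> cls s" for t
  proof -
    have "(\<lambda>n. nm (s n \<ominus> t n)) \<longlonglongrightarrow> 0" using t by (simp add: mem_cls_iff null_rel_iff)
    then have "(\<lambda>n. nm (s n) - nm (t n)) \<longlonglongrightarrow> 0"
      by (rule Lim_null_comparison[rotated])
         (use t s in \<open>auto intro!: always_eventually abs_diff_le simp: mem_cls_iff null_rel_iff\<close>)
    from tendsto_diff[OF conv this] show ?thesis by (simp add: limI)
  qed
  then have "(\<lambda>t. lim (\<lambda>n. nm (t n))) ` cls s = {lim (\<lambda>n. nm (s n))}"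
    using self_in_cls[OF s] by blast
  then show ?thesis using conv by (simp add: completion_def)
qed

lemma nrm_cls_eqI:
  "s \<in> cauchy_seqs V \<Longrightarrow> (\<lambda>n. nm (s n)) \<longlonglongrightarrow> l \<Longrightarrow> nrm (completion V) (cls s) = l"
  using nrm_cls_tendsto LIMSEQ_unique by blast

lemma complex_vs_completion: "complex_vs (completion V)"
proof (rule complex_vsI)
  fix \<xi> \<eta> \<zeta> c d
  assume \<xi>: "\<xi> \<in> carrier (completion V)"
  then obtain s where s: "s \<in> cauchy_seqs V" "\<xi> = cls s" by (rule completionE)
  show "c \<odot>\<^bsub>completion V\<^esub> \<xi> \<in> carrier (completion V)"
    "\<zero>\<^bsub>completion V\<^esub> \<oplus>\<^bsub>completion V\<^esub> \<xi> = \<xi>"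
    "(-1) \<odot>\<^bsub>completion V\<^esub> \<xi> \<oplus>\<^bsub>completion V\<^esub> \<xi> = \<zero>\<^bsub>completion V\<^esub>"
    "(c + d) \<odot>\<^bsub>completion V\<^esub> \<xi> = c \<odot>\<^bsub>completion V\<^esub> \<xi> \<oplus>\<^bsub>completion V\<^esub> d \<odot>\<^bsub>completion V\<^esub> \<xi>"
    "(c * d) \<odot>\<^bsub>completion V\<^esub> \<xi> = c \<odot>\<^bsub>completion V\<^esub> (d \<odot>\<^bsub>completion V\<^esub> \<xi>)"
    "1 \<odot>\<^bsub>completion V\<^esub> \<xi> = \<xi>"
    using s(1) by (simp_all add: s(2) cls_add cls_smult zero_completion add_smult)
  assume "\<eta> \<in> carrier (completion V)"
  then obtain t where t: "t \<in> cauchy_seqs V" "\<eta> = cls t" by (rule completionE)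
  show "\<xi> \<oplus>\<^bsub>completion V\<^esub> \<eta> \<in> carrier (completion V)"
    "\<xi> \<oplus>\<^bsub>completion V\<^esub> \<eta> = \<eta> \<oplus>\<^bsub>completion V\<^esub> \<xi>"
    "c \<odot>\<^bsub>completion V\<^esub> (\<xi> \<oplus>\<^bsub>completion V\<^esub> \<eta>)
      = c \<odot>\<^bsub>completion V\<^esub> \<xi> \<oplus>\<^bsub>completion V\<^esub> c \<odot>\<^bsub>completion V\<^esub> \<eta>"
    using s(1) t(1) by (simp_all add: s(2) t(2) cls_add cls_smult smult_add M.a_comm)
  assume "\<zeta> \<in> carrier (completion V)"
  then obtain u where u: "u \<in> cauchy_seqs V" "\<zeta> = cls u" by (rule completionE)
  show "(\<xi> \<oplus>\<^bsub>completion V\<^esub> \<eta>) \<oplus>\<^bsub>completion V\<^esub> \<zeta> = \<xi> \<oplus>\<^bsub>completion V\<^esub> (\<eta> \<oplus>\<^bsub>completion V\<^esub> \<zeta>)"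
    using s(1) t(1) u(1) by (simp add: s(2) t(2) u(2) cls_add M.a_assoc)
qed (simp add: zero_completion)

sublocale C: cvs "completion V"
  by (rule cvs.intro) (rule complex_vs_completion)

lemma cls_minus:
  assumes "s \<in> cauchy_seqs V" "t \<in> cauchy_seqs V"
  shows "cls s \<ominus>\<^bsub>completion V\<^esub> cls t = cls (\<lambda>n. s n \<ominus> t n)"
  using assms by (simp add: C.minus_eq_smult cls_add cls_smult minus_eq_smult)

lemma seminorm_completion: "seminorm (completion V) (nrm (completion V))"
  unfolding seminorm_def
proof (intro conjI ballI allI)
  fix \<xi> \<eta> c
  assume \<xi>: "\<xi> \<in> carrier (completion V)"
  then obtain s where s: "s \<in> cauchy_seqs V" "\<xi> = cls s" by (rule completionE)
  show "0 \<le> nrm (completion V) \<xi>"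
    using nrm_cls_tendsto[OF s(1)] s by (auto intro: LIMSEQ_le_const)
  show "nrm (completion V) (c \<odot>\<^bsub>completion V\<^esub> \<xi>) = cmod c * nrm (completion V) \<xi>"
    using nrm_cls_tendsto[OF s(1)] s
    by (auto simp: cls_smult intro!: nrm_cls_eqI tendsto_mult_left)
  assume "\<eta> \<in> carrier (completion V)"
  then obtain t where t: "t \<in> cauchy_seqs V" "\<eta> = cls t" by (rule completionE)
  show "nrm (completion V) (\<xi> \<oplus>\<^bsub>completion V\<^esub> \<eta>) \<le> nrm (completion V) \<xi> + nrm (completion V) \<eta>"
    unfolding s(2) t(2) cls_add[OF s(1) t(1)]
    by (rule LIMSEQ_le[OF nrm_cls_tendsto tendsto_add[OF nrm_cls_tendsto nrm_cls_tendsto]])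
       (use s(1) t(1) triangle in auto)
qed

lemma snspace_completion: "snspace (completion V)"
  by (rule snspaceI[OF complex_vs_completion seminorm_completion])

lemma nrm_cls_eq_0_iff:
  assumes "s \<in> cauchy_seqs V"
  shows "cls s = \<zero>\<^bsub>completion V\<^esub> \<longleftrightarrow> nrm (completion V) (cls s) = 0"
proof -
  have "cls s = \<zero>\<^bsub>completion V\<^esub> \<longleftrightarrow> (\<lambda>n. nm (s n)) \<longlonglongrightarrow> 0"
    using assms by (simp add: zero_completion cls_eq_iff)
  also have "\<dots> \<longleftrightarrow> nrm (completion V) (cls s) = 0"
    using nrm_cls_tendsto[OF assms] LIMSEQ_unique by fastforce
  finally show ?thesis .
qed

definition embed :: "'a \<Rightarrow> (nat \<Rightarrow> 'a) set" where
  "embed x = cls (\<lambda>_. x)"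

lemma embed_closed [simp]: "x \<in> carrier V \<Longrightarrow> embed x \<in> carrier (completion V)"
  by (simp add: embed_def)

lemma embed_add:
  "x \<in> carrier V \<Longrightarrow> y \<in> carrier V \<Longrightarrow> embed (x \<oplus> y) = embed x \<oplus>\<^bsub>completion V\<^esub> embed y"
  by (simp add: embed_def cls_add)

lemma embed_smult: "x \<in> carrier V \<Longrightarrow> embed (c \<odot> x) = c \<odot>\<^bsub>completion V\<^esub> embed x"
  by (simp add: embed_def cls_smult)

lemma nrm_embed: "x \<in> carrier V \<Longrightarrow> nrm (completion V) (embed x) = nm x"
  unfolding embed_def by (rule nrm_cls_eqI) auto

lemma embed_minus:
  "x \<in> carrier V \<Longrightarrow> y \<in> carrier V \<Longrightarrow> embed (x \<ominus> y) = embed x \<ominus>\<^bsub>completion V\<^esub> embed y"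
  by (simp add: embed_def cls_minus)

text \<open>The uniqueness of extensions to the completion rests on this form of density.\<close>

lemma embed_tendsto_cls:
  assumes s: "s \<in> cauchy_seqs V"
  shows "(\<lambda>k. nrm (completion V) (embed (s k) \<ominus>\<^bsub>completion V\<^esub> cls s)) \<longlonglongrightarrow> 0"
proof (rule LIMSEQ_I)
  interpret C: snspace "completion V" by (rule snspace_completion)
  fix e :: real assume "0 < e"
  then obtain N where N: "\<forall>m\<ge>N. \<forall>n\<ge>N. nm (s m \<ominus> s n) < e/2"
    using s unfolding cauchy_seqs_iff by (meson half_gt_zero)
  have "nrm (completion V) (embed (s k) \<ominus>\<^bsub>completion V\<^esub> cls s) \<le> e/2" if "k \<ge> N" for k
  proof (rule LIMSEQ_le_const2)
    show "(\<lambda>n. nm (s k \<ominus> s n)) \<longlonglongrightarrow> nrm (completion V) (embed (s k) \<ominus>\<^bsub>completion V\<^esub> cls s)"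
      using s by (simp add: embed_def cls_minus nrm_cls_tendsto)
    show "\<exists>N. \<forall>n\<ge>N. nm (s k \<ominus> s n) \<le> e / 2" using N that by (meson less_imp_le)
  qed
  then show "\<exists>N. \<forall>k\<ge>N. norm (nrm (completion V) (embed (s k) \<ominus>\<^bsub>completion V\<^esub> cls s) - 0) < e"
    using \<open>0 < e\<close> s by (intro exI[of _ N]) force
qed

text \<open>
  Given a Cauchy sequence of the completion, choose elements \<open>x k\<close> of \<open>V\<close> within \<open>1 / (k + 1)\<close> of its
  terms. Then \<open>x\<close> is a Cauchy sequence, and its class is the limit.
\<close>

lemma banach_completion: "banach_space (completion V)"
  unfolding banach_space_def
proof (intro conjI ballI impI)
  interpret C: snspace "completion V" by (rule snspace_completion)
  show "complex_vs (completion V)" "seminorm (completion V) (nrm (completion V))"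
    by (rule complex_vs_completion seminorm_completion)+
  show "\<xi> = \<zero>\<^bsub>completion V\<^esub>" if "\<xi> \<in> carrier (completion V)" "nrm (completion V) \<xi> = 0" for \<xi>
    using that nrm_cls_eq_0_iff by (metis completionE)
  fix \<sigma> assume \<sigma>: "\<sigma> \<in> cauchy_seqs (completion V)"
  let ?d = "\<lambda>\<xi> \<eta>. nrm (completion V) (\<xi> \<ominus>\<^bsub>completion V\<^esub> \<eta>)"
  have "\<exists>x\<in>carrier V. ?d (embed x) (\<sigma> k) < inverse (real (Suc k))" for k
  proof -
    obtain s where s: "s \<in> cauchy_seqs V" "\<sigma> k = cls s"
      using C.cauchy_closed[OF \<sigma>] by (rule completionE)
    from order_tendstoD(2)[OF embed_tendsto_cls[OF s(1)], of "inverse (real (Suc k))"]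
    obtain n where "?d (embed (s n)) (cls s) < inverse (real (Suc k))"
      by (auto simp: eventually_sequentially)
    then show ?thesis using s by (auto intro: bexI[of _ "s n"])
  qed
  then obtain x where x: "\<And>k. x k \<in> carrier V"
    and dx: "\<And>k. ?d (embed (x k)) (\<sigma> k) < inverse (real (Suc k))" by metis
  have null: "(\<lambda>k. ?d (embed (x k)) (\<sigma> k)) \<longlonglongrightarrow> 0"
    by (rule Lim_null_comparison[OF _ LIMSEQ_inverse_real_of_nat])
       (use dx x \<sigma> in \<open>auto intro!: always_eventually less_imp_le\<close>)
  have cauchy: "x \<in> cauchy_seqs V"
    unfolding cauchy_seqs_iff
  proof (intro conjI allI impI x)
    fix e :: real assume "0 < e"
    then obtain N where N: "\<forall>m\<ge>N. \<forall>n\<ge>N. ?d (\<sigma> m) (\<sigma> n) < e/3"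
      using \<sigma> unfolding C.cauchy_seqs_iff by (meson zero_less_divide_iff zero_less_numeral)
    obtain N' where N': "\<forall>k\<ge>N'. ?d (embed (x k)) (\<sigma> k) < e/3"
      using order_tendstoD(2)[OF null, of "e/3"] \<open>0 < e\<close> by (auto simp: eventually_sequentially)
    have "nm (x m \<ominus> x n) < e" if mn: "m \<ge> max N N'" "n \<ge> max N N'" for m n
    proof -
      have "nm (x m \<ominus> x n) = ?d (embed (x m)) (embed (x n))"
        using x by (simp add: embed_minus[symmetric] nrm_embed)
      also have "\<dots> \<le> ?d (embed (x m)) (\<sigma> m) + (?d (\<sigma> m) (\<sigma> n) + ?d (\<sigma> n) (embed (x n)))"
        using C.triangle_via[of "embed (x m)" "\<sigma> m" "embed (x n)"]
          C.triangle_via[of "\<sigma> m" "\<sigma> n" "embed (x n)"] x \<sigma> by fastforce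
      also have "\<dots> < e/3 + (e/3 + e/3)"
        using N N' mn x \<sigma> C.minus_sym[of "\<sigma> n" "embed (x n)"] by (intro add_strict_mono) auto
      finally show ?thesis by simp
    qed
    then show "\<exists>N. \<forall>m\<ge>N. \<forall>n\<ge>N. nm (x m \<ominus> x n) < e" by blast
  qed
  have "(\<lambda>k. ?d (embed (x k)) (\<sigma> k) + ?d (embed (x k)) (cls x)) \<longlonglongrightarrow> 0"
    using tendsto_add[OF null embed_tendsto_cls[OF cauchy]] by simp
  then have "(\<lambda>k. ?d (\<sigma> k) (cls x)) \<longlonglongrightarrow> 0"
  proof (rule Lim_null_comparison[rotated])
    show "\<forall>\<^sub>F k in sequentially. norm (?d (\<sigma> k) (cls x)) \<le> ?d (embed (x k)) (\<sigma> k) + ?d (embed (x k)) (cls x)"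
      using C.triangle_via[of "\<sigma> _" "embed (x _)" "cls x"] C.minus_sym[of "\<sigma> _" "embed (x _)"] x \<sigma> cauchy
      by (intro always_eventually) fastforce
  qed
  then show "\<exists>\<xi>\<in>carrier (completion V). (\<lambda>n. ?d (\<sigma> n) \<xi>) \<longlonglongrightarrow> 0"
    using cauchy by (intro bexI[of _ "cls x"]) auto
qed

end

section \<open>Gauges of absolutely convex sets\<close>

context cvs
begin

lemma abs_convexD:
  assumes "abs_convex V B"
  shows "B \<subseteq> carrier V" "B \<noteq> {}"
    and "x \<in> B \<Longrightarrow> y \<in> B \<Longrightarrow> cmod a + cmod b \<le> 1 \<Longrightarrow> a \<odot> x \<oplus> b \<odot> y \<in> B"
  using assms by (auto simp: abs_convex_def)

lemma abs_convex_balanced: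
  assumes "abs_convex V B" "x \<in> B" "cmod c \<le> 1"
  shows "c \<odot> x \<in> B"
proof -
  have "x \<in> carrier V" using assms abs_convexD by blast
  then show ?thesis using abs_convexD(3)[OF assms(1,2,2), of c 0] assms(3) by simp
qed

lemma abs_convex_zero: "abs_convex V B \<Longrightarrow> \<zero> \<in> B"
  using abs_convex_balanced[of B _ 0] abs_convexD[of B] by fastforce

lemma abs_convex_mono_scale:
  assumes B: "abs_convex V B" and "b \<in> B" "0 < r" "r \<le> s"
  shows "\<exists>b'\<in>B. complex_of_real r \<odot> b = complex_of_real s \<odot> b'"
proof
  have "b \<in> carrier V" using assms abs_convexD by blast
  then show "complex_of_real r \<odot> b = complex_of_real s \<odot> (complex_of_real (r / s) \<odot> b)"
    using assms by simp
  show "complex_of_real (r / s) \<odot> b \<in> B"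
    using assms by (intro abs_convex_balanced[OF B]) (auto simp: norm_divide)
qed

lemma abs_convex_scale_add:
  assumes B: "abs_convex V B" and "b \<in> B" "b' \<in> B" "0 < r" "0 < r'"
  shows "\<exists>b''\<in>B. complex_of_real r \<odot> b \<oplus> complex_of_real r' \<odot> b' = complex_of_real (r + r') \<odot> b''"
proof
  have "b \<in> carrier V" "b' \<in> carrier V" using assms abs_convexD by blast+
  moreover have "complex_of_real r + complex_of_real r' \<noteq> 0"
    using assms(4,5) by (metis add_pos_pos less_irrefl of_real_add of_real_eq_0_iff)
  ultimately show "complex_of_real r \<odot> b \<oplus> complex_of_real r' \<odot> b' =
     complex_of_real (r + r') \<odot> (complex_of_real (r / (r + r')) \<odot> b \<oplus> complex_of_real (r' / (r + r')) \<odot> b')"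
    by (simp add: smult_add)
  show "complex_of_real (r / (r + r')) \<odot> b \<oplus> complex_of_real (r' / (r + r')) \<odot> b' \<in> B"
    using assms by (intro abs_convexD(3)[OF B]) (simp_all only: norm_of_real, simp add: add_divide_distrib[symmetric])
qed

lemma abs_convex_scale_smult:
  assumes B: "abs_convex V B" and "b \<in> B" "0 < r" "cmod c * r < s"
  shows "\<exists>b'\<in>B. c \<odot> (complex_of_real r \<odot> b) = complex_of_real s \<odot> b'"
proof
  have s: "0 < s" using assms by (smt (verit) mult_nonneg_nonneg norm_ge_zero)
  have "b \<in> carrier V" using assms abs_convexD by blast
  then show "c \<odot> (complex_of_real r \<odot> b) = complex_of_real s \<odot> ((c * complex_of_real (r / s)) \<odot> b)"
    using s by simp
  show "(c * complex_of_real (r / s)) \<odot> b \<in> B"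
    using assms s by (intro abs_convex_balanced[OF B]) (auto simp: norm_mult norm_divide)
qed

text \<open>
  For an absolutely convex set \<open>B\<close>, the sum of elements of \<open>r B\<close> and \<open>s B\<close> is in \<open>(r + s) B\<close>, and
  multiples of elements of \<open>r B\<close> are in a scaled copy of \<open>B\<close>. So the positive multiples of \<open>B\<close>
  already form the linear hull.
\<close>

lemma scaled_submodule:
  assumes B: "abs_convex V B"
  shows "submodule {complex_of_real r \<odot> b | r b. 0 < r \<and> b \<in> B} complex_ring V"
    (is "submodule ?H _ _")
proof (rule M.submoduleI)
  have BV: "B \<subseteq> carrier V" by (rule abs_convexD[OF B])
  show smult: "c \<odot> x \<in> ?H" if xH: "x \<in> ?H" for c x
  proof -
    obtain r b where x: "x = complex_of_real r \<odot> b" "0 < r" "b \<in> B" using xH by blast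
    define s where "s = cmod c * r + 1"
    have "0 < s" using x(2) by (simp add: s_def add_nonneg_pos)
    moreover obtain b' where "b' \<in> B" "c \<odot> x = complex_of_real s \<odot> b'"
      using abs_convex_scale_smult[OF B x(3,2), of c s] x(1) by (auto simp: s_def)
    ultimately show ?thesis by blast
  qed
  show "?H \<subseteq> carrier V" using BV by auto
  have "\<zero> = complex_of_real 1 \<odot> \<zero>" by simp
  then show "\<zero> \<in> ?H" using abs_convex_zero[OF B] zero_less_one by blast
  show "\<ominus> a \<in> ?H" if "a \<in> ?H" for a
  proof -
    have a: "a \<in> carrier V" using that BV by auto
    then have "\<ominus> a = (-1) \<odot> a" using minus_eq_smult[of \<zero> a] by (simp add: a_minus_def)
    then show ?thesis using smult[OF that, of "-1"] by (simp only:)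
  qed
  show "a \<oplus> b \<in> ?H" if ab: "a \<in> ?H" "b \<in> ?H" for a b
  proof -
    obtain r x s y where xy: "a = complex_of_real r \<odot> x" "0 < r" "x \<in> B"
      "b = complex_of_real s \<odot> y" "0 < s" "y \<in> B" using ab by blast
    then obtain z where "z \<in> B" "a \<oplus> b = complex_of_real (r + s) \<odot> z"
      using abs_convex_scale_add[OF B xy(3,6,2,5)] by blast
    then show ?thesis using add_pos_pos[OF xy(2,5)] by blast
  qed
qed

lemma linear_hull_eq:
  assumes B: "abs_convex V B"
  shows "linear_hull V B = {complex_of_real r \<odot> b | r b. 0 < r \<and> b \<in> B}" (is "_ = ?H")
  unfolding linear_hull_def
proof (rule hull_unique)
  show "B \<subseteq> ?H"
  proof
    fix b assume "b \<in> B"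
    then have "b = complex_of_real 1 \<odot> b" using abs_convexD(1)[OF B] by auto
    then show "b \<in> ?H" using \<open>b \<in> B\<close> zero_less_one by blast
  qed
  show "submodule ?H complex_ring V" by (rule scaled_submodule[OF B])
  show "?H \<subseteq> S" if "B \<subseteq> S" "submodule S complex_ring V" for S
    using that M.submoduleE(4)[OF that(2)] by (auto simp: complex_ring_def)
qed

lemma linear_hull_submodule: "abs_convex V B \<Longrightarrow> submodule (linear_hull V B) complex_ring V"
  by (simp add: linear_hull_eq scaled_submodule)

lemma linear_hull_closed: "abs_convex V B \<Longrightarrow> linear_hull V B \<subseteq> carrier V"
  by (rule M.submoduleE(1)[OF linear_hull_submodule])

lemma subset_linear_hull: "B \<subseteq> linear_hull V B"
  by (simp add: linear_hull_def hull_subset)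

lemma linear_hull_mono: "B \<subseteq> C \<Longrightarrow> linear_hull V B \<subseteq> linear_hull V C"
  by (simp add: linear_hull_def hull_mono)

lemma gauge_bdd: "bdd_below {r. 0 < r \<and> x \<in> (\<lambda>y. complex_of_real r \<odot> y) ` B}"
  by (rule bdd_belowI[of _ 0]) auto

lemma gauge_leI:
  assumes "b \<in> B" "0 < r" "x = complex_of_real r \<odot> b"
  shows "gauge_of V B x \<le> r"
  unfolding gauge_of_def using assms by (intro cInf_lower gauge_bdd) auto

lemma gauge_le_oneI: "abs_convex V B \<Longrightarrow> x \<in> B \<Longrightarrow> gauge_of V B x \<le> 1"
  using gauge_leI[of x B 1 x] abs_convexD(1) by (auto simp: subset_eq)

lemma gauge_lessD:
  assumes B: "abs_convex V B" and "x \<in> linear_hull V B" "gauge_of V B x < r"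
  shows "\<exists>b\<in>B. x = complex_of_real r \<odot> b"
proof -
  have "{r. 0 < r \<and> x \<in> (\<lambda>y. complex_of_real r \<odot> y) ` B} \<noteq> {}"
    using assms(2) linear_hull_eq[OF B] by auto
  from cInf_lessD[OF this assms(3)[unfolded gauge_of_def]]
  obtain s b where "0 < s" "x = complex_of_real s \<odot> b" "b \<in> B" "s < r" by auto
  then show ?thesis using abs_convex_mono_scale[OF B, of b s r] by auto
qed

lemma gauge_nonneg:
  assumes B: "abs_convex V B" and "x \<in> linear_hull V B"
  shows "0 \<le> gauge_of V B x"
  unfolding gauge_of_def using assms(2) linear_hull_eq[OF B] by (intro cInf_greatest) auto

lemma gauge_seminorm:
  assumes B: "abs_convex V B"
  shows "seminorm (V\<lparr>carrier := linear_hull V B\<rparr>) (gauge_of V B)"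
  unfolding seminorm_def
proof (intro conjI ballI allI)
  let ?H = "linear_hull V B"
  fix x y c assume "x \<in> carrier (V\<lparr>carrier := ?H\<rparr>)"
  then have x: "x \<in> ?H" "x \<in> carrier V" using linear_hull_closed[OF B] by auto
  show "0 \<le> gauge_of V B x" by (rule gauge_nonneg[OF B x(1)])
  have le: "gauge_of V B (c \<odot> x) \<le> cmod c * gauge_of V B x" if xH: "x \<in> ?H" for c x
  proof (rule dense_ge)
    fix t assume t: "cmod c * gauge_of V B x < t"
    have "\<exists>r. gauge_of V B x < r \<and> cmod c * r < t"
    proof (cases "c = 0")
      case True
      then show ?thesis using t by (intro exI[of _ "gauge_of V B x + 1"]) simp
    next
      case False
      then show ?thesis
        using t dense[of "gauge_of V B x" "t / cmod c"] by (auto simp: field_simps)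
    qed
    then obtain r where r: "gauge_of V B x < r" "cmod c * r < t" by blast
    have r0: "0 < r" using r(1) gauge_nonneg[OF B xH] by simp
    have "0 \<le> cmod c * r" using r0 by simp
    then have t0: "0 < t" using r(2) by linarith
    obtain b where "b \<in> B" "x = complex_of_real r \<odot> b" using gauge_lessD[OF B xH r(1)] by blast
    then obtain b' where "b' \<in> B" "c \<odot> x = complex_of_real t \<odot> b'"
      using abs_convex_scale_smult[OF B _ r0 r(2)] by blast
    then show "gauge_of V B (c \<odot> x) \<le> t" using t0 gauge_leI by blast
  qed
  show "gauge_of V B (c \<odot>\<^bsub>V\<lparr>carrier := ?H\<rparr>\<^esub> x) = cmod c * gauge_of V B x"
  proof (rule antisym)
    show "cmod c * gauge_of V B x \<le> gauge_of V B (c \<odot>\<^bsub>V\<lparr>carrier := ?H\<rparr>\<^esub> x)"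
    proof (cases "c = 0")
      case True
      have "\<zero> \<in> ?H" using abs_convex_zero[OF B] subset_linear_hull by blast
      then show ?thesis using True x gauge_nonneg[OF B] by simp
    next
      case False
      have "c \<odot> x \<in> ?H"
        using M.submoduleE(4)[OF linear_hull_submodule[OF B], of c x] x by (simp add: complex_ring_def)
      from le[OF this, of "inverse c"] show ?thesis
        using False x by (simp add: norm_divide field_simps)
    qed
  qed (use le[OF x(1)] in simp)
  assume "y \<in> carrier (V\<lparr>carrier := ?H\<rparr>)"
  then have y: "y \<in> ?H" by simp
  have "gauge_of V B (x \<oplus> y) \<le> gauge_of V B x + gauge_of V B y"
  proof (rule field_le_epsilon)
    fix e :: real assume e: "0 < e"
    define r s where "r = gauge_of V B x + e/2" and "s = gauge_of V B y + e/2"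
    have "0 < r" "0 < s" using e gauge_nonneg[OF B] x y by (auto simp: r_def s_def add_nonneg_pos)
    moreover obtain b b' where "b \<in> B" "x = complex_of_real r \<odot> b" "b' \<in> B" "y = complex_of_real s \<odot> b'"
      using gauge_lessD[OF B x(1), of r] gauge_lessD[OF B y, of s] e by (auto simp: r_def s_def)
    ultimately have "gauge_of V B (x \<oplus> y) \<le> r + s"
      using abs_convex_scale_add[OF B, of b b' r s] gauge_leI add_pos_pos by metis
    then show "gauge_of V B (x \<oplus> y) \<le> gauge_of V B x + gauge_of V B y + e" by (simp add: r_def s_def)
  qed
  then show "gauge_of V B (x \<oplus>\<^bsub>V\<lparr>carrier := ?H\<rparr>\<^esub> y) \<le> gauge_of V B x + gauge_of V B y" by simp
qed

lemma gauge_antimono: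
  assumes C: "abs_convex V C" and B: "abs_convex V B" "B \<subseteq> C" "x \<in> linear_hull V B"
  shows "gauge_of V C x \<le> gauge_of V B x"
proof (rule dense_ge)
  fix t assume t: "gauge_of V B x < t"
  then have "0 < t" using gauge_nonneg[OF B(1,3)] by simp
  then show "gauge_of V C x \<le> t" using gauge_lessD[OF B(1,3) t] B(2) gauge_leI by blast
qed

text \<open>
  This comparison turns boundedness of \<open>B\<close> for a family of semi-norms into continuity of the
  inclusion of the space normed by the gauge.
\<close>

lemma seminorm_le_gauge:
  assumes B: "abs_convex V B" and p: "seminorm V p" and "\<And>b. b \<in> B \<Longrightarrow> p b \<le> M"
    and x: "x \<in> linear_hull V B"
  shows "p x \<le> M * gauge_of V B x"
proof -
  interpret p: seminormed V p using p by unfold_locales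
  have M: "0 \<le> M" using assms(3)[OF abs_convex_zero[OF B]] by simp
  show ?thesis
  proof (rule field_le_epsilon)
    fix e :: real assume e: "0 < e"
    define r where "r = gauge_of V B x + e / (M + 1)"
    have "gauge_of V B x < r" using e M by (simp add: r_def)
    then obtain b where b: "b \<in> B" "x = complex_of_real r \<odot> b" using gauge_lessD[OF B x] by blast
    have "0 < r" using gauge_nonneg[OF B x] \<open>gauge_of V B x < r\<close> by simp
    then have "p x \<le> M * r" using b assms(3)[OF b(1)] abs_convexD(1)[OF B] by (auto simp: mult.commute)
    also have "\<dots> \<le> M * gauge_of V B x + e"
      using M e by (simp add: r_def distrib_left field_simps)
    finally show "p x \<le> M * gauge_of V B x + e" .
  qed
qed

end

locale lcs_vs = cvs E for E :: "'a lcs" (structure)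
begin

lemma hull_space_simps [simp]:
  "carrier (hull_space E B) = linear_hull E B"
  "zero (hull_space E B) = \<zero>"
  "add (hull_space E B) = add E"
  "smult (hull_space E B) = smult E"
  "nrm (hull_space E B) = gauge_of E B"
  by (simp_all add: hull_space_def with_norm_def)

lemma snspace_hull_space:
  assumes B: "abs_convex E B"
  shows "snspace (hull_space E B)"
proof (rule snspaceI)
  have vs: "complex_vs (E\<lparr>carrier := linear_hull E B\<rparr>)"
    by (rule submodule_cvs[OF linear_hull_submodule[OF B]])
  show "complex_vs (hull_space E B)" by (rule complex_vs_cong[OF vs]) simp_all
  show "seminorm (hull_space E B) (nrm (hull_space E B))"
    using gauge_seminorm[OF B] by (simp add: seminorm_def)
qed

lemma minus_hull_space:
  assumes B: "abs_convex E B" and "x \<in> linear_hull E B" "y \<in> linear_hull E B"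
  shows "x \<ominus>\<^bsub>hull_space E B\<^esub> y = x \<ominus> y"
proof -
  interpret H: snspace "hull_space E B" by (rule snspace_hull_space[OF B])
  have "x \<in> carrier E" "y \<in> carrier E" using assms linear_hull_closed by blast+
  then show ?thesis using H.minus_eq_smult[of x y] minus_eq_smult[of x y] assms(2,3) by simp
qed

end

section \<open>Spaces of bounded linear maps\<close>

lemma ban_L_simps [simp]:
  "carrier (ban_L V W) = ban_hom V W"
  "zero (ban_L V W) = (\<lambda>x\<in>carrier V. \<zero>\<^bsub>W\<^esub>)"
  "f \<oplus>\<^bsub>ban_L V W\<^esub> g = (\<lambda>x\<in>carrier V. f x \<oplus>\<^bsub>W\<^esub> g x)"
  "c \<odot>\<^bsub>ban_L V W\<^esub> f = (\<lambda>x\<in>carrier V. c \<odot>\<^bsub>W\<^esub> f x)"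
  "nrm (ban_L V W) f = (SUP x\<in>{x \<in> carrier V. nrm V x \<le> 1}. nrm W (f x))"
  by (simp_all add: ban_L_def with_norm_def hom_module_def)

lemma hom_module_complex_vs:
  assumes V: "complex_vs V" and W: "complex_vs W" and H: "H \<subseteq> linear_maps V W"
    and zero: "(\<lambda>x\<in>carrier V. \<zero>\<^bsub>W\<^esub>) \<in> H"
    and add: "\<And>f g. f \<in> H \<Longrightarrow> g \<in> H \<Longrightarrow> (\<lambda>x\<in>carrier V. f x \<oplus>\<^bsub>W\<^esub> g x) \<in> H"
    and smult: "\<And>c f. f \<in> H \<Longrightarrow> (\<lambda>x\<in>carrier V. c \<odot>\<^bsub>W\<^esub> f x) \<in> H"
  shows "complex_vs (hom_module V W H)"
proof -
  interpret W: cvs W by (rule cvs.intro) fact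
  have cl: "f x \<in> carrier W" if "f \<in> H" "x \<in> carrier V" for f x
    using that H by (intro linear_mapsD(1)[of f V W]) auto
  have ext: "f \<in> extensional (carrier V)" if "f \<in> H" for f
    using that H by (intro linear_mapsD(4)[of f V W]) auto
  have und: "f x = undefined" if "f \<in> H" "x \<notin> carrier V" for f x
    using ext[OF that(1)] that(2) by (rule extensional_arb)
  let ?M = "hom_module V W H"
  have M: "carrier ?M = H" "\<zero>\<^bsub>?M\<^esub> = (\<lambda>x\<in>carrier V. \<zero>\<^bsub>W\<^esub>)"
    "\<And>f g. f \<oplus>\<^bsub>?M\<^esub> g = (\<lambda>x\<in>carrier V. f x \<oplus>\<^bsub>W\<^esub> g x)"
    "\<And>c f. c \<odot>\<^bsub>?M\<^esub> f = (\<lambda>x\<in>carrier V. c \<odot>\<^bsub>W\<^esub> f x)"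
    by (simp_all add: hom_module_def)
  show ?thesis
  proof (rule complex_vsI; unfold M)
    fix f g h c d assume f: "f \<in> H"
    show "(\<lambda>x\<in>carrier V. c \<odot>\<^bsub>W\<^esub> f x) \<in> H" by (rule smult[OF f])
    show "(\<lambda>x\<in>carrier V. (\<lambda>x\<in>carrier V. \<zero>\<^bsub>W\<^esub>) x \<oplus>\<^bsub>W\<^esub> f x) = f"
      "(\<lambda>x\<in>carrier V. 1 \<odot>\<^bsub>W\<^esub> f x) = f"
      by (rule HOL.ext, simp add: cl[OF f] und[OF f])+
    show "(\<lambda>x\<in>carrier V. (\<lambda>x\<in>carrier V. (-1) \<odot>\<^bsub>W\<^esub> f x) x \<oplus>\<^bsub>W\<^esub> f x) = (\<lambda>x\<in>carrier V. \<zero>\<^bsub>W\<^esub>)"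
      "(\<lambda>x\<in>carrier V. (c + d) \<odot>\<^bsub>W\<^esub> f x) =
        (\<lambda>x\<in>carrier V. (\<lambda>x\<in>carrier V. c \<odot>\<^bsub>W\<^esub> f x) x \<oplus>\<^bsub>W\<^esub> (\<lambda>x\<in>carrier V. d \<odot>\<^bsub>W\<^esub> f x) x)"
      "(\<lambda>x\<in>carrier V. (c * d) \<odot>\<^bsub>W\<^esub> f x) = (\<lambda>x\<in>carrier V. c \<odot>\<^bsub>W\<^esub> (\<lambda>x\<in>carrier V. d \<odot>\<^bsub>W\<^esub> f x) x)"
      by (rule HOL.ext, simp add: cl[OF f] W.add_smult)+
    assume g: "g \<in> H"
    show "(\<lambda>x\<in>carrier V. f x \<oplus>\<^bsub>W\<^esub> g x) \<in> H" by (rule add[OF f g])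
    show "(\<lambda>x\<in>carrier V. f x \<oplus>\<^bsub>W\<^esub> g x) = (\<lambda>x\<in>carrier V. g x \<oplus>\<^bsub>W\<^esub> f x)"
      "(\<lambda>x\<in>carrier V. c \<odot>\<^bsub>W\<^esub> (\<lambda>x\<in>carrier V. f x \<oplus>\<^bsub>W\<^esub> g x) x) =
        (\<lambda>x\<in>carrier V. (\<lambda>x\<in>carrier V. c \<odot>\<^bsub>W\<^esub> f x) x \<oplus>\<^bsub>W\<^esub> (\<lambda>x\<in>carrier V. c \<odot>\<^bsub>W\<^esub> g x) x)"
      by (rule HOL.ext, simp add: cl[OF f] cl[OF g] W.smult_add W.M.a_comm)+
    assume h: "h \<in> H"
    show "(\<lambda>x\<in>carrier V. (\<lambda>x\<in>carrier V. f x \<oplus>\<^bsub>W\<^esub> g x) x \<oplus>\<^bsub>W\<^esub> h x) =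
        (\<lambda>x\<in>carrier V. f x \<oplus>\<^bsub>W\<^esub> (\<lambda>x\<in>carrier V. g x \<oplus>\<^bsub>W\<^esub> h x) x)"
      by (rule HOL.ext, simp add: cl[OF f] cl[OF g] cl[OF h] W.M.a_assoc)
  qed (rule zero)
qed

lemma linear_map_zero:
  assumes "complex_vs V" "complex_vs W"
  shows "(\<lambda>x\<in>carrier V. \<zero>\<^bsub>W\<^esub>) \<in> linear_maps V W"
proof -
  interpret V: cvs V by (rule cvs.intro) fact
  interpret W: cvs W by (rule cvs.intro) fact
  show ?thesis by (rule linear_mapsI) auto
qed

lemma linear_map_add:
  assumes "complex_vs V" "complex_vs W" and f: "f \<in> linear_maps V W" and g: "g \<in> linear_maps V W"
  shows "(\<lambda>x\<in>carrier V. f x \<oplus>\<^bsub>W\<^esub> g x) \<in> linear_maps V W"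
proof -
  interpret V: cvs V by (rule cvs.intro) fact
  interpret W: cvs W by (rule cvs.intro) fact
  show ?thesis
    by (rule linear_mapsI)
       (simp_all add: linear_mapsD(1-3)[OF f] linear_mapsD(1-3)[OF g] W.M.a_ac W.smult_add)
qed

lemma linear_map_smult:
  assumes "complex_vs V" "complex_vs W" and f: "f \<in> linear_maps V W"
  shows "(\<lambda>x\<in>carrier V. c \<odot>\<^bsub>W\<^esub> f x) \<in> linear_maps V W"
proof -
  interpret V: cvs V by (rule cvs.intro) fact
  interpret W: cvs W by (rule cvs.intro) fact
  show ?thesis
    by (rule linear_mapsI) (simp_all add: linear_mapsD(1-3)[OF f] W.smult_add mult.commute)
qed

locale snspace_pair = V: snspace V + W: snspace W for V :: "'a nspace" and W :: "'b nspace"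
begin

lemmas hom_iff = ban_hom_iff_bounded[OF V.snspace_axioms W.snspace_axioms]

lemma ban_hom_closed: "f \<in> ban_hom V W \<Longrightarrow> x \<in> carrier V \<Longrightarrow> f x \<in> carrier W"
  by (rule linear_mapsD(1)[OF ban_hom_linear])

lemma unit_ball_nonempty: "\<zero>\<^bsub>V\<^esub> \<in> {x \<in> carrier V. nrm V x \<le> 1}"
  by simp

lemma unit_ball_bdd:
  assumes "f \<in> ban_hom V W"
  shows "bdd_above ((\<lambda>x. nrm W (f x)) ` {x \<in> carrier V. nrm V x \<le> 1})"
proof -
  obtain K where K: "K \<ge> 0" "\<And>x. x \<in> carrier V \<Longrightarrow> nrm W (f x) \<le> K * nrm V x"
    using assms[unfolded hom_iff] by blast
  have "nrm W (f x) \<le> K" if "x \<in> carrier V" "nrm V x \<le> 1" for x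
    using K(2)[OF that(1)] mult_left_mono[OF that(2) K(1)] by simp
  then show ?thesis by (auto intro!: bdd_aboveI[of _ K])
qed

lemma ban_L_nrm_le:
  assumes "K \<ge> 0" "\<And>x. x \<in> carrier V \<Longrightarrow> nrm W (f x) \<le> K * nrm V x"
  shows "nrm (ban_L V W) f \<le> K"
  unfolding ban_L_simps
proof (rule cSUP_least)
  show "nrm W (f x) \<le> K" if "x \<in> {x \<in> carrier V. nrm V x \<le> 1}" for x
    using assms(2)[of x] mult_left_mono[of "nrm V x" 1 K] assms(1) that by simp
qed (use unit_ball_nonempty in blast)

lemma nrm_le_ban_L:
  assumes f: "f \<in> ban_hom V W" and x: "x \<in> carrier V"
  shows "nrm W (f x) \<le> nrm (ban_L V W) f * nrm V x"
proof -
  have fl: "f \<in> linear_maps V W" using f by (rule ban_hom_linear)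
  have *: "nrm W (f x) \<le> nrm (ban_L V W) f * t" if t: "nrm V x < t" for t
  proof -
    have t0: "0 < t" using V.nonneg[OF x] t by simp
    have "nrm V (complex_of_real (1/t) \<odot>\<^bsub>V\<^esub> x) \<le> 1" using x t t0 by (simp add: norm_divide)
    then have "nrm W (f (complex_of_real (1/t) \<odot>\<^bsub>V\<^esub> x)) \<le> nrm (ban_L V W) f"
      unfolding ban_L_simps using x by (intro cSUP_upper unit_ball_bdd[OF f]) auto
    then show ?thesis using x t0 linear_mapsD(1,3)[OF fl] by (simp add: norm_divide field_simps)
  qed
  have "(\<lambda>n. nrm (ban_L V W) f * (nrm V x + inverse (real (Suc n)))) \<longlonglongrightarrow> nrm (ban_L V W) f * (nrm V x + 0)"
    by (intro tendsto_intros LIMSEQ_inverse_real_of_nat)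
  moreover have "nrm W (f x) \<le> nrm (ban_L V W) f * (nrm V x + inverse (real (Suc n)))" for n
    by (rule *) simp
  ultimately show ?thesis by (auto intro: LIMSEQ_le_const)
qed

lemma snspace_ban_L: "snspace (ban_L V W)"
proof (rule snspaceI)
  have add: "(\<lambda>x\<in>carrier V. f x \<oplus>\<^bsub>W\<^esub> g x) \<in> ban_hom V W" if f: "f \<in> ban_hom V W" and g: "g \<in> ban_hom V W" for f g
  proof -
    obtain K K' where K: "K \<ge> 0" "\<And>x. x \<in> carrier V \<Longrightarrow> nrm W (f x) \<le> K * nrm V x"
      "K' \<ge> 0" "\<And>x. x \<in> carrier V \<Longrightarrow> nrm W (g x) \<le> K' * nrm V x"
      using f[unfolded hom_iff] g[unfolded hom_iff] by blast
    have "nrm W (f x \<oplus>\<^bsub>W\<^esub> g x) \<le> (K + K') * nrm V x" if "x \<in> carrier V" for x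
      using W.triangle[of "f x" "g x"] K(2)[OF that] K(4)[OF that] ban_hom_closed[OF f that]
        ban_hom_closed[OF g that] by (simp add: distrib_right)
    then show ?thesis
      using K(1,3) f g linear_map_add[OF V.cvs W.cvs] unfolding hom_iff
      by (intro conjI exI[of _ "K + K'"]) auto
  qed
  have smult: "(\<lambda>x\<in>carrier V. c \<odot>\<^bsub>W\<^esub> f x) \<in> ban_hom V W" if f: "f \<in> ban_hom V W" for c f
  proof -
    obtain K where K: "K \<ge> 0" "\<And>x. x \<in> carrier V \<Longrightarrow> nrm W (f x) \<le> K * nrm V x"
      using f[unfolded hom_iff] by blast
    have "nrm W (c \<odot>\<^bsub>W\<^esub> f x) \<le> (cmod c * K) * nrm V x" if "x \<in> carrier V" for x
      using mult_left_mono[OF K(2)[OF that], of "cmod c"] ban_hom_closed[OF f that] by (simp add: mult.assoc)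
    then show ?thesis
      using K(1) f linear_map_smult[OF V.cvs W.cvs] unfolding hom_iff
      by (intro conjI exI[of _ "cmod c * K"]) auto
  qed
  have zero: "(\<lambda>x\<in>carrier V. \<zero>\<^bsub>W\<^esub>) \<in> ban_hom V W"
    unfolding hom_iff using linear_map_zero[OF V.cvs W.cvs] by (intro conjI exI[of _ 0]) auto
  have "complex_vs (hom_module V W (ban_hom V W))"
    by (rule hom_module_complex_vs[OF V.cvs W.cvs]) (auto intro: ban_hom_linear add smult zero)
  then have vs: "complex_vs (ban_L V W)"
    by (rule complex_vs_cong) (simp_all add: ban_L_def with_norm_def)
  then show "complex_vs (ban_L V W)" .
  interpret H: cvs "ban_L V W" by (rule cvs.intro) fact
  show "seminorm (ban_L V W) (nrm (ban_L V W))"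
    unfolding seminorm_def
  proof (intro conjI ballI allI)
    fix f g c assume "f \<in> carrier (ban_L V W)"
    then have f: "f \<in> ban_hom V W" by simp
    have nn: "0 \<le> nrm (ban_L V W) f" if f: "f \<in> ban_hom V W" for f
      unfolding ban_L_simps
      by (rule cSUP_upper2[OF unit_ball_bdd[OF f] unit_ball_nonempty])
         (simp add: ban_hom_closed[OF f])
    then show "0 \<le> nrm (ban_L V W) f" by (simp add: f)
    have le: "nrm (ban_L V W) (c \<odot>\<^bsub>ban_L V W\<^esub> f) \<le> cmod c * nrm (ban_L V W) f"
      if f: "f \<in> ban_hom V W" for c f
      by (rule ban_L_nrm_le)
         (use nn[OF f] nrm_le_ban_L[OF f] ban_hom_closed[OF f] in
           \<open>auto simp del: ban_L_simps(5) simp: mult.assoc intro: mult_left_mono\<close>)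
    show "nrm (ban_L V W) (c \<odot>\<^bsub>ban_L V W\<^esub> f) = cmod c * nrm (ban_L V W) f"
    proof (rule antisym[OF le[OF f]])
      show "cmod c * nrm (ban_L V W) f \<le> nrm (ban_L V W) (c \<odot>\<^bsub>ban_L V W\<^esub> f)"
      proof (cases "c = 0")
        case True
        then show ?thesis using nn[OF smult[OF f, of c]] by simp
      next
        case False
        have "inverse c \<odot>\<^bsub>ban_L V W\<^esub> (c \<odot>\<^bsub>ban_L V W\<^esub> f) = f"
          using f False by (simp del: ban_L_simps(4))
        moreover have "c \<odot>\<^bsub>ban_L V W\<^esub> f \<in> ban_hom V W" using smult[OF f] by simp
        ultimately show ?thesis using le[of "c \<odot>\<^bsub>ban_L V W\<^esub> f" "inverse c"] False
          by (simp del: ban_L_simps add: norm_divide field_simps)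
      qed
    qed
    assume "g \<in> carrier (ban_L V W)"
    then have g: "g \<in> ban_hom V W" by simp
    show "nrm (ban_L V W) (f \<oplus>\<^bsub>ban_L V W\<^esub> g) \<le> nrm (ban_L V W) f + nrm (ban_L V W) g"
    proof (rule ban_L_nrm_le)
      fix x assume x: "x \<in> carrier V"
      show "nrm W ((f \<oplus>\<^bsub>ban_L V W\<^esub> g) x) \<le> (nrm (ban_L V W) f + nrm (ban_L V W) g) * nrm V x"
        using W.triangle[of "f x" "g x"] nrm_le_ban_L[OF f x] nrm_le_ban_L[OF g x] x
          ban_hom_closed[OF f x] ban_hom_closed[OF g x] by (simp del: ban_L_simps(5) add: distrib_right)
    qed (use nn f g in simp)
  qed
qed

end

section \<open>Ind-objects with a realization\<close>

text \<open>
  A realization of an ind-object \<open>Y\<close> is a compatible family of maps from the spaces \<open>Y\<^sub>j\<close> to one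
  set. If these maps are injective for cofinally many \<open>j\<close>, two germs into \<open>Y\<close> are equal in the
  inductive limit iff they have the same realization, so that morphisms into \<open>Y\<close> and their
  composites can be computed on realizations.
\<close>

locale realized_ind =
  fixes Y :: "('j, 'n, 'y) ind" and r :: "'j \<Rightarrow> 'y \<Rightarrow> 'r"
  assumes category: "category (idx Y)"
    and trn_closed: "a \<in> arr (idx Y) \<Longrightarrow> y \<in> carrier (spc Y (src (idx Y) a))
      \<Longrightarrow> trn Y a y \<in> carrier (spc Y (tgt (idx Y) a))"
    and r_trn: "a \<in> arr (idx Y) \<Longrightarrow> y \<in> carrier (spc Y (src (idx Y) a))
      \<Longrightarrow> r (tgt (idx Y) a) (trn Y a y) = r (src (idx Y) a) y"
    and cofinally_inj: "i \<in> obj (idx Y) \<Longrightarrow> j \<in> obj (idx Y)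
      \<Longrightarrow> \<exists>a\<in>arr (idx Y). \<exists>b\<in>arr (idx Y). src (idx Y) a = i \<and> src (idx Y) b = j \<and>
            tgt (idx Y) a = tgt (idx Y) b \<and> inj_on (r (tgt (idx Y) a)) (carrier (spc Y (tgt (idx Y) a)))"

text \<open>
  If the realization is cofinally injective, then the germs over a given map form at most one class
  of the inductive limit; the class exists iff the set is nonempty. This makes it possible to define
  morphisms without choosing representatives.
\<close>

definition germs_over ::
  "('j, 'n, 'y) ind \<Rightarrow> ('j \<Rightarrow> 'y \<Rightarrow> 'r) \<Rightarrow> 'v nspace \<Rightarrow> ('v \<Rightarrow> 'r) \<Rightarrow> ('j \<times> ('v \<Rightarrow> 'y)) set" where
  "germs_over Y r V h = {(j, f). (j, f) \<in> germs V Y \<and> (\<forall>v\<in>carrier V. r j (f v) = h v)}"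

definition mor_over ::
  "('i, 'm, 'x) ind \<Rightarrow> ('j, 'n, 'y) ind \<Rightarrow> ('j \<Rightarrow> 'y \<Rightarrow> 'r) \<Rightarrow> ('i \<Rightarrow> 'x \<Rightarrow> 'r)
    \<Rightarrow> 'i \<Rightarrow> ('j \<times> ('x \<Rightarrow> 'y)) set" where
  "mor_over X Y r h = (\<lambda>i\<in>obj (idx X). germs_over Y r (spc X i) (h i))"

lemma germs_over_cong: "(\<And>v. v \<in> carrier V \<Longrightarrow> h v = h' v) \<Longrightarrow> germs_over Y r V h = germs_over Y r V h'"
  by (auto simp: germs_over_def)

lemma mor_over_cong:
  "(\<And>i v. i \<in> obj (idx X) \<Longrightarrow> v \<in> carrier (spc X i) \<Longrightarrow> h i v = h' i v)
    \<Longrightarrow> mor_over X Y r h = mor_over X Y r h'"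
  unfolding mor_over_def by (intro restrict_ext germs_over_cong)

lemma germs_over_eqD:
  assumes "germs_over Y r V h = germs_over Y r V h'" "germs_over Y r V h \<noteq> {}" "v \<in> carrier V"
  shows "h v = h' v"
proof -
  obtain j f where "(j, f) \<in> germs_over Y r V h" "(j, f) \<in> germs_over Y r V h'"
    using assms(1,2) by auto
  then show ?thesis using assms(3) by (auto simp: germs_over_def)
qed

lemma germs_iff: "(j, f) \<in> germs V Y \<longleftrightarrow> j \<in> obj (idx Y) \<and> f \<in> ban_hom V (spc Y j)"
  by (simp add: germs_def)

lemma ban_hom_apply: "f \<in> ban_hom V W \<Longrightarrow> v \<in> carrier V \<Longrightarrow> f v \<in> carrier W"
  by (rule linear_mapsD(1)[OF ban_hom_linear])

context realized_ind
begin

text \<open>Both germs can be moved to an index at which the realization is injective.\<close>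

lemma germ_rel_iff:
  "((i, f), (j, g)) \<in> germ_rel V Y \<longleftrightarrow>
     (i, f) \<in> germs V Y \<and> (j, g) \<in> germs V Y \<and> (\<forall>v\<in>carrier V. r i (f v) = r j (g v))"
proof
  assume "((i, f), (j, g)) \<in> germ_rel V Y"
  then obtain a b where fg: "(i, f) \<in> germs V Y" "(j, g) \<in> germs V Y"
    and ab: "a \<in> arr (idx Y)" "b \<in> arr (idx Y)" "src (idx Y) a = i" "src (idx Y) b = j"
      "tgt (idx Y) a = tgt (idx Y) b"
    and eq: "compose (carrier V) (trn Y a) f = compose (carrier V) (trn Y b) g"
    unfolding germ_rel_def by blast
  have "r i (f v) = r j (g v)" if v: "v \<in> carrier V" for v
  proof -
    have "trn Y a (f v) = trn Y b (g v)" using fun_cong[OF eq, of v] v by (simp add: compose_def)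
    then show ?thesis
      using r_trn[OF ab(1), of "f v"] r_trn[OF ab(2), of "g v"] fg ab v
      by (auto simp add: germs_iff ban_hom_apply)
  qed
  then show "(i, f) \<in> germs V Y \<and> (j, g) \<in> germs V Y \<and> (\<forall>v\<in>carrier V. r i (f v) = r j (g v))"
    using fg by blast
next
  assume *: "(i, f) \<in> germs V Y \<and> (j, g) \<in> germs V Y \<and> (\<forall>v\<in>carrier V. r i (f v) = r j (g v))"
  then obtain a b where ab: "a \<in> arr (idx Y)" "b \<in> arr (idx Y)" "src (idx Y) a = i" "src (idx Y) b = j"
      "tgt (idx Y) a = tgt (idx Y) b"
      and inj: "inj_on (r (tgt (idx Y) a)) (carrier (spc Y (tgt (idx Y) a)))"
    using cofinally_inj[of i j] by (auto simp: germs_iff)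
  have "trn Y a (f v) = trn Y b (g v)" if v: "v \<in> carrier V" for v
  proof (rule inj_onD[OF inj])
    have fg: "f v \<in> carrier (spc Y i)" "g v \<in> carrier (spc Y j)"
      using * v by (auto simp: germs_iff intro: ban_hom_apply)
    then show "trn Y a (f v) \<in> carrier (spc Y (tgt (idx Y) a))"
      "trn Y b (g v) \<in> carrier (spc Y (tgt (idx Y) a))"
      using trn_closed[OF ab(1), of "f v"] trn_closed[OF ab(2), of "g v"] ab by simp_all
    show "r (tgt (idx Y) a) (trn Y a (f v)) = r (tgt (idx Y) a) (trn Y b (g v))"
      using r_trn[OF ab(1), of "f v"] r_trn[OF ab(2), of "g v"] fg ab v * by simp
  qed
  then have "compose (carrier V) (trn Y a) f = compose (carrier V) (trn Y b) g"
    by (auto simp: compose_def restrict_def)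
  then show "((i, f), (j, g)) \<in> germ_rel V Y"
    using * ab unfolding germ_rel_def by blast
qed

lemma germ_rel_Image:
  assumes "G \<subseteq> germs_over Y r V h" "G \<noteq> {}"
  shows "germ_rel V Y `` G = germs_over Y r V h"
proof -
  obtain i f where f: "(i, f) \<in> G" using assms(2) by auto
  have "(j, g) \<in> germ_rel V Y `` G \<longleftrightarrow> (j, g) \<in> germs_over Y r V h" for j g
  proof
    assume "(j, g) \<in> germ_rel V Y `` G"
    then obtain i' f' where "(i', f') \<in> G" "((i', f'), (j, g)) \<in> germ_rel V Y" by auto
    then show "(j, g) \<in> germs_over Y r V h"
      using assms(1) unfolding germ_rel_iff germs_over_def by auto
  next
    assume "(j, g) \<in> germs_over Y r V h"
    then have "((i, f), (j, g)) \<in> germ_rel V Y"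
      using f assms(1) unfolding germ_rel_iff germs_over_def by auto
    then show "(j, g) \<in> germ_rel V Y `` G" using f by blast
  qed
  then show ?thesis by auto
qed

lemma germs_over_in_colim_hom:
  assumes "germs_over Y r V h \<noteq> {}"
  shows "germs_over Y r V h \<in> colim_hom V Y"
proof -
  obtain i f where f: "(i, f) \<in> germs_over Y r V h" using assms by auto
  then have "germ_rel V Y `` {(i, f)} = germs_over Y r V h" by (intro germ_rel_Image) auto
  moreover have "(i, f) \<in> germs V Y" using f by (simp add: germs_over_def)
  ultimately show ?thesis unfolding colim_hom_def using quotientI by metis
qed

lemma colim_homE:
  assumes "K \<in> colim_hom V Y"
  obtains h where "K = germs_over Y r V h" "K \<noteq> {}"
proof -
  obtain i f where f: "(i, f) \<in> germs V Y" "K = germ_rel V Y `` {(i, f)}"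
    using assms unfolding colim_hom_def quotient_def by auto
  let ?h = "\<lambda>v. r i (f v)"
  have "(i, f) \<in> germs_over Y r V ?h" using f(1) by (simp add: germs_over_def)
  then have "K = germs_over Y r V ?h" "K \<noteq> {}"
    using germ_rel_Image[of "{(i, f)}" V ?h] f(2) by auto
  then show ?thesis by (rule that)
qed

text \<open>
  Restricting a germ along a transition map of the source restricts its realization, so the
  compatibility condition on a morphism is one between realizations.
\<close>

lemma germ_rel_precompose:
  assumes X: "ind_object X" and a: "a \<in> arr (idx X)"
    and ne: "germs_over Y r (spc X (tgt (idx X) a)) h \<noteq> {}"
  shows "germ_rel (spc X (src (idx X) a)) Y ``
      {(j, compose (carrier (spc X (src (idx X) a))) f (trn X a)) | j f.
        (j, f) \<in> germs_over Y r (spc X (tgt (idx X) a)) h}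
    = germs_over Y r (spc X (src (idx X) a)) (\<lambda>x. h (trn X a x))"
proof (rule germ_rel_Image)
  have trn: "trn X a \<in> ban_hom (spc X (src (idx X) a)) (spc X (tgt (idx X) a))"
    using X a by (simp add: ind_object_def)
  have "src (idx X) a \<in> obj (idx X)" using X a by (auto simp: ind_object_def category_def)
  then have vs: "complex_vs (spc X (src (idx X) a))" using X by (simp add: ind_object_def banach_space_def)
  show "{(j, compose (carrier (spc X (src (idx X) a))) f (trn X a)) | j f.
        (j, f) \<in> germs_over Y r (spc X (tgt (idx X) a)) h}
      \<subseteq> germs_over Y r (spc X (src (idx X) a)) (\<lambda>x. h (trn X a x))"
    using ban_hom_compose[OF trn _ vs] ban_hom_apply[OF trn]
    by (auto simp: germs_over_def germs_iff compose_def)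
  obtain j f where "(j, f) \<in> germs_over Y r (spc X (tgt (idx X) a)) h" using ne by auto
  then show "{(j, compose (carrier (spc X (src (idx X) a))) f (trn X a)) | j f.
        (j, f) \<in> germs_over Y r (spc X (tgt (idx X) a)) h} \<noteq> {}"
    by blast
qed

lemma ind_homI:
  assumes X: "ind_object X"
    and ne: "\<And>i. i \<in> obj (idx X) \<Longrightarrow> germs_over Y r (spc X i) (h i) \<noteq> {}"
    and compat: "\<And>a x. a \<in> arr (idx X) \<Longrightarrow> x \<in> carrier (spc X (src (idx X) a))
      \<Longrightarrow> h (tgt (idx X) a) (trn X a x) = h (src (idx X) a) x"
  shows "mor_over X Y r h \<in> ind_hom X Y"
proof -
  have "mor_over X Y r h (src (idx X) a) = germ_rel (spc X (src (idx X) a)) Y ``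
      {(j, compose (carrier (spc X (src (idx X) a))) f (trn X a)) | j f.
        (j, f) \<in> mor_over X Y r h (tgt (idx X) a)}" if a: "a \<in> arr (idx X)" for a
  proof -
    have st: "src (idx X) a \<in> obj (idx X)" "tgt (idx X) a \<in> obj (idx X)"
      using X a by (auto simp: ind_object_def category_def)
    then have "mor_over X Y r h (src (idx X) a)
        = germs_over Y r (spc X (src (idx X) a)) (\<lambda>x. h (tgt (idx X) a) (trn X a x))"
      unfolding mor_over_def by (auto intro!: germs_over_cong simp: compat[OF a])
    also have "\<dots> = germ_rel (spc X (src (idx X) a)) Y ``
      {(j, compose (carrier (spc X (src (idx X) a))) f (trn X a)) | j f.
        (j, f) \<in> germs_over Y r (spc X (tgt (idx X) a)) (h (tgt (idx X) a))}"
      by (rule germ_rel_precompose[symmetric, OF X a ne[OF st(2)]])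
    finally show ?thesis using st by (simp add: mor_over_def)
  qed
  then show ?thesis
    unfolding ind_hom_def using germs_over_in_colim_hom[OF ne] by (auto simp: mor_over_def)
qed

lemma ind_homE:
  assumes X: "ind_object X" and \<phi>: "\<phi> \<in> ind_hom X Y"
  obtains h where "\<phi> = mor_over X Y r h"
    "\<forall>i\<in>obj (idx X). germs_over Y r (spc X i) (h i) \<noteq> {}"
    "\<forall>a\<in>arr (idx X). \<forall>x\<in>carrier (spc X (src (idx X) a)).
       h (tgt (idx X) a) (trn X a x) = h (src (idx X) a) x"
proof -
  have "\<forall>i\<in>obj (idx X). \<exists>h. \<phi> i = germs_over Y r (spc X i) h \<and> \<phi> i \<noteq> {}"
    using \<phi> unfolding ind_hom_def by (auto elim!: colim_homE dest!: PiE_mem)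
  then obtain h where h: "\<And>i. i \<in> obj (idx X) \<Longrightarrow> \<phi> i = germs_over Y r (spc X i) (h i)"
    and ne: "\<And>i. i \<in> obj (idx X) \<Longrightarrow> germs_over Y r (spc X i) (h i) \<noteq> {}"
    by metis
  have "\<phi> \<in> extensional (obj (idx X))" using \<phi> by (auto simp: ind_hom_def PiE_def)
  then have eq: "\<phi> = mor_over X Y r h"
    unfolding mor_over_def using h by (intro extensionalityI) auto
  moreover have "h (tgt (idx X) a) (trn X a x) = h (src (idx X) a) x"
    if a: "a \<in> arr (idx X)" and x: "x \<in> carrier (spc X (src (idx X) a))" for a x
  proof -
    have st: "src (idx X) a \<in> obj (idx X)" "tgt (idx X) a \<in> obj (idx X)"
      using X a by (auto simp: ind_object_def category_def)
    have "germs_over Y r (spc X (src (idx X) a)) (h (src (idx X) a)) = germ_rel (spc X (src (idx X) a)) Y ``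
      {(j, compose (carrier (spc X (src (idx X) a))) f (trn X a)) | j f.
        (j, f) \<in> germs_over Y r (spc X (tgt (idx X) a)) (h (tgt (idx X) a))}"
      using \<phi> a h[OF st(1)] h[OF st(2)] unfolding ind_hom_def by auto
    then have "germs_over Y r (spc X (src (idx X) a)) (h (src (idx X) a))
       = germs_over Y r (spc X (src (idx X) a)) (\<lambda>x. h (tgt (idx X) a) (trn X a x))"
      using germ_rel_precompose[OF X a ne[OF st(2)]] by simp
    from germs_over_eqD[OF this ne[OF st(1)] x] show ?thesis by simp
  qed
  ultimately show ?thesis using ne that by blast
qed

text \<open>
  If \<open>\<psi>\<close> acts on realizations through a map \<open>m\<close>, then all composites of representatives of \<open>\<psi>\<close> and of
  the given morphism have the same realization, hence form one class.
\<close>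

lemma ind_comp_over:
  assumes Z: "realized_ind Z s"
    and vs: "\<And>i. i \<in> obj (idx X) \<Longrightarrow> complex_vs (spc X i)"
    and ne: "\<And>i. i \<in> obj (idx X) \<Longrightarrow> germs_over Y r (spc X i) (h i) \<noteq> {}"
    and \<psi>: "\<And>j. j \<in> obj (idx Y) \<Longrightarrow> \<psi> j \<noteq> {}"
      "\<And>j. j \<in> obj (idx Y) \<Longrightarrow> \<psi> j \<subseteq> germs_over Z s (spc Y j) (\<lambda>y. m (r j y))"
  shows "ind_comp X Z \<psi> (mor_over X Y r h) = mor_over X Z s (\<lambda>i x. m (h i x))"
proof -
  interpret Z: realized_ind Z s by fact
  have "germ_rel (spc X i) Z ``
     {(k, compose (carrier (spc X i)) g f) | j f k g. (j, f) \<in> germs_over Y r (spc X i) (h i) \<and> (k, g) \<in> \<psi> j}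
    = germs_over Z s (spc X i) (\<lambda>x. m (h i x))" (is "_ `` ?G = _") if i: "i \<in> obj (idx X)" for i
  proof (rule Z.germ_rel_Image)
    show "?G \<subseteq> germs_over Z s (spc X i) (\<lambda>x. m (h i x))"
    proof clarify
      fix j f k g assume f: "(j, f) \<in> germs_over Y r (spc X i) (h i)" and g: "(k, g) \<in> \<psi> j"
      then have j: "j \<in> obj (idx Y)" "f \<in> ban_hom (spc X i) (spc Y j)"
        by (auto simp: germs_over_def germs_iff)
      then have "(k, g) \<in> germs_over Z s (spc Y j) (\<lambda>y. m (r j y))" using \<psi>(2) g by blast
      then show "(k, compose (carrier (spc X i)) g f) \<in> germs_over Z s (spc X i) (\<lambda>x. m (h i x))"
        using f ban_hom_compose[OF j(2) _ vs[OF i]] ban_hom_apply[OF j(2)]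
        by (auto simp: germs_over_def germs_iff compose_def)
    qed
    obtain j f where f: "(j, f) \<in> germs_over Y r (spc X i) (h i)" using ne[OF i] by auto
    then have "j \<in> obj (idx Y)" by (auto simp: germs_over_def germs_iff)
    then obtain k g where "(k, g) \<in> \<psi> j" using \<psi>(1) by (metis ex_in_conv surj_pair)
    then show "?G \<noteq> {}" using f by blast
  qed
  then show ?thesis
    unfolding ind_comp_def mor_over_def by (intro restrict_ext) simp
qed

lemma ind_id_over:
  assumes Y: "ind_object Y"
  shows "ind_id Y = mor_over Y Y r r" "\<And>i. i \<in> obj (idx Y) \<Longrightarrow> germs_over Y r (spc Y i) (r i) \<noteq> {}"
proof -
  have id: "(i, \<lambda>x\<in>carrier (spc Y i). x) \<in> germs_over Y r (spc Y i) (r i)" if i: "i \<in> obj (idx Y)" for i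
  proof -
    have "(\<lambda>x\<in>carrier (spc Y i). x) \<in> ban_hom (spc Y i) (spc Y i)"
      using Y i category unfolding ind_object_def category_def by metis
    then show ?thesis using i by (simp add: germs_over_def germs_iff)
  qed
  then show "\<And>i. i \<in> obj (idx Y) \<Longrightarrow> germs_over Y r (spc Y i) (r i) \<noteq> {}" by blast
  show "ind_id Y = mor_over Y Y r r"
    unfolding ind_id_def mor_over_def
    by (rule restrict_ext) (use id in \<open>auto intro!: germ_rel_Image\<close>)
qed

lemma ind_iso_refl:
  assumes Y: "ind_object Y"
  shows "Y \<simeq>\<^sub>I Y"
proof -
  note id = ind_id_over[OF Y]
  have "ind_id Y \<in> ind_hom Y Y"
    unfolding id(1) by (rule ind_homI[OF Y id(2) r_trn])
  moreover have "ind_comp Y Y (ind_id Y) (ind_id Y) = ind_id Y"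
    unfolding id(1)
    using ind_comp_over[where m = "\<lambda>x. x" and \<psi> = "mor_over Y Y r r", OF realized_ind_axioms _ id(2)] Y id(2)
    by (auto simp: ind_object_def banach_space_def mor_over_def)
  ultimately show ?thesis unfolding ind_iso_def by blast
qed

end

section \<open>Families of semi-norms and extension of bounded maps to a completion\<close>

locale seminorm_family = cvs V for V :: "(complex, 'a, 'r) module_scheme" (structure) +
  fixes P :: "('a \<Rightarrow> real) set"
  assumes seminorms: "p \<in> P \<Longrightarrow> seminorm V p"
begin

lemma seminormed: "p \<in> P \<Longrightarrow> seminormed V p"
  using seminorms by unfold_locales

definition pbounded :: "'a set \<Rightarrow> bool" where
  "pbounded B \<longleftrightarrow> B \<subseteq> carrier V \<and> (\<forall>p\<in>P. \<exists>M. \<forall>x\<in>B. p x \<le> M)"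

text \<open>
  These sets are cofinal among the bounded ones and contain the limits of their sequences, and so
  they serve as a substitute for closures of absolutely convex bounded sets.
\<close>

definition level :: "(('a \<Rightarrow> real) \<Rightarrow> real) \<Rightarrow> 'a set" where
  "level M = {x \<in> carrier V. \<forall>p\<in>P. p x \<le> M p}"

lemma pbounded_level: "pbounded (level M)"
  by (auto simp: pbounded_def level_def)

lemma abs_convex_level:
  assumes "\<And>p. p \<in> P \<Longrightarrow> 0 \<le> M p"
  shows "abs_convex V (level M)"
  unfolding abs_convex_def
proof (intro conjI ballI allI impI)
  have "p \<zero> \<le> M p" if "p \<in> P" for p
    using assms[OF that] seminormed.at_zero[OF seminormed[OF that]] by simp
  then have "\<zero> \<in> level M" by (auto simp: level_def)
  then show "level M \<noteq> {}" by blast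
  fix x y a b assume x: "x \<in> level M" and y: "y \<in> level M" and ab: "cmod a + cmod b \<le> 1"
  show "a \<odot> x \<oplus> b \<odot> y \<in> level M"
    unfolding level_def
  proof (intro CollectI conjI ballI)
    have xy: "x \<in> carrier V" "y \<in> carrier V" using x y by (auto simp: level_def)
    then show "a \<odot> x \<oplus> b \<odot> y \<in> carrier V" by simp
    fix p assume p: "p \<in> P"
    interpret p: seminormed V p by (rule seminormed[OF p])
    have "p (a \<odot> x \<oplus> b \<odot> y) \<le> cmod a * p x + cmod b * p y"
      using p.triangle[of "a \<odot> x" "b \<odot> y"] xy by simp
    also have "\<dots> \<le> cmod a * M p + cmod b * M p"
      using x y p by (intro add_mono mult_left_mono) (auto simp: level_def)
    also have "\<dots> \<le> M p"
      using mult_right_mono[OF ab assms[OF p]] by (simp add: distrib_right)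
    finally show "p (a \<odot> x \<oplus> b \<odot> y) \<le> M p" .
  qed
qed (auto simp: level_def)

lemma pbounded_subset_level:
  assumes "pbounded B"
  obtains M where "\<forall>p\<in>P. 0 \<le> M p" "B \<subseteq> level M"
proof -
  have "\<forall>p\<in>P. \<exists>M. \<forall>x\<in>B. p x \<le> M" and BV: "B \<subseteq> carrier V" using assms by (auto simp: pbounded_def)
  then obtain M where M: "\<And>p x. p \<in> P \<Longrightarrow> x \<in> B \<Longrightarrow> p x \<le> M p" by metis
  show ?thesis
    by (rule that[of "\<lambda>p. max 0 (M p)"]) (use M BV in \<open>auto simp: level_def max.coboundedI2\<close>)
qed

lemma pbounded_Un: "pbounded A \<Longrightarrow> pbounded B \<Longrightarrow> pbounded (A \<union> B)"
  unfolding pbounded_def by (simp, metis (full_types) Un_iff max.coboundedI1 max.coboundedI2)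

lemma pbounded_singleton: "x \<in> carrier V \<Longrightarrow> pbounded {x}"
  by (auto simp: pbounded_def)

lemma level_scale:
  assumes "x \<in> carrier V" "0 < t" "\<And>p. p \<in> P \<Longrightarrow> p x \<le> t * M p"
  shows "\<exists>b\<in>level M. x = complex_of_real t \<odot> b"
proof
  show "x = complex_of_real t \<odot> (complex_of_real (1 / t) \<odot> x)" using assms(1,2) by simp
  show "complex_of_real (1 / t) \<odot> x \<in> level M"
    unfolding level_def
  proof (intro CollectI conjI ballI)
    fix p assume p: "p \<in> P"
    show "p (complex_of_real (1 / t) \<odot> x) \<le> M p"
      using seminormed.homogeneous[OF seminormed[OF p] assms(1)] assms(2) assms(3)[OF p]
      by (simp add: norm_divide field_simps)
  qed (use assms(1) in simp)
qed

lemma level_gauge: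
  assumes M: "\<And>p. p \<in> P \<Longrightarrow> 0 \<le> M p"
    and x: "x \<in> carrier V" and t: "0 \<le> t" and le: "\<And>p. p \<in> P \<Longrightarrow> p x \<le> t * M p"
  shows "x \<in> linear_hull V (level M)" "gauge_of V (level M) x \<le> t"
proof -
  have *: "\<exists>b\<in>level M. x = complex_of_real s \<odot> b" if "t < s" for s
  proof (rule level_scale[OF x])
    show "0 < s" using that t by simp
    show "p x \<le> s * M p" if "p \<in> P" for p
      using le[OF that] mult_right_mono[OF less_imp_le[OF \<open>t < s\<close>] M[OF that]] by linarith
  qed
  obtain b where b: "b \<in> level M" "x = complex_of_real (t + 1) \<odot> b" using *[of "t + 1"] by auto
  have "0 < t + 1" using t by simp
  moreover have "abs_convex V (level M)" by (rule abs_convex_level) (rule M)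
  ultimately show "x \<in> linear_hull V (level M)" using b linear_hull_eq by blast
  show "gauge_of V (level M) x \<le> t"
  proof (rule dense_ge)
    fix s assume "t < s"
    then show "gauge_of V (level M) x \<le> s" using *[of s] t gauge_leI[of _ "level M" s x] by auto
  qed
qed

definition plim :: "(nat \<Rightarrow> 'a) \<Rightarrow> 'a \<Rightarrow> bool" where
  "plim s x \<longleftrightarrow> x \<in> carrier V \<and> (\<forall>p\<in>P. (\<lambda>n. p (s n \<ominus> x)) \<longlonglongrightarrow> 0)"

lemma plim_const: "x \<in> carrier V \<Longrightarrow> plim (\<lambda>_. x) x"
  unfolding plim_def
proof (intro conjI ballI)
  fix p assume "x \<in> carrier V" "p \<in> P"
  then show "(\<lambda>n. p (x \<ominus> x)) \<longlonglongrightarrow> 0" by (simp add: seminormed.at_zero[OF seminormed])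
qed

lemma plim_add:
  assumes "\<And>n. s n \<in> carrier V" "\<And>n. t n \<in> carrier V" "plim s x" "plim t y"
  shows "plim (\<lambda>n. s n \<oplus> t n) (x \<oplus> y)"
  unfolding plim_def
proof (intro conjI ballI)
  show "x \<oplus> y \<in> carrier V" using assms by (simp add: plim_def)
  fix p assume p: "p \<in> P"
  interpret p: seminormed V p by (rule seminormed[OF p])
  have "(\<lambda>n. p (s n \<ominus> x) + p (t n \<ominus> y)) \<longlonglongrightarrow> 0"
    using assms(3,4) p tendsto_add[of "\<lambda>n. p (s n \<ominus> x)" 0 _ "\<lambda>n. p (t n \<ominus> y)" 0] by (simp add: plim_def)
  then show "(\<lambda>n. p ((s n \<oplus> t n) \<ominus> (x \<oplus> y))) \<longlonglongrightarrow> 0"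
    by (rule Lim_null_comparison[rotated])
       (use assms in \<open>auto intro!: always_eventually p.add_minus_add_le simp: plim_def M.minus_closed\<close>)
qed

lemma plim_smult:
  assumes "\<And>n. s n \<in> carrier V" "plim s x"
  shows "plim (\<lambda>n. c \<odot> s n) (c \<odot> x)"
  unfolding plim_def
proof (intro conjI ballI)
  show "c \<odot> x \<in> carrier V" using assms by (simp add: plim_def)
  fix p assume p: "p \<in> P"
  interpret p: seminormed V p by (rule seminormed[OF p])
  have "(\<lambda>n. cmod c * p (s n \<ominus> x)) \<longlonglongrightarrow> 0"
    using assms(2) p by (intro tendsto_mult_right_zero) (simp add: plim_def)
  then show "(\<lambda>n. p (c \<odot> s n \<ominus> c \<odot> x)) \<longlonglongrightarrow> 0"
    using assms by (simp add: p.smult_minus_smult plim_def)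
qed

lemma plim_seminorm:
  assumes "\<And>n. s n \<in> carrier V" "plim s x" "p \<in> P"
  shows "(\<lambda>n. p (s n)) \<longlonglongrightarrow> p x"
  using seminormed.tendsto_seminorm[OF seminormed[OF assms(3)] assms(1)] assms(2,3)
  by (simp add: plim_def)

end

locale complete_family = seminorm_family +
  assumes separated: "x \<in> carrier V \<Longrightarrow> (\<And>p. p \<in> P \<Longrightarrow> p x = 0) \<Longrightarrow> x = \<zero>"
    and seq_complete: "(\<And>n. s n \<in> carrier V)
      \<Longrightarrow> (\<And>p e. p \<in> P \<Longrightarrow> 0 < e \<Longrightarrow> \<exists>N. \<forall>m\<ge>N. \<forall>n\<ge>N. p (s m \<ominus> s n) < e) \<Longrightarrow> \<exists>x. plim s x"
begin

lemma plim_unique: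
  assumes s: "\<And>n. s n \<in> carrier V" and "plim s x" "plim s y"
  shows "x = y"
proof (rule eq_if_minus_eq_zero)
  show xy: "x \<in> carrier V" "y \<in> carrier V" using assms by (auto simp: plim_def)
  show "x \<ominus> y = \<zero>"
  proof (rule separated)
    fix p assume p: "p \<in> P"
    interpret p: seminormed V p by (rule seminormed[OF p])
    have "(\<lambda>n. p (s n \<ominus> x) + p (s n \<ominus> y)) \<longlonglongrightarrow> 0 + 0"
      using assms(2,3) p by (intro tendsto_add) (auto simp: plim_def)
    moreover have "p (x \<ominus> y) \<le> p (s n \<ominus> x) + p (s n \<ominus> y)" for n
      using p.triangle_via[of x "s n" y] p.minus_sym[of x "s n"] s xy by simp
    ultimately have "p (x \<ominus> y) \<le> 0" by (auto intro: LIMSEQ_le_const)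
    then show "p (x \<ominus> y) = 0" using xy by (intro antisym p.nonneg) (auto simp: M.minus_closed)
  qed (use xy in \<open>simp add: M.minus_closed\<close>)
qed

end

text \<open>
  The value of the extension of \<open>u\<close> at a class of Cauchy sequences \<open>s\<close> is the limit of \<open>u \<circ> s\<close>.
  It only depends on \<open>u\<close> and the class, not on the semi-normed space that is being completed.
\<close>

definition extend ::
  "(complex, 'a, 'r) module_scheme \<Rightarrow> ('a \<Rightarrow> real) set \<Rightarrow> ('c \<Rightarrow> 'a) \<Rightarrow> (nat \<Rightarrow> 'c) set \<Rightarrow> 'a" where
  "extend V P u \<xi> = (THE y. \<forall>s\<in>\<xi>. seminorm_family.plim V P (\<lambda>n. u (s n)) y)"

locale bounded_map = S: snspace S + V: complete_family V P
  for S :: "'c nspace" and V :: "(complex, 'a, 'r) module_scheme" and P +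
  fixes u :: "'c \<Rightarrow> 'a"
  assumes closed [simp]: "x \<in> carrier S \<Longrightarrow> u x \<in> carrier V"
    and map_add: "x \<in> carrier S \<Longrightarrow> y \<in> carrier S \<Longrightarrow> u (x \<oplus>\<^bsub>S\<^esub> y) = u x \<oplus>\<^bsub>V\<^esub> u y"
    and map_smult: "x \<in> carrier S \<Longrightarrow> u (c \<odot>\<^bsub>S\<^esub> x) = c \<odot>\<^bsub>V\<^esub> u x"
    and bounded: "p \<in> P \<Longrightarrow> \<exists>M. \<forall>x\<in>carrier S. p (u x) \<le> M * nrm S x"
begin

lemma map_minus: "x \<in> carrier S \<Longrightarrow> y \<in> carrier S \<Longrightarrow> u (x \<ominus>\<^bsub>S\<^esub> y) = u x \<ominus>\<^bsub>V\<^esub> u y"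
  by (simp add: S.minus_eq_smult V.minus_eq_smult map_add map_smult)

lemma bounded_pos:
  assumes "p \<in> P"
  obtains M where "0 < M" "\<And>x. x \<in> carrier S \<Longrightarrow> p (u x) \<le> M * nrm S x"
proof -
  obtain M where M: "\<And>x. x \<in> carrier S \<Longrightarrow> p (u x) \<le> M * nrm S x" using bounded[OF assms] by blast
  have "p (u x) \<le> (\<bar>M\<bar> + 1) * nrm S x" if "x \<in> carrier S" for x
    using M[OF that] mult_right_mono[of M "\<bar>M\<bar> + 1" "nrm S x"] S.nonneg[OF that] by linarith
  then show ?thesis using that[of "\<bar>M\<bar> + 1"] by simp
qed

lemma plim_null:
  assumes "\<And>n. s n \<in> carrier S" "x \<in> carrier S" "(\<lambda>n. nrm S (s n \<ominus>\<^bsub>S\<^esub> x)) \<longlonglongrightarrow> 0"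
  shows "V.plim (\<lambda>n. u (s n)) (u x)"
  unfolding V.plim_def
proof (intro conjI ballI)
  fix p assume p: "p \<in> P"
  obtain M where M: "0 < M" "\<And>x. x \<in> carrier S \<Longrightarrow> p (u x) \<le> M * nrm S x" by (rule bounded_pos[OF p]) blast
  interpret p: seminormed V p by (rule V.seminormed[OF p])
  have le: "p (u (s n) \<ominus>\<^bsub>V\<^esub> u x) \<le> M * nrm S (s n \<ominus>\<^bsub>S\<^esub> x)" for n
    using M(2)[of "s n \<ominus>\<^bsub>S\<^esub> x"] assms(1,2) by (simp add: map_minus)
  have "(\<lambda>n. M * nrm S (s n \<ominus>\<^bsub>S\<^esub> x)) \<longlonglongrightarrow> 0" by (rule tendsto_mult_right_zero[OF assms(3)])
  then show "(\<lambda>n. p (u (s n) \<ominus>\<^bsub>V\<^esub> u x)) \<longlonglongrightarrow> 0"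
    by (rule Lim_null_comparison[rotated])
       (use le assms(1,2) in \<open>auto intro!: always_eventually simp: V.M.minus_closed\<close>)
qed (use assms in simp)

lemma plim_cauchy:
  assumes s: "s \<in> cauchy_seqs S"
  shows "\<exists>y. V.plim (\<lambda>n. u (s n)) y"
proof (rule V.seq_complete)
  fix p e assume p: "p \<in> P" and e: "0 < (e::real)"
  obtain M where M: "0 < M" "\<And>x. x \<in> carrier S \<Longrightarrow> p (u x) \<le> M * nrm S x" by (rule bounded_pos[OF p]) blast
  obtain N where N: "\<forall>m\<ge>N. \<forall>n\<ge>N. nrm S (s m \<ominus>\<^bsub>S\<^esub> s n) < e / M"
    using s e M(1) unfolding S.cauchy_seqs_iff by (meson divide_pos_pos)
  have "p (u (s m) \<ominus>\<^bsub>V\<^esub> u (s n)) < e" if mn: "m \<ge> N" "n \<ge> N" for m n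
  proof -
    have "p (u (s m) \<ominus>\<^bsub>V\<^esub> u (s n)) \<le> M * nrm S (s m \<ominus>\<^bsub>S\<^esub> s n)"
      using M(2)[of "s m \<ominus>\<^bsub>S\<^esub> s n"] s by (simp add: map_minus)
    also have "\<dots> < e" using N mn M(1) by (simp add: field_simps)
    finally show ?thesis .
  qed
  then show "\<exists>N. \<forall>m\<ge>N. \<forall>n\<ge>N. p (u (s m) \<ominus>\<^bsub>V\<^esub> u (s n)) < e" by blast
qed (use s in simp)

lemma plim_extend:
  assumes s: "s \<in> cauchy_seqs S"
  shows "V.plim (\<lambda>n. u (s n)) (extend V P u (S.cls s))"
proof -
  obtain y where y: "V.plim (\<lambda>n. u (s n)) y" using plim_cauchy[OF s] by blast
  have all: "V.plim (\<lambda>n. u (t n)) y" if "t \<in> S.cls s" for t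
  proof -
    have t: "t \<in> cauchy_seqs S" "(\<lambda>n. nrm S (s n \<ominus>\<^bsub>S\<^esub> t n)) \<longlonglongrightarrow> 0"
      using that by (auto simp: S.mem_cls_iff S.null_rel_iff)
    have "(\<lambda>n. nrm S ((-1) \<odot>\<^bsub>S\<^esub> (s n \<ominus>\<^bsub>S\<^esub> t n) \<ominus>\<^bsub>S\<^esub> \<zero>\<^bsub>S\<^esub>)) \<longlonglongrightarrow> 0"
      using t s by simp
    from plim_null[OF _ _ this] s t(1)
    have "V.plim (\<lambda>n. (-1) \<odot>\<^bsub>V\<^esub> (u (s n) \<ominus>\<^bsub>V\<^esub> u (t n))) (u \<zero>\<^bsub>S\<^esub>)"
      by (simp add: map_smult map_minus)
    moreover have "u \<zero>\<^bsub>S\<^esub> = \<zero>\<^bsub>V\<^esub>" using map_smult[of "\<zero>\<^bsub>S\<^esub>" 0] closed[of "\<zero>\<^bsub>S\<^esub>"] by simp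
    ultimately have "V.plim (\<lambda>n. u (s n) \<oplus>\<^bsub>V\<^esub> (-1) \<odot>\<^bsub>V\<^esub> (u (s n) \<ominus>\<^bsub>V\<^esub> u (t n))) (y \<oplus>\<^bsub>V\<^esub> \<zero>\<^bsub>V\<^esub>)"
      using s t(1) by (intro V.plim_add[OF _ _ y]) (auto simp: V.M.minus_closed)
    moreover have "x \<oplus>\<^bsub>V\<^esub> (-1) \<odot>\<^bsub>V\<^esub> (x \<ominus>\<^bsub>V\<^esub> z) = z" if xz: "x \<in> carrier V" "z \<in> carrier V" for x z
      by (rule V.linear_combinations[OF xz xz]) simp
    moreover have "y \<in> carrier V" using y by (simp add: V.plim_def)
    ultimately show ?thesis using s t(1) by simp
  qed
  have "extend V P u (S.cls s) = y"
    unfolding extend_def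
  proof (rule the_equality)
    show "\<forall>t\<in>S.cls s. V.plim (\<lambda>n. u (t n)) y" using all by blast
    show "z = y" if "\<forall>t\<in>S.cls s. V.plim (\<lambda>n. u (t n)) z" for z
      using that y s by (intro V.plim_unique[of "\<lambda>n. u (s n)"]) auto
  qed
  then show ?thesis using y by simp
qed

lemma extend_eqI:
  assumes "s \<in> cauchy_seqs S" "V.plim (\<lambda>n. u (s n)) y"
  shows "extend V P u (S.cls s) = y"
  using plim_extend[OF assms(1)] assms by (intro V.plim_unique[of "\<lambda>n. u (s n)"]) auto

lemma extend_embed: "x \<in> carrier S \<Longrightarrow> extend V P u (S.embed x) = u x"
  unfolding S.embed_def by (rule extend_eqI) (auto intro: V.plim_const)

lemma extend_closed: "\<xi> \<in> carrier (completion S) \<Longrightarrow> extend V P u \<xi> \<in> carrier V"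
  by (rule S.completionE, assumption) (use plim_extend in \<open>auto simp: V.plim_def\<close>)

lemma extend_le:
  assumes p: "p \<in> P" and M: "\<And>x. x \<in> carrier S \<Longrightarrow> p (u x) \<le> M * nrm S x"
    and \<xi>: "\<xi> \<in> carrier (completion S)"
  shows "p (extend V P u \<xi>) \<le> M * nrm (completion S) \<xi>"
proof -
  obtain s where s: "s \<in> cauchy_seqs S" "\<xi> = S.cls s" using \<xi> by (rule S.completionE)
  have "(\<lambda>n. p (u (s n))) \<longlonglongrightarrow> p (extend V P u \<xi>)"
    unfolding s(2) by (rule V.plim_seminorm[OF _ plim_extend[OF s(1)] p]) (use s in simp)
  moreover have "(\<lambda>n. M * nrm S (s n)) \<longlonglongrightarrow> M * nrm (completion S) \<xi>"
    unfolding s(2) by (intro tendsto_mult_left S.nrm_cls_tendsto s)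
  ultimately show ?thesis by (rule LIMSEQ_le) (use M s in auto)
qed

lemma bounded_map_extend: "bounded_map (completion S) V P (extend V P u)"
proof -
  interpret C: snspace "completion S" by (rule S.snspace_completion)
  show ?thesis
  proof
    fix \<xi> assume \<xi>: "\<xi> \<in> carrier (completion S)"
    show "extend V P u \<xi> \<in> carrier V" by (rule extend_closed[OF \<xi>])
    obtain s where s: "s \<in> cauchy_seqs S" "\<xi> = S.cls s" using \<xi> by (rule S.completionE)
    show "extend V P u (c \<odot>\<^bsub>completion S\<^esub> \<xi>) = c \<odot>\<^bsub>V\<^esub> extend V P u \<xi>" for c
      unfolding s(2) S.cls_smult[OF s(1)]
      by (rule extend_eqI) (use s V.plim_smult[OF _ plim_extend[OF s(1)]] in \<open>simp_all add: map_smult\<close>)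
    fix \<eta> assume "\<eta> \<in> carrier (completion S)"
    then obtain t where t: "t \<in> cauchy_seqs S" "\<eta> = S.cls t" by (rule S.completionE)
    show "extend V P u (\<xi> \<oplus>\<^bsub>completion S\<^esub> \<eta>) = extend V P u \<xi> \<oplus>\<^bsub>V\<^esub> extend V P u \<eta>"
      unfolding s(2) t(2) S.cls_add[OF s(1) t(1)]
      by (rule extend_eqI)
         (use s t V.plim_add[OF _ _ plim_extend[OF s(1)] plim_extend[OF t(1)]] in \<open>simp_all add: map_add\<close>)
  next
    fix p assume p: "p \<in> P"
    obtain M where "\<And>x. x \<in> carrier S \<Longrightarrow> p (u x) \<le> M * nrm S x" using bounded[OF p] by blast
    from extend_le[OF p this]
    show "\<exists>M. \<forall>\<xi>\<in>carrier (completion S). p (extend V P u \<xi>) \<le> M * nrm (completion S) \<xi>" by blast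
  qed
qed

text \<open>
  Both sides are continuous and agree on the dense image of \<open>S\<close>.
\<close>

lemma extend_unique:
  assumes g: "bounded_map (completion S) V P g"
    and eq: "\<And>x. x \<in> carrier S \<Longrightarrow> g (S.embed x) = u x"
    and \<xi>: "\<xi> \<in> carrier (completion S)"
  shows "g \<xi> = extend V P u \<xi>"
proof -
  interpret g: bounded_map "completion S" V P g by fact
  obtain s where s: "s \<in> cauchy_seqs S" "\<xi> = S.cls s" using \<xi> by (rule S.completionE)
  have "V.plim (\<lambda>n. g (S.embed (s n))) (g \<xi>)"
    unfolding s(2) by (rule g.plim_null[OF _ _ S.embed_tendsto_cls]) (use s in auto)
  then have "V.plim (\<lambda>n. u (s n)) (g \<xi>)" using s by (simp add: eq)
  then show ?thesis unfolding s(2) using extend_eqI s(1) by simp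
qed

end

section \<open>The ind-object of a locally convex space\<close>

lemma category_inclusion: "category (inclusion_category \<B>)"
  by (auto simp: category_def inclusion_category_def)

lemma filtered_inclusion:
  assumes "\<B> \<noteq> {}" "\<And>B C. B \<in> \<B> \<Longrightarrow> C \<in> \<B> \<Longrightarrow> \<exists>D\<in>\<B>. B \<union> C \<subseteq> D"
  shows "filtered (inclusion_category \<B>)"
  unfolding filtered_def
proof (intro conjI ballI impI)
  show "obj (inclusion_category \<B>) \<noteq> {}" using assms(1) by (simp add: inclusion_category_def)
  fix B C assume "B \<in> obj (inclusion_category \<B>)" "C \<in> obj (inclusion_category \<B>)"
  then obtain D where "B \<in> \<B>" "C \<in> \<B>" "D \<in> \<B>" "B \<union> C \<subseteq> D"
    using assms(2)[of B C] by (auto simp: inclusion_category_def)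
  then show "\<exists>a\<in>arr (inclusion_category \<B>). \<exists>b\<in>arr (inclusion_category \<B>).
      src (inclusion_category \<B>) a = B \<and> src (inclusion_category \<B>) b = C \<and>
      tgt (inclusion_category \<B>) a = tgt (inclusion_category \<B>) b"
    by (intro bexI[of _ "(B, D)"] bexI[of _ "(C, D)"]) (auto simp: inclusion_category_def)
next
  fix a b assume "a \<in> arr (inclusion_category \<B>)" "b \<in> arr (inclusion_category \<B>)"
    "src (inclusion_category \<B>) a = src (inclusion_category \<B>) b \<and>
     tgt (inclusion_category \<B>) a = tgt (inclusion_category \<B>) b"
  then show "\<exists>c\<in>arr (inclusion_category \<B>). src (inclusion_category \<B>) c = tgt (inclusion_category \<B>) a \<and>
      cmp (inclusion_category \<B>) c a = cmp (inclusion_category \<B>) c b"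
    by (intro bexI[of _ "(snd a, snd a)"]) (auto simp: inclusion_category_def)
qed

abbreviation disks :: "'a lcs \<Rightarrow> 'a set set" where
  "disks G \<equiv> {B. abs_convex G B \<and> vbounded G B}"

lemma IB_simps [simp]:
  "idx (IB G) = inclusion_category (disks G)"
  "obj (inclusion_category \<B>) = \<B>"
  "arr (inclusion_category \<B>) = {(B, C). B \<in> \<B> \<and> C \<in> \<B> \<and> B \<subseteq> C}"
  "src (inclusion_category \<B>) = fst"
  "tgt (inclusion_category \<B>) = snd"
  "idn (inclusion_category \<B>) B = (B, B)"
  "cmp (inclusion_category \<B>) b a = (fst a, snd b)"
  "spc (IB G) B = completion (hull_space G B)"
  by (simp_all add: IB_def inclusion_category_def)

lemma trn_IB:
  "trn (IB G) (B, C) = (\<lambda>\<xi>\<in>carrier (completion (hull_space G B)). null_rel (hull_space G C) `` \<xi>)"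
  by (simp add: IB_def)

text \<open>
  Of the topology of a locally convex space, \<open>IB\<close> only sees the bounded sets. It is enough to
  describe them by a family of semi-norms.
\<close>

locale bornology_family = lcs_vs G + seminorm_family G P for G :: "'a lcs" (structure) and P +
  assumes vbounded_iff: "vbounded G B \<longleftrightarrow> pbounded B"
begin

lemma level_disk:
  assumes "\<And>p. p \<in> P \<Longrightarrow> 0 \<le> M p"
  shows "level M \<in> disks G"
  using abs_convex_level[of M] assms pbounded_level by (simp add: vbounded_iff)

lemma disk_cofinal:
  assumes "pbounded B"
  obtains M where "\<forall>p\<in>P. 0 \<le> M p" "B \<subseteq> level M" "level M \<in> disks G"
proof -
  obtain M where M: "\<forall>p\<in>P. 0 \<le> M p" "B \<subseteq> level M"
    using assms by (rule pbounded_subset_level)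
  then show ?thesis using that[of M] level_disk[of M] by blast
qed

lemma disk_Un: "B \<in> disks G \<Longrightarrow> C \<in> disks G \<Longrightarrow> \<exists>D\<in>disks G. B \<union> C \<subseteq> D"
  by (rule disk_cofinal[OF pbounded_Un[of B C]]) (auto simp: vbounded_iff)

text \<open>
  The gauge of a larger set is smaller, so Cauchy sequences and null sequences for \<open>B\<close> stay so for \<open>C\<close>,
  and the transition map sends the class of a sequence to the class of the same sequence.
\<close>

lemma trn_cls:
  assumes B: "B \<in> disks G" and C: "C \<in> disks G" and BC: "B \<subseteq> C"
    and s: "s \<in> cauchy_seqs (hull_space G B)"
  shows "s \<in> cauchy_seqs (hull_space G C)"
    and "trn (IB G) (B, C) (snspace.cls (hull_space G B) s) = snspace.cls (hull_space G C) s"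
    and "nrm (completion (hull_space G C)) (snspace.cls (hull_space G C) s)
      \<le> nrm (completion (hull_space G B)) (snspace.cls (hull_space G B) s)"
proof -
  have ac: "abs_convex G B" "abs_convex G C" using B C by auto
  interpret B: snspace "hull_space G B" by (rule snspace_hull_space) fact
  interpret C: snspace "hull_space G C" by (rule snspace_hull_space) fact
  have hull: "x \<in> linear_hull G C" if "x \<in> linear_hull G B" for x
    using linear_hull_mono[OF BC] that by blast
  have le: "gauge_of G C (x \<ominus>\<^bsub>hull_space G C\<^esub> y) \<le> gauge_of G B (x \<ominus>\<^bsub>hull_space G B\<^esub> y)"
    if "x \<in> linear_hull G B" "y \<in> linear_hull G B" for x y
    using gauge_antimono[OF ac(2,1) BC, of "x \<ominus> y"] B.minus_closed[of x y] that hull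
    by (simp add: minus_hull_space[OF ac(1)] minus_hull_space[OF ac(2)])
  have cauchy: "t \<in> cauchy_seqs (hull_space G C)" if t: "t \<in> cauchy_seqs (hull_space G B)" for t
    unfolding C.cauchy_seqs_iff
  proof (intro conjI allI impI)
    have tB: "t n \<in> linear_hull G B" for n using B.cauchy_closed[OF t] by simp
    then show "t n \<in> carrier (hull_space G C)" for n using hull by simp
    fix e :: real assume "0 < e"
    then obtain N where N: "\<forall>m\<ge>N. \<forall>n\<ge>N. gauge_of G B (t m \<ominus>\<^bsub>hull_space G B\<^esub> t n) < e"
      using t unfolding B.cauchy_seqs_iff by auto
    then show "\<exists>N. \<forall>m\<ge>N. \<forall>n\<ge>N. nrm (hull_space G C) (t m \<ominus>\<^bsub>hull_space G C\<^esub> t n) < e"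
      using le[OF tB tB] order_le_less_trans unfolding hull_space_simps by meson
  qed
  then show sC: "s \<in> cauchy_seqs (hull_space G C)" using s .
  have "t \<in> C.cls s" if t: "t \<in> B.cls s" for t
  proof -
    have t': "t \<in> cauchy_seqs (hull_space G B)"
      and lim: "(\<lambda>n. gauge_of G B (s n \<ominus>\<^bsub>hull_space G B\<^esub> t n)) \<longlonglongrightarrow> 0"
      using t by (auto simp: B.mem_cls_iff B.null_rel_iff)
    have stB: "s n \<in> linear_hull G B" "t n \<in> linear_hull G B" for n
      using B.cauchy_closed[OF s] B.cauchy_closed[OF t'] by simp_all
    have nn: "0 \<le> gauge_of G C (s n \<ominus>\<^bsub>hull_space G C\<^esub> t n)" for n
      using C.nonneg[of "s n \<ominus>\<^bsub>hull_space G C\<^esub> t n"] C.minus_closed[of "s n" "t n"] hull stB by simp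
    have "(\<lambda>n. gauge_of G C (s n \<ominus>\<^bsub>hull_space G C\<^esub> t n)) \<longlonglongrightarrow> 0"
      by (rule Lim_null_comparison[OF _ lim]) (use le[OF stB] nn in auto)
    then show ?thesis using sC cauchy[OF t'] by (simp add: C.mem_cls_iff C.null_rel_iff)
  qed
  then have "null_rel (hull_space G C) `` B.cls s = null_rel (hull_space G C) `` {s}"
    using B.self_in_cls[OF s] by (intro equiv_Image_subset[OF C.equiv_null_rel]) (auto simp: C.cls_def)
  then show "trn (IB G) (B, C) (B.cls s) = C.cls s"
    using B.cls_closed[OF s] by (simp add: trn_IB C.cls_def)
  have "gauge_of G C (s n) \<le> gauge_of G B (s n)" for n
    using gauge_antimono[OF ac(2,1) BC, of "s n"] B.cauchy_closed[OF s] by simp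
  then show "nrm (completion (hull_space G C)) (C.cls s) \<le> nrm (completion (hull_space G B)) (B.cls s)"
    by (intro LIMSEQ_le[OF C.nrm_cls_tendsto[OF sC] B.nrm_cls_tendsto[OF s]]) auto
qed

lemma trn_embed:
  assumes B: "B \<in> disks G" and C: "C \<in> disks G" and BC: "B \<subseteq> C" and x: "x \<in> linear_hull G B"
  shows "trn (IB G) (B, C) (snspace.embed (hull_space G B) x) = snspace.embed (hull_space G C) x"
proof -
  interpret B: snspace "hull_space G B" by (rule snspace_hull_space) (use B in simp)
  interpret C: snspace "hull_space G C" by (rule snspace_hull_space) (use C in simp)
  show ?thesis
    using trn_cls(2)[OF B C BC B.cauchy_const[of x]] x by (simp add: B.embed_def C.embed_def)
qed

lemma trn_ban_hom:
  assumes B: "B \<in> disks G" and C: "C \<in> disks G" and BC: "B \<subseteq> C"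
  shows "trn (IB G) (B, C) \<in> ban_hom (completion (hull_space G B)) (completion (hull_space G C))"
proof -
  interpret B: snspace "hull_space G B" by (rule snspace_hull_space) (use B in simp)
  interpret C: snspace "hull_space G C" by (rule snspace_hull_space) (use C in simp)
  note tc = trn_cls[OF B C BC]
  have "trn (IB G) (B, C) \<in> linear_maps (completion (hull_space G B)) (completion (hull_space G C))"
  proof (rule linear_mapsI)
    show "trn (IB G) (B, C) \<in> extensional (carrier (completion (hull_space G B)))"
      by (simp add: trn_IB)
    fix \<xi> \<eta> c assume "\<xi> \<in> carrier (completion (hull_space G B))"
    then obtain s where s: "s \<in> cauchy_seqs (hull_space G B)" "\<xi> = B.cls s" by (rule B.completionE)
    show "trn (IB G) (B, C) \<xi> \<in> carrier (completion (hull_space G C))"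
      using s tc(1,2)[OF s(1)] by simp
    show "trn (IB G) (B, C) (c \<odot>\<^bsub>completion (hull_space G B)\<^esub> \<xi>)
        = c \<odot>\<^bsub>completion (hull_space G C)\<^esub> trn (IB G) (B, C) \<xi>"
      using s(1) tc(1)[OF s(1)] tc(2)[OF s(1)] tc(2)[OF B.cauchy_smult[OF s(1), of c]]
      unfolding s(2) B.cls_smult[OF s(1)] by (simp add: C.cls_smult)
    assume "\<eta> \<in> carrier (completion (hull_space G B))"
    then obtain t where t: "t \<in> cauchy_seqs (hull_space G B)" "\<eta> = B.cls t" by (rule B.completionE)
    show "trn (IB G) (B, C) (\<xi> \<oplus>\<^bsub>completion (hull_space G B)\<^esub> \<eta>)
        = trn (IB G) (B, C) \<xi> \<oplus>\<^bsub>completion (hull_space G C)\<^esub> trn (IB G) (B, C) \<eta>"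
      using tc(1,2)[OF s(1)] tc(1,2)[OF t(1)] tc(2)[OF B.cauchy_add[OF s(1) t(1)]]
      unfolding s(2) t(2) B.cls_add[OF s(1) t(1)] by (simp add: C.cls_add)
  qed
  moreover have "nrm (completion (hull_space G C)) (trn (IB G) (B, C) \<xi>)
      \<le> 1 * nrm (completion (hull_space G B)) \<xi>" if "\<xi> \<in> carrier (completion (hull_space G B))" for \<xi>
    using that tc(2,3) by (auto elim: B.completionE)
  ultimately show ?thesis
    using ban_hom_iff_bounded[OF B.snspace_completion C.snspace_completion] zero_le_one by blast
qed

lemma ind_object_IB: "ind_object (IB G)"
  unfolding ind_object_def
proof (intro conjI ballI impI)
  show "Defs.category (idx (IB G))" by (simp add: category_inclusion)
  have "disks G \<noteq> {}" using level_disk[of "\<lambda>_. 0"] by blast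
  then show "filtered (idx (IB G))" using disk_Un by (simp del: mem_Collect_eq add: filtered_inclusion)
  show "banach_space (spc (IB G) B)" if "B \<in> obj (idx (IB G))" for B
    using that snspace.banach_completion[OF snspace_hull_space] by simp
next
  fix a assume "a \<in> arr (idx (IB G))"
  then show "trn (IB G) a \<in> ban_hom (spc (IB G) (src (idx (IB G)) a)) (spc (IB G) (tgt (idx (IB G)) a))"
    using trn_ban_hom by (cases a) simp
next
  fix B assume B: "B \<in> obj (idx (IB G))"
  interpret B: snspace "hull_space G B" by (rule snspace_hull_space) (use B in simp)
  have "trn (IB G) (B, B) \<xi> = \<xi>" if "\<xi> \<in> carrier (completion (hull_space G B))" for \<xi>
    using that trn_cls(2)[of B B] B by (auto elim: B.completionE)
  then show "trn (IB G) (idn (idx (IB G)) B) = (\<lambda>x\<in>carrier (spc (IB G) B). x)"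
    by (intro extensionalityI[of _ "carrier (completion (hull_space G B))"]) (simp_all add: trn_IB)
next
  fix a b assume a: "a \<in> arr (idx (IB G))" and b: "b \<in> arr (idx (IB G))"
    and ab: "tgt (idx (IB G)) a = src (idx (IB G)) b"
  then obtain B C D where abD: "a = (B, C)" "b = (C, D)" by (metis IB_simps(1,4,5) prod.collapse)
  have BCD: "B \<in> disks G" "C \<in> disks G" "D \<in> disks G" "B \<subseteq> C" "C \<subseteq> D" using a b abD by auto
  interpret B: snspace "hull_space G B" by (rule snspace_hull_space) (use BCD in simp)
  have "trn (IB G) (B, D) \<xi> = trn (IB G) (C, D) (trn (IB G) (B, C) \<xi>)"
    if \<xi>: "\<xi> \<in> carrier (completion (hull_space G B))" for \<xi>
  proof -
    obtain s where s: "s \<in> cauchy_seqs (hull_space G B)" "\<xi> = B.cls s" using \<xi> by (rule B.completionE)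
    show ?thesis
      using trn_cls(1,2)[OF BCD(1,2,4) s(1)] trn_cls(2)[OF BCD(2,3,5), of s] 
        trn_cls(2)[OF BCD(1,3) _ s(1)] BCD(4,5) by (simp add: s(2))
  qed
  then show "trn (IB G) (cmp (idx (IB G)) b a)
      = compose (carrier (spc (IB G) (src (idx (IB G)) a))) (trn (IB G) b) (trn (IB G) a)"
    unfolding abD
    by (intro extensionalityI[of _ "carrier (completion (hull_space G B))"]) (simp_all add: trn_IB[of G B D] compose_def)
qed

end

text \<open>
  The realization of \<open>IB G\<close> in \<open>G\<close> sends a class of Cauchy sequences to their limit in \<open>G\<close>; it extends
  the inclusions of the linear hulls. The index is a dummy, as the limit is the same for all disks.
\<close>

abbreviation realize :: "'a lcs \<Rightarrow> ('a \<Rightarrow> real) set \<Rightarrow> 'i \<Rightarrow> (nat \<Rightarrow> 'a) set \<Rightarrow> 'a" where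
  "realize G P \<equiv> \<lambda>_. extend G P (\<lambda>x. x)"

locale complete_bornology_family = bornology_family + complete_family G P
begin

lemma inclusion_bounded_map:
  assumes B: "B \<in> disks G"
  shows "bounded_map (hull_space G B) G P (\<lambda>x. x)"
proof -
  have ac: "abs_convex G B" and bd: "pbounded B" using B by (auto simp: vbounded_iff)
  interpret B: snspace "hull_space G B" by (rule snspace_hull_space) fact
  show ?thesis
  proof
    show "x \<in> carrier G" if "x \<in> carrier (hull_space G B)" for x
      using that linear_hull_closed[OF ac] by auto
    fix p assume p: "p \<in> P"
    then obtain M where "\<forall>x\<in>B. p x \<le> M" using bd by (auto simp: pbounded_def)
    then have "p x \<le> M * gauge_of G B x" if "x \<in> linear_hull G B" for x
      using seminorm_le_gauge[OF ac seminorms[OF p] _ that] by blast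
    then show "\<exists>M. \<forall>x\<in>carrier (hull_space G B). p x \<le> M * nrm (hull_space G B) x" by auto
  qed simp_all
qed

lemma realize_trn:
  assumes B: "B \<in> disks G" and C: "C \<in> disks G" and BC: "B \<subseteq> C"
    and \<xi>: "\<xi> \<in> carrier (completion (hull_space G B))"
  shows "extend G P (\<lambda>x. x) (trn (IB G) (B, C) \<xi>) = extend G P (\<lambda>x. x) \<xi>"
proof -
  interpret B: bounded_map "hull_space G B" G P "\<lambda>x. x" by (rule inclusion_bounded_map[OF B])
  interpret C: bounded_map "hull_space G C" G P "\<lambda>x. x" by (rule inclusion_bounded_map[OF C])
  obtain s where s: "s \<in> cauchy_seqs (hull_space G B)" "\<xi> = B.S.cls s" using \<xi> by (rule B.S.completionE)
  show ?thesis
    unfolding s(2) trn_cls(2)[OF B C BC s(1)]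
    by (rule C.extend_eqI[OF trn_cls(1)[OF B C BC s(1)] B.plim_extend[OF s(1)]])
qed

text \<open>
  For a general disk the completion may contain nonzero elements that vanish in \<open>G\<close>. For a set
  \<open>level M\<close> it does not: if \<open>s\<close> is a Cauchy sequence for the gauge with limit zero in \<open>G\<close>, then
  \<open>p (s m \<ominus> s n) \<le> e/2 * M p\<close> for all large \<open>m\<close>, \<open>n\<close>, and letting \<open>n\<close> grow gives \<open>p (s m) \<le> e/2 * M p\<close>,
  which says that the gauge of \<open>s m\<close> is at most \<open>e/2\<close>.
\<close>

lemma realize_level_inj:
  assumes M: "\<And>p. p \<in> P \<Longrightarrow> 0 \<le> M p"
  shows "inj_on (extend G P (\<lambda>x. x)) (carrier (completion (hull_space G (level M))))"
proof -
  let ?S = "hull_space G (level M)"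
  have ac: "abs_convex G (level M)" by (rule abs_convex_level) (rule M)
  interpret B: bounded_map ?S G P "\<lambda>x. x" by (rule inclusion_bounded_map[OF level_disk[of M, OF M]])
  interpret E: bounded_map "completion ?S" G P "extend G P (\<lambda>x. x)" by (rule B.bounded_map_extend)
  have zero: "\<xi> = \<zero>\<^bsub>completion ?S\<^esub>"
    if \<xi>: "\<xi> \<in> carrier (completion ?S)" and \<xi>0: "extend G P (\<lambda>x. x) \<xi> = \<zero>" for \<xi>
  proof -
    obtain s where s: "s \<in> cauchy_seqs ?S" "\<xi> = B.S.cls s" using \<xi> by (rule B.S.completionE)
    have sH: "s n \<in> linear_hull G (level M)" for n using B.S.cauchy_closed[OF s(1)] by simp
    then have sG: "s n \<in> carrier G" for n using linear_hull_closed[OF ac] by blast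
    have lim: "plim s \<zero>" using B.plim_extend[OF s(1)] \<xi>0 s(2) by simp
    have "(\<lambda>n. gauge_of G (level M) (s n)) \<longlonglongrightarrow> 0"
    proof (rule LIMSEQ_I)
      fix e :: real assume e: "0 < e"
      have "\<forall>e>0. \<exists>N. \<forall>m\<ge>N. \<forall>n\<ge>N. gauge_of G (level M) (s m \<ominus> s n) < e"
        using s(1) sH unfolding B.S.cauchy_seqs_iff by (simp add: minus_hull_space[OF ac])
      then obtain N where N: "\<forall>m\<ge>N. \<forall>n\<ge>N. gauge_of G (level M) (s m \<ominus> s n) < e/2"
        using half_gt_zero[OF e] by blast
      have "gauge_of G (level M) (s m) \<le> e/2" if m: "m \<ge> N" for m
      proof (rule level_gauge(2)[OF M sG])
        fix p assume p: "p \<in> P"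
        interpret p: seminormed G p by (rule seminormed[OF p])
        have "p (s m \<ominus> s n) \<le> e/2 * M p" if "n \<ge> N" for n
        proof -
          have h: "s m \<ominus> s n \<in> linear_hull G (level M)"
            using B.S.minus_closed[of "s m" "s n"] sH by (simp add: minus_hull_space[OF ac])
          have "p (s m \<ominus> s n) \<le> M p * gauge_of G (level M) (s m \<ominus> s n)"
            using seminorm_le_gauge[OF ac seminorms[OF p] _ h] p by (auto simp: level_def)
          also have "\<dots> \<le> M p * (e/2)" using N m that M[OF p] by (intro mult_left_mono) (auto intro: less_imp_le)
          finally show ?thesis by (simp add: mult.commute)
        qed
        then have le: "p (s m) \<le> e/2 * M p + p (s n)" if "n \<ge> N" for n
          using p.le_add_minus[OF sG[of m] sG[of n]] that by force
        have "(\<lambda>n. e/2 * M p + p (s n)) \<longlonglongrightarrow> e/2 * M p + 0"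
          using lim p sG by (intro tendsto_intros) (simp add: plim_def)
        from LIMSEQ_le_const[OF this, of "p (s m)"] le show "p (s m) \<le> e/2 * M p" by auto
      qed (use e in simp_all)
      then show "\<exists>N. \<forall>m\<ge>N. norm (gauge_of G (level M) (s m) - 0) < e"
        using e gauge_nonneg[OF ac sH] by (intro exI[of _ N]) fastforce
    qed
    then have "nrm (completion ?S) (B.S.cls s) = 0" by (intro B.S.nrm_cls_eqI s) simp
    then show ?thesis using s B.S.nrm_cls_eq_0_iff by simp
  qed
  show ?thesis
  proof (rule inj_onI)
    fix \<xi> \<eta> assume *: "\<xi> \<in> carrier (completion ?S)" "\<eta> \<in> carrier (completion ?S)"
      "extend G P (\<lambda>x. x) \<xi> = extend G P (\<lambda>x. x) \<eta>"
    have "extend G P (\<lambda>x. x) (\<xi> \<ominus>\<^bsub>completion ?S\<^esub> \<eta>) = \<zero>"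
      using *(3) E.closed[OF *(2)] by (simp add: E.map_minus[OF *(1,2)])
    then have "\<xi> \<ominus>\<^bsub>completion ?S\<^esub> \<eta> = \<zero>\<^bsub>completion ?S\<^esub>"
      by (rule zero[OF E.S.minus_closed[OF *(1,2)]])
    then show "\<xi> = \<eta>" by (rule B.S.C.eq_if_minus_eq_zero[OF *(1,2)])
  qed
qed

lemma realized_IB: "realized_ind (IB G) (realize G P)"
proof
  show "Defs.category (idx (IB G))" by (simp add: category_inclusion)
  fix a \<xi> assume a: "a \<in> arr (idx (IB G))" and \<xi>: "\<xi> \<in> carrier (spc (IB G) (src (idx (IB G)) a))"
  obtain B C where BC: "a = (B, C)" by (cases a)
  show "trn (IB G) a \<xi> \<in> carrier (spc (IB G) (tgt (idx (IB G)) a))"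
    using ban_hom_apply[OF trn_ban_hom] a \<xi> BC by simp
  show "extend G P (\<lambda>x. x) (trn (IB G) a \<xi>) = extend G P (\<lambda>x. x) \<xi>"
    using realize_trn a \<xi> BC by simp
next
  fix B C assume "B \<in> obj (idx (IB G))" "C \<in> obj (idx (IB G))"
  then have BC: "B \<in> disks G" "C \<in> disks G" by simp_all
  then have "pbounded (B \<union> C)" by (simp add: pbounded_Un vbounded_iff)
  then obtain M where M: "\<forall>p\<in>P. 0 \<le> M p" "B \<union> C \<subseteq> level M" "level M \<in> disks G"
    by (rule disk_cofinal)
  then show "\<exists>a\<in>arr (idx (IB G)). \<exists>b\<in>arr (idx (IB G)). src (idx (IB G)) a = B \<and> src (idx (IB G)) b = C \<and>
      tgt (idx (IB G)) a = tgt (idx (IB G)) b \<and>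
      inj_on (extend G P (\<lambda>x. x)) (carrier (spc (IB G) (tgt (idx (IB G)) a)))"
    using BC realize_level_inj[of M]
    by (intro bexI[of _ "(B, level M)"] bexI[of _ "(C, level M)"]) auto
qed

text \<open>
  A bounded linear map \<open>h\<close> sends the unit ball into the set \<open>level M\<close> formed with bounds \<open>M\<close> of \<open>h\<close>, and so
  factors through the linear hull of that set.
\<close>

lemma germs_over_IB:
  assumes h: "bounded_map V G P h"
  shows "germs_over (IB G) (realize G P) V h \<noteq> {}"
proof -
  interpret h: bounded_map V G P h by fact
  have "\<forall>p\<in>P. \<exists>M. 0 < M \<and> (\<forall>v\<in>carrier V. p (h v) \<le> M * nrm V v)" using h.bounded_pos by metis
  then obtain M where M: "\<And>p. p \<in> P \<Longrightarrow> 0 < M p" "\<And>p v. p \<in> P \<Longrightarrow> v \<in> carrier V \<Longrightarrow> p (h v) \<le> M p * nrm V v"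
    by metis
  then have M0: "\<And>p. p \<in> P \<Longrightarrow> 0 \<le> M p" by (auto intro: less_imp_le)
  let ?S = "hull_space G (level M)"
  interpret B: bounded_map ?S G P "\<lambda>x. x" by (rule inclusion_bounded_map[OF level_disk[of M, OF M0]])
  have hg: "h v \<in> linear_hull G (level M)" "gauge_of G (level M) (h v) \<le> nrm V v" if v: "v \<in> carrier V" for v
    using level_gauge[of M "h v" "nrm V v"] M0 M(2)[OF _ v] v by (auto simp: mult.commute)
  let ?f = "\<lambda>v\<in>carrier V. B.S.embed (h v)"
  have "?f \<in> linear_maps V (completion ?S)"
    by (rule linear_mapsI)
       (use hg(1) B.S.embed_add[of "h _" "h _"] B.S.embed_smult[of "h _"] in
         \<open>simp_all add: h.map_add h.map_smult\<close>)
  moreover have "\<forall>v\<in>carrier V. nrm (completion ?S) (?f v) \<le> 1 * nrm V v"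
    using hg B.S.nrm_embed by simp
  ultimately have "?f \<in> ban_hom V (completion ?S)"
    using ban_hom_iff_bounded[OF h.S.snspace_axioms B.S.snspace_completion] zero_le_one by blast
  moreover have "level M \<in> disks G" by (rule level_disk) (rule M0)
  ultimately have "(level M, ?f) \<in> germs_over (IB G) (realize G P) V h"
    using hg(1) B.extend_embed by (simp add: germs_over_def germs_iff)
  then show ?thesis by blast
qed

end

section \<open>Inductive limits of spaces of bounded linear maps\<close>

lemma ind_L_simps [simp]:
  "idx (ind_L W Y) = idx Y"
  "spc (ind_L W Y) j = ban_L W (spc Y j)"
  by (simp_all add: ind_L_def)

definition realize_L :: "'w nspace \<Rightarrow> ('j \<Rightarrow> 'y \<Rightarrow> 'r) \<Rightarrow> 'j \<Rightarrow> ('w \<Rightarrow> 'y) \<Rightarrow> 'w \<Rightarrow> 'r" where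
  "realize_L W r j u = (\<lambda>w\<in>carrier W. r j (u w))"

text \<open>
  Composing with an injective realization of \<open>Y\<^sub>j\<close> is injective on the maps from \<open>W\<close> to \<open>Y\<^sub>j\<close>.
\<close>

lemma (in realized_ind) realized_ind_L:
  assumes Y: "ind_object Y" and W: "complex_vs W"
  shows "realized_ind (ind_L W Y) (realize_L W r)"
proof
  show "Defs.category (idx (ind_L W Y))" by (simp add: category)
  fix a u assume "a \<in> arr (idx (ind_L W Y))" "u \<in> carrier (spc (ind_L W Y) (src (idx (ind_L W Y)) a))"
  then have a: "a \<in> arr (idx Y)" and u: "u \<in> ban_hom W (spc Y (src (idx Y) a))" by simp_all
  have trn: "trn (ind_L W Y) a u = compose (carrier W) (trn Y a) u"
    using u by (simp add: ind_L_def)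
  have "trn Y a \<in> ban_hom (spc Y (src (idx Y) a)) (spc Y (tgt (idx Y) a))"
    using Y a by (simp add: ind_object_def)
  then show "trn (ind_L W Y) a u \<in> carrier (spc (ind_L W Y) (tgt (idx (ind_L W Y)) a))"
    unfolding trn using ban_hom_compose[OF u _ W] by simp
  show "realize_L W r (tgt (idx (ind_L W Y)) a) (trn (ind_L W Y) a u)
      = realize_L W r (src (idx (ind_L W Y)) a) u"
    unfolding trn realize_L_def
    by (rule restrict_ext) (use r_trn[OF a] ban_hom_apply[OF u] in \<open>simp add: compose_def\<close>)
next
  fix i j assume "i \<in> obj (idx (ind_L W Y))" "j \<in> obj (idx (ind_L W Y))"
  then obtain a b where ab: "a \<in> arr (idx Y)" "b \<in> arr (idx Y)" "src (idx Y) a = i" "src (idx Y) b = j"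
      "tgt (idx Y) a = tgt (idx Y) b"
      and inj: "inj_on (r (tgt (idx Y) a)) (carrier (spc Y (tgt (idx Y) a)))"
    using cofinally_inj[of i j] by auto
  have "inj_on (realize_L W r (tgt (idx Y) a)) (ban_hom W (spc Y (tgt (idx Y) a)))"
  proof (rule inj_onI)
    fix u v assume u: "u \<in> ban_hom W (spc Y (tgt (idx Y) a))" and v: "v \<in> ban_hom W (spc Y (tgt (idx Y) a))"
      and eq: "realize_L W r (tgt (idx Y) a) u = realize_L W r (tgt (idx Y) a) v"
    show "u = v"
    proof (rule extensionalityI)
      show "u \<in> extensional (carrier W)" "v \<in> extensional (carrier W)"
        using linear_mapsD(4)[OF ban_hom_linear[OF u]] linear_mapsD(4)[OF ban_hom_linear[OF v]] .
      fix w assume w: "w \<in> carrier W"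
      show "u w = v w"
        using fun_cong[OF eq, of w] w
        by (intro inj_onD[OF inj] ban_hom_apply[OF u] ban_hom_apply[OF v]) (simp_all add: realize_L_def)
    qed
  qed
  then show "\<exists>a\<in>arr (idx (ind_L W Y)). \<exists>b\<in>arr (idx (ind_L W Y)).
      src (idx (ind_L W Y)) a = i \<and> src (idx (ind_L W Y)) b = j \<and>
      tgt (idx (ind_L W Y)) a = tgt (idx (ind_L W Y)) b \<and>
      inj_on (realize_L W r (tgt (idx (ind_L W Y)) a)) (carrier (spc (ind_L W Y) (tgt (idx (ind_L W Y)) a)))"
    using ab by (intro bexI[of _ a] bexI[of _ b]) auto
qed

lemma precompose_ban_hom:
  assumes W: "snspace W" and W': "snspace W'" and Z: "snspace Z" and t: "t \<in> ban_hom W W'"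
  shows "(\<lambda>u\<in>ban_hom W' Z. compose (carrier W) u t) \<in> ban_hom (ban_L W' Z) (ban_L W Z)"
proof -
  interpret W: snspace W by fact
  interpret W': snspace W' by fact
  interpret Z: snspace Z by fact
  interpret p: snspace_pair W Z by unfold_locales
  interpret p': snspace_pair W' Z by unfold_locales
  interpret L: snspace "ban_L W' Z" by (rule p'.snspace_ban_L)
  note tl = linear_mapsD[OF ban_hom_linear[OF t]]
  obtain K where K: "K \<ge> 0" "\<And>x. x \<in> carrier W \<Longrightarrow> nrm W' (t x) \<le> K * nrm W x"
    using t[unfolded ban_hom_iff_bounded[OF W W']] by blast
  have comp: "compose (carrier W) u t \<in> ban_hom W Z" if "u \<in> ban_hom W' Z" for u
    by (rule ban_hom_compose[OF t that W.cvs])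
  have "(\<lambda>u\<in>ban_hom W' Z. compose (carrier W) u t) \<in> linear_maps (ban_L W' Z) (ban_L W Z)"
  proof (rule linear_mapsI)
    fix u v c assume "u \<in> carrier (ban_L W' Z)"
    then have u: "u \<in> ban_hom W' Z" by simp
    show "(\<lambda>u\<in>ban_hom W' Z. compose (carrier W) u t) u \<in> carrier (ban_L W Z)"
      using comp u by simp
    show "(\<lambda>u\<in>ban_hom W' Z. compose (carrier W) u t) (c \<odot>\<^bsub>ban_L W' Z\<^esub> u)
        = c \<odot>\<^bsub>ban_L W Z\<^esub> (\<lambda>u\<in>ban_hom W' Z. compose (carrier W) u t) u"
      using L.smult_closed[of u c] u by (auto simp: compose_def tl(1))
    assume "v \<in> carrier (ban_L W' Z)"
    then have v: "v \<in> ban_hom W' Z" by simp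
    show "(\<lambda>u\<in>ban_hom W' Z. compose (carrier W) u t) (u \<oplus>\<^bsub>ban_L W' Z\<^esub> v)
        = (\<lambda>u\<in>ban_hom W' Z. compose (carrier W) u t) u \<oplus>\<^bsub>ban_L W Z\<^esub> (\<lambda>u\<in>ban_hom W' Z. compose (carrier W) u t) v"
      using L.M.a_closed[of u v] u v by (auto simp: compose_def tl(1))
  qed simp
  moreover have "nrm (ban_L W Z) (compose (carrier W) u t) \<le> K * nrm (ban_L W' Z) u"
    if u: "u \<in> ban_hom W' Z" for u
  proof (rule p.ban_L_nrm_le)
    show "0 \<le> K * nrm (ban_L W' Z) u" using K(1) L.nonneg[of u] u by (simp del: ban_L_simps(5))
    fix x assume x: "x \<in> carrier W"
    have "nrm Z (u (t x)) \<le> nrm (ban_L W' Z) u * nrm W' (t x)"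
      by (rule p'.nrm_le_ban_L[OF u tl(1)[OF x]])
    also have "\<dots> \<le> nrm (ban_L W' Z) u * (K * nrm W x)"
      using K(2)[OF x] L.nonneg[of u] u by (intro mult_left_mono) (simp_all del: ban_L_simps(5))
    finally show "nrm Z (compose (carrier W) u t x) \<le> K * nrm (ban_L W' Z) u * nrm W x"
      using x by (simp add: compose_def mult_ac del: ban_L_simps(5))
  qed
  ultimately show ?thesis
    unfolding ban_hom_iff_bounded[OF p'.snspace_ban_L p.snspace_ban_L]
    using K(1) by (auto simp del: ban_L_simps(5))
qed

text \<open>
  On realizations, \<open>ind_L_map X Y a\<close> is the composition of maps \<open>X\<^sub>i\<^sub>' \<rightarrow> R\<close> with the transition map
  \<open>X\<^sub>i \<rightarrow> X\<^sub>i\<^sub>'\<close>.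
\<close>

lemma (in realized_ind) ind_L_map_over:
  assumes Y: "ind_object Y" and X: "ind_object X" and a: "a \<in> arr (idx X)" and j: "j \<in> obj (idx Y)"
  defines "W \<equiv> spc X (src (idx X) a)" and "W' \<equiv> spc X (tgt (idx X) a)"
  shows "ind_L_map X Y a j = germs_over (ind_L W Y) (realize_L W r) (ban_L W' (spc Y j))
      (\<lambda>u. \<lambda>x\<in>carrier W. realize_L W' r j u (trn X a x))" (is "_ = ?R")
    and "ind_L_map X Y a j \<noteq> {}"
proof -
  have st: "src (idx X) a \<in> obj (idx X)" "tgt (idx X) a \<in> obj (idx X)"
    using X a by (auto simp: ind_object_def category_def)
  then have W: "snspace W" "snspace W'" using X by (auto simp: ind_object_def W_def W'_def banach_snspace)
  have Z: "snspace (spc Y j)" using Y j by (auto simp: ind_object_def banach_snspace)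
  have t: "trn X a \<in> ban_hom W W'" using X a by (simp add: ind_object_def W_def W'_def)
  have vs: "complex_vs W" by (rule cvs.cvs) (use W(1) in \<open>simp add: snspace_def seminormed_def\<close>)
  interpret L: realized_ind "ind_L W Y" "realize_L W r" by (rule realized_ind_L[OF Y vs])
  let ?g = "(j, \<lambda>u\<in>carrier (ban_L W' (spc Y j)). compose (carrier W) u (trn X a))"
  have g: "?g \<in> ?R"
    using precompose_ban_hom[OF W Z t] j ban_hom_apply[OF t]
    by (auto simp: germs_over_def germs_iff realize_L_def compose_def intro!: restrict_ext)
  have "germ_rel (ban_L W' (spc Y j)) (ind_L W Y) `` {?g} = ?R"
    by (rule L.germ_rel_Image) (use g in auto)
  then show "ind_L_map X Y a j = ?R" using j by (simp add: ind_L_map_def W_def W'_def)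
  then show "ind_L_map X Y a j \<noteq> {}" using g by blast
qed

section \<open>Bounded bilinear maps\<close>

locale bounded_bilinear_map = V: snspace V + W: snspace W + G: complete_family G P
  for V :: "'v nspace" and W :: "'w nspace" and G :: "(complex, 'a, 'r) module_scheme" and P +
  fixes b :: "'v \<Rightarrow> 'w \<Rightarrow> 'a"
  assumes closed [simp]: "v \<in> carrier V \<Longrightarrow> w \<in> carrier W \<Longrightarrow> b v w \<in> carrier G"
    and add_left: "v \<in> carrier V \<Longrightarrow> v' \<in> carrier V \<Longrightarrow> w \<in> carrier W
      \<Longrightarrow> b (v \<oplus>\<^bsub>V\<^esub> v') w = b v w \<oplus>\<^bsub>G\<^esub> b v' w"
    and smult_left: "v \<in> carrier V \<Longrightarrow> w \<in> carrier W \<Longrightarrow> b (c \<odot>\<^bsub>V\<^esub> v) w = c \<odot>\<^bsub>G\<^esub> b v w"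
    and add_right: "v \<in> carrier V \<Longrightarrow> w \<in> carrier W \<Longrightarrow> w' \<in> carrier W
      \<Longrightarrow> b v (w \<oplus>\<^bsub>W\<^esub> w') = b v w \<oplus>\<^bsub>G\<^esub> b v w'"
    and smult_right: "v \<in> carrier V \<Longrightarrow> w \<in> carrier W \<Longrightarrow> b v (c \<odot>\<^bsub>W\<^esub> w) = c \<odot>\<^bsub>G\<^esub> b v w"
    and bounded: "p \<in> P \<Longrightarrow> \<exists>M. \<forall>v\<in>carrier V. \<forall>w\<in>carrier W. p (b v w) \<le> M * (nrm V v * nrm W w)"
begin

lemma bounded_map_right:
  assumes v: "v \<in> carrier V"
  shows "bounded_map W G P (b v)"
proof
  fix p assume "p \<in> P"
  then obtain M where "\<forall>w\<in>carrier W. p (b v w) \<le> M * (nrm V v * nrm W w)" using bounded v by blast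
  then show "\<exists>M. \<forall>w\<in>carrier W. p (b v w) \<le> M * nrm W w"
    by (intro exI[of _ "M * nrm V v"]) (simp add: mult.assoc)
qed (simp_all add: v add_right smult_right)

end

context complete_bornology_family
begin

text \<open>
  A bounded bilinear map \<open>V \<times> W \<rightarrow> G\<close> sends the product of the unit balls into a set
  \<open>level M\<close>, and so defines a bounded linear map from \<open>V\<close> to the maps from \<open>W\<close> to the completion of
  the hull of that one set.
\<close>

lemma germs_over_ind_L_IB:
  assumes b: "bounded_bilinear_map V W G P b"
  shows "germs_over (ind_L W (IB G)) (realize_L W (realize G P)) V (\<lambda>v. \<lambda>w\<in>carrier W. b v w) \<noteq> {}"
proof -
  interpret b: bounded_bilinear_map V W G P b by fact
  have "\<exists>M. 0 \<le> M \<and> (\<forall>v\<in>carrier V. \<forall>w\<in>carrier W. p (b v w) \<le> M * (nrm V v * nrm W w))" if p: "p \<in> P" for p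
  proof -
    obtain M where M: "\<forall>v\<in>carrier V. \<forall>w\<in>carrier W. p (b v w) \<le> M * (nrm V v * nrm W w)"
      using b.bounded[OF p] by blast
    have "M * (nrm V v * nrm W w) \<le> \<bar>M\<bar> * (nrm V v * nrm W w)" if "v \<in> carrier V" "w \<in> carrier W" for v w
      using that by (intro mult_right_mono) auto
    then have "p (b v w) \<le> \<bar>M\<bar> * (nrm V v * nrm W w)" if "v \<in> carrier V" "w \<in> carrier W" for v w
      using M that order_trans by blast
    then show ?thesis using abs_ge_zero by blast
  qed
  then obtain M where M0: "\<And>p. p \<in> P \<Longrightarrow> 0 \<le> M p"
    and M: "\<And>p v w. p \<in> P \<Longrightarrow> v \<in> carrier V \<Longrightarrow> w \<in> carrier W \<Longrightarrow> p (b v w) \<le> M p * (nrm V v * nrm W w)"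
    by metis
  let ?S = "hull_space G (level M)"
  interpret B: bounded_map ?S G P "\<lambda>x. x" by (rule inclusion_bounded_map[OF level_disk[of M, OF M0]])
  interpret C: snspace "completion ?S" by (rule B.S.snspace_completion)
  interpret WC: snspace_pair W "completion ?S" by unfold_locales
  interpret L: snspace "ban_L W (completion ?S)" by (rule WC.snspace_ban_L)
  have bg: "b v w \<in> linear_hull G (level M)" "gauge_of G (level M) (b v w) \<le> nrm V v * nrm W w"
    if "v \<in> carrier V" "w \<in> carrier W" for v w
    using level_gauge[of M "b v w" "nrm V v * nrm W w"] M0 M[OF _ that] that by (auto simp: mult.commute)
  define g where "g v = (\<lambda>w\<in>carrier W. B.S.embed (b v w))" for v
  have g_le: "nrm (completion ?S) (g v w) \<le> nrm V v * nrm W w" if "v \<in> carrier V" "w \<in> carrier W" for v w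
    using bg that B.S.nrm_embed by (simp add: g_def)
  have g: "g v \<in> ban_hom W (completion ?S)" if v: "v \<in> carrier V" for v
  proof -
    have "g v \<in> linear_maps W (completion ?S)"
      unfolding g_def
      by (rule linear_mapsI)
         (use v bg(1) B.S.embed_add[of "b v _" "b v _"] B.S.embed_smult[of "b v _"] in
           \<open>simp_all add: b.add_right b.smult_right\<close>)
    then show ?thesis using g_le[OF v] v unfolding WC.hom_iff by (intro conjI exI[of _ "nrm V v"]) auto
  qed
  have "restrict g (carrier V) \<in> linear_maps V (ban_L W (completion ?S))"
  proof (rule linear_mapsI)
    fix v v' c assume v: "v \<in> carrier V"
    show "restrict g (carrier V) v \<in> carrier (ban_L W (completion ?S))" using g v by simp
    show "restrict g (carrier V) (c \<odot>\<^bsub>V\<^esub> v) = c \<odot>\<^bsub>ban_L W (completion ?S)\<^esub> restrict g (carrier V) v"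
      using v bg(1) B.S.embed_smult[of "b v _"] by (auto simp: g_def b.smult_left intro!: restrict_ext)
    assume v': "v' \<in> carrier V"
    show "restrict g (carrier V) (v \<oplus>\<^bsub>V\<^esub> v')
        = restrict g (carrier V) v \<oplus>\<^bsub>ban_L W (completion ?S)\<^esub> restrict g (carrier V) v'"
      using v v' bg(1) B.S.embed_add[of "b v _" "b v' _"] by (auto simp: g_def b.add_left intro!: restrict_ext)
  qed simp
  moreover have "\<forall>v\<in>carrier V. nrm (ban_L W (completion ?S)) (restrict g (carrier V) v) \<le> 1 * nrm V v"
    using g_le by (auto intro!: WC.ban_L_nrm_le simp del: ban_L_simps(5))
  ultimately have "restrict g (carrier V) \<in> ban_hom V (ban_L W (completion ?S))"
    using ban_hom_iff_bounded[OF b.V.snspace_axioms L.snspace_axioms] zero_le_one by blast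
  moreover have "level M \<in> disks G" by (rule level_disk) (rule M0)
  ultimately have "(level M, restrict g (carrier V)) \<in>
      germs_over (ind_L W (IB G)) (realize_L W (realize G P)) V (\<lambda>v. \<lambda>w\<in>carrier W. b v w)"
    using bg(1) B.extend_embed
    by (auto simp: germs_over_def germs_iff realize_L_def g_def intro!: restrict_ext)
  then show ?thesis by blast
qed

text \<open>
  Conversely, the norm of \<open>ban_L\<close> bounds the realization of a germ in both variables at once.
\<close>

lemma bounded_bilinear_map_if_germ:
  assumes V: "snspace V" and W: "snspace W"
    and f: "(C, f) \<in> germs_over (ind_L W (IB G)) (realize_L W (realize G P)) V h"
  shows "bounded_bilinear_map V W G P h"
proof -
  interpret V: snspace V by fact
  interpret W: snspace W by fact
  have C: "C \<in> disks G" and fb: "f \<in> ban_hom V (ban_L W (completion (hull_space G C)))"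
    using f by (auto simp: germs_over_def germs_iff)
  let ?S = "hull_space G C"
  interpret B: bounded_map ?S G P "\<lambda>x. x" by (rule inclusion_bounded_map[OF C])
  interpret E: bounded_map "completion ?S" G P "extend G P (\<lambda>x. x)" by (rule B.bounded_map_extend)
  interpret WC: snspace_pair W "completion ?S" by unfold_locales
  interpret L: snspace "ban_L W (completion ?S)" by (rule WC.snspace_ban_L)
  have h: "h v w = extend G P (\<lambda>x. x) (f v w)" if "v \<in> carrier V" "w \<in> carrier W" for v w
    using f that by (auto simp: germs_over_def realize_L_def dest!: bspec fun_cong[of _ _ w])
  note fl = linear_mapsD(1-3)[OF ban_hom_linear[OF fb]]
  have fv: "f v \<in> ban_hom W (completion ?S)" if "v \<in> carrier V" for v using fl(1)[OF that] by simp
  note fvl = linear_mapsD(1-3)[OF ban_hom_linear[OF fv]]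
  obtain K where K: "K \<ge> 0" "\<And>v. v \<in> carrier V \<Longrightarrow> nrm (ban_L W (completion ?S)) (f v) \<le> K * nrm V v"
    using fb[unfolded ban_hom_iff_bounded[OF V WC.snspace_ban_L]] by blast
  show ?thesis
  proof
    fix v v' w w' c assume v: "v \<in> carrier V" and w: "w \<in> carrier W"
    show "h v w \<in> carrier G" using v w by (simp add: h fvl)
    show "h (c \<odot>\<^bsub>V\<^esub> v) w = c \<odot> h v w" using v w by (simp add: h fl fvl E.map_smult)
    show "h v (c \<odot>\<^bsub>W\<^esub> w) = c \<odot> h v w" using v w by (simp add: h fvl E.map_smult)
    show "h (v \<oplus>\<^bsub>V\<^esub> v') w = h v w \<oplus> h v' w" if "v' \<in> carrier V"
      using v w that by (simp add: h fl fvl E.map_add)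
    show "h v (w \<oplus>\<^bsub>W\<^esub> w') = h v w \<oplus> h v w'" if "w' \<in> carrier W"
      using v w that by (simp add: h fvl E.map_add)
  next
    fix p assume p: "p \<in> P"
    obtain M where M: "0 < M" "\<And>\<xi>. \<xi> \<in> carrier (completion ?S) \<Longrightarrow> p (extend G P (\<lambda>x. x) \<xi>) \<le> M * nrm (completion ?S) \<xi>"
      by (rule E.bounded_pos[OF p]) blast
    have "p (h v w) \<le> M * K * (nrm V v * nrm W w)" if v: "v \<in> carrier V" and w: "w \<in> carrier W" for v w
    proof -
      have "p (h v w) \<le> M * nrm (completion ?S) (f v w)" using M(2) fvl(1)[OF v w] by (simp add: h v w)
      also have "\<dots> \<le> M * (nrm (ban_L W (completion ?S)) (f v) * nrm W w)"
        using M(1) WC.nrm_le_ban_L[OF fv[OF v] w] by (intro mult_left_mono) auto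
      also have "\<dots> \<le> M * ((K * nrm V v) * nrm W w)"
        using M(1) K(2)[OF v] w by (intro mult_left_mono mult_right_mono) auto
      finally show ?thesis by (simp add: mult_ac)
    qed
    then show "\<exists>M. \<forall>v\<in>carrier V. \<forall>w\<in>carrier W. p (h v w) \<le> M * (nrm V v * nrm W w)" by blast
  qed
qed

end

section \<open>Continuous semi-norms of a locally convex space\<close>

definition cont_seminorms :: "'a lcs \<Rightarrow> ('a \<Rightarrow> real) set" where
  "cont_seminorms E = {p. seminorm E p \<and> continuous_map (lctop E) euclideanreal p}"

lemma nbhd0_mono: "nbhd0 E N \<Longrightarrow> N \<subseteq> N' \<Longrightarrow> N' \<subseteq> carrier E \<Longrightarrow> nbhd0 E N'"
  unfolding nbhd0_def by blast

locale lc_space = lcs_vs E for E :: "'a lcs" (structure) +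
  assumes locally_convex: "locally_convex E"
begin

lemma topspace [simp]: "topspace (lctop E) = carrier E"
  using locally_convex by (simp add: locally_convex_def)

lemma nbhd0_zero: "nbhd0 E N \<Longrightarrow> \<zero> \<in> N"
  by (auto simp: nbhd0_def)

lemma continuous_translate:
  assumes "x \<in> carrier E"
  shows "continuous_map (lctop E) (lctop E) (\<lambda>y. y \<oplus> x)"
proof -
  have "continuous_map (lctop E) (prod_topology (lctop E) (lctop E)) (\<lambda>y. (y, x))"
    using assms by (intro continuous_map_pairedI) auto
  moreover have "continuous_map (prod_topology (lctop E) (lctop E)) (lctop E) (\<lambda>(x, y). x \<oplus> y)"
    using locally_convex by (simp add: locally_convex_def)
  ultimately have "continuous_map (lctop E) (lctop E) ((\<lambda>(x, y). x \<oplus> y) \<circ> (\<lambda>y. (y, x)))"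
    by (rule continuous_map_compose)
  then show ?thesis by (simp add: o_def)
qed

lemma continuous_smult: "continuous_map (prod_topology euclidean (lctop E)) (lctop E) (\<lambda>(c, x). c \<odot> x)"
  using locally_convex by (simp add: locally_convex_def)

lemma nbhd0_translate:
  assumes "nbhd0 E N" "x \<in> carrier E"
  shows "\<exists>U. openin (lctop E) U \<and> x \<in> U \<and> (\<forall>y\<in>U. y \<in> carrier E \<and> y \<ominus> x \<in> N)"
proof -
  obtain U where U: "openin (lctop E) U" "\<zero> \<in> U" "U \<subseteq> N" using assms(1) by (auto simp: nbhd0_def)
  have "openin (lctop E) {y \<in> carrier E. y \<oplus> (-1) \<odot> x \<in> U}"
    using openin_continuous_map_preimage[OF continuous_translate U(1), of "(-1) \<odot> x"] assms(2) by simp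
  then show ?thesis
    using U assms(2) by (intro exI[of _ "{y \<in> carrier E. y \<oplus> (-1) \<odot> x \<in> U}"]) (auto simp: minus_eq_smult)
qed

lemma nbhd0_if_open:
  assumes "openin (lctop E) U" "x \<in> U"
  shows "nbhd0 E {y \<in> carrier E. y \<oplus> x \<in> U}"
proof -
  have x: "x \<in> carrier E" using assms openin_subset by fastforce
  have "openin (lctop E) {y \<in> carrier E. y \<oplus> x \<in> U}"
    using openin_continuous_map_preimage[OF continuous_translate[OF x] assms(1)] by simp
  then show ?thesis using x assms(2) unfolding nbhd0_def by auto
qed

lemma nbhd0_scale:
  assumes "nbhd0 E N"
  shows "nbhd0 E {y \<in> carrier E. c \<odot> y \<in> N}"
proof -
  obtain U where U: "openin (lctop E) U" "\<zero> \<in> U" "U \<subseteq> N" using assms by (auto simp: nbhd0_def)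
  have "continuous_map (lctop E) (prod_topology euclidean (lctop E)) (\<lambda>y. (c, y))"
    by (intro continuous_map_pairedI) auto
  from continuous_map_compose[OF this continuous_smult]
  have "continuous_map (lctop E) (lctop E) (\<lambda>y. c \<odot> y)" by (simp add: o_def)
  from openin_continuous_map_preimage[OF this U(1)]
  have "openin (lctop E) {y \<in> carrier E. c \<odot> y \<in> U}" by simp
  then show ?thesis
    unfolding nbhd0_def using U(2,3) by (intro conjI exI[of _ "{y \<in> carrier E. c \<odot> y \<in> U}"]) auto
qed

lemma nbhd0_absorbing:
  assumes "nbhd0 E N" "x \<in> carrier E"
  shows "\<exists>t>0. \<exists>a\<in>N. x = complex_of_real t \<odot> a"
proof -
  obtain U where U: "openin (lctop E) U" "\<zero> \<in> U" "U \<subseteq> N" using assms by (auto simp: nbhd0_def)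
  have "continuous_map euclidean (prod_topology euclidean (lctop E)) (\<lambda>c::complex. (c, x))"
    using assms(2) by (intro continuous_map_pairedI) auto
  from continuous_map_compose[OF this continuous_smult]
  have "continuous_map euclidean (lctop E) (\<lambda>c. c \<odot> x)" by (simp add: o_def)
  from openin_continuous_map_preimage[OF this U(1)]
  have "open {c. c \<odot> x \<in> U}" by simp
  moreover have "0 \<in> {c. c \<odot> x \<in> U}" using U(2) assms(2) by simp
  ultimately obtain d where d: "0 < d" "ball 0 d \<subseteq> {c. c \<odot> x \<in> U}"
    using open_contains_ball by blast
  have "complex_of_real (d/2) \<in> ball 0 d" using d(1) by simp
  then have "complex_of_real (d/2) \<odot> x \<in> U" using subsetD[OF d(2)] by blast
  then have "complex_of_real (d/2) \<odot> x \<in> N" by (rule subsetD[OF U(3)])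
  moreover have "x = complex_of_real (2/d) \<odot> (complex_of_real (d/2) \<odot> x)" using d(1) assms(2) by simp
  moreover have "0 < 2/d" using d(1) by simp
  ultimately show ?thesis by (intro exI[of _ "2/d"] conjI bexI[of _ "complex_of_real (d/2) \<odot> x"])
qed

text \<open>
  A convex neighborhood of zero contains an absolutely convex one: the elements all of whose
  multiples by scalars of modulus at most one stay in the given set. Continuity of the scalar
  multiplication at \<open>(0, 0)\<close> makes this set a neighborhood.
\<close>

lemma nbhd0_abs_convex:
  assumes "nbhd0 E N"
  obtains A where "abs_convex E A" "nbhd0 E A" "A \<subseteq> N"
proof -
  obtain C where C: "nbhd0 E C" "convex_subset E C" "C \<subseteq> N"
    using locally_convex assms unfolding locally_convex_def by blast
  obtain U where U: "openin (lctop E) U" "\<zero> \<in> U" "U \<subseteq> C" using C(1) by (auto simp: nbhd0_def)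
  define A where "A = {x \<in> carrier E. \<forall>c. cmod c \<le> 1 \<longrightarrow> c \<odot> x \<in> C}"
  have AC: "A \<subseteq> C"
  proof
    fix x assume "x \<in> A"
    then have "1 \<odot> x \<in> C" "x \<in> carrier E" using norm_one by (auto simp: A_def simp del: one_smult)
    then show "x \<in> C" by simp
  qed
  have zero: "\<zero> \<in> A" using nbhd0_zero[OF C(1)] by (simp add: A_def)
  have "abs_convex E A"
    unfolding abs_convex_def
  proof (intro conjI ballI allI impI)
    fix x y a b assume x: "x \<in> A" and y: "y \<in> A" and ab: "cmod a + cmod b \<le> 1"
    have xy: "x \<in> carrier E" "y \<in> carrier E" using x y by (auto simp: A_def)
    have "c \<odot> (a \<odot> x \<oplus> b \<odot> y) \<in> C" if c: "cmod c \<le> 1" for c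
    proof -
      define t where "t = cmod a"
      have t: "0 \<le> t" "t \<le> 1" "cmod b \<le> 1 - t"
        using ab norm_ge_zero[of b] norm_ge_zero[of a] unfolding t_def by linarith+
      \<comment> \<open>If \<open>t\<close> or \<open>1 - t\<close> vanishes, then so does \<open>a\<close> or \<open>b\<close>, and the value 0 of the division is right.\<close>
      have s1: "c * a / complex_of_real t * complex_of_real t = c * a" by (simp add: t_def)
      have s2: "c * b / complex_of_real (1 - t) * complex_of_real (1 - t) = c * b"
        using t(3) by (cases "1 - t = 0") (auto simp flip: of_real_diff simp del: of_real_diff)
      have n1: "cmod (c * a / complex_of_real t) \<le> 1"
        using c by (simp add: norm_mult norm_divide t_def divide_le_eq_1 mult_le_cancel_right1)
      have n2: "cmod (c * b / complex_of_real (1 - t)) \<le> 1"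
      proof -
        have "cmod c * cmod b \<le> 1 * (1 - t)" by (rule mult_mono[OF c t(3)]) auto
        then show ?thesis using t(2) by (auto simp: norm_mult norm_divide divide_le_eq_1 simp del: of_real_diff)
      qed
      have "(complex_of_real t \<odot> ((c * a / complex_of_real t) \<odot> x)) \<oplus>
          (complex_of_real (1 - t) \<odot> ((c * b / complex_of_real (1 - t)) \<odot> y)) \<in> C"
        using C(2) x y n1 n2 t(1,2) unfolding convex_subset_def A_def by blast
      moreover have "complex_of_real t \<odot> ((c * a / complex_of_real t) \<odot> x) = c \<odot> (a \<odot> x)"
        using xy s1 by (simp add: mult.commute)
      moreover have "complex_of_real (1 - t) \<odot> ((c * b / complex_of_real (1 - t)) \<odot> y) = c \<odot> (b \<odot> y)"
        using xy s2 by (simp add: mult.commute del: of_real_diff)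
      ultimately show ?thesis using xy by (simp add: smult_add)
    qed
    then show "a \<odot> x \<oplus> b \<odot> y \<in> A" using xy by (simp add: A_def)
  qed (use zero in \<open>auto simp: A_def\<close>)
  moreover have "nbhd0 E A"
  proof -
    from openin_continuous_map_preimage[OF continuous_smult U(1)]
    have op: "openin (prod_topology euclidean (lctop E)) {z \<in> UNIV \<times> carrier E. (case z of (c, x) \<Rightarrow> c \<odot> x) \<in> U}"
      by simp
    have mem: "(0, \<zero>) \<in> {z \<in> UNIV \<times> carrier E. (case z of (c, x) \<Rightarrow> c \<odot> x) \<in> U}" using U(2) by simp
    from openin_prod_topology_alt[THEN iffD1, rule_format, OF op mem]
    obtain D W where "openin euclidean D" and D0: "0 \<in> D" and W: "openin (lctop E) W" "\<zero> \<in> W"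
      and DW: "D \<times> W \<subseteq> {z \<in> UNIV \<times> carrier E. (case z of (c, x) \<Rightarrow> c \<odot> x) \<in> U}" by auto
    then have D: "open D" "0 \<in> D" by simp_all
    obtain d where d: "0 < d" "ball 0 d \<subseteq> D" using D by (auto simp: open_contains_ball)
    have "nbhd0 E W" using W openin_subset unfolding nbhd0_def by fastforce
    from nbhd0_scale[OF this, of "complex_of_real (2/d)"] show ?thesis
    proof (rule nbhd0_mono)
      show "{y \<in> carrier E. complex_of_real (2/d) \<odot> y \<in> W} \<subseteq> A"
      proof (clarsimp simp: A_def simp del: of_real_divide)
        fix y c assume y: "y \<in> carrier E" "complex_of_real (2/d) \<odot> y \<in> W" and c: "cmod c \<le> 1"
        have "cmod (c * complex_of_real (d/2)) < d"
          using c d(1) mult_right_mono[OF c, of "d/2"] by (simp add: norm_mult)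
        then have "c * complex_of_real (d/2) \<in> D" using d(2) by auto
        then have "(c * complex_of_real (d/2)) \<odot> (complex_of_real (2/d) \<odot> y) \<in> U"
          using subsetD[OF DW, of "(c * complex_of_real (d/2), complex_of_real (2/d) \<odot> y)"] y(2) by simp
        moreover have "(c * complex_of_real (d/2)) \<odot> (complex_of_real (2/d) \<odot> y) = c \<odot> y"
          using y(1) d(1) by simp
        ultimately show "c \<odot> y \<in> C" using subsetD[OF U(3)] by simp
      qed
    qed (auto simp: A_def)
  qed
  ultimately show thesis using that AC C(3) by blast
qed

lemma seminorm_continuousI:
  assumes p: "seminorm E p" and nb: "\<And>e. 0 < e \<Longrightarrow> nbhd0 E {x \<in> carrier E. p x < e}"
  shows "p \<in> cont_seminorms E"
proof -
  interpret p: seminormed E p using p by unfold_locales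
  have "\<exists>U. openin (lctop E) U \<and> x \<in> U \<and> (\<forall>y\<in>U. p y \<in> ball (p x) e)" if x: "x \<in> carrier E" and e: "0 < e" for x e
  proof -
    obtain U where U: "openin (lctop E) U" "x \<in> U" "\<And>y. y \<in> U \<Longrightarrow> y \<in> carrier E \<and> p (y \<ominus> x) < e"
      using nbhd0_translate[OF nb[OF e] x] by auto
    have "p y \<in> ball (p x) e" if "y \<in> U" for y
      using p.abs_diff_le[of y x] U(3)[OF that] x by (auto simp: dist_real_def abs_minus_commute)
    then show ?thesis using U by blast
  qed
  then have "continuous_map (lctop E) euclideanreal p"
    using Met_TC.continuous_map_to_metric[of "lctop E" p] by (simp add: mtopology_is_euclidean)
  then show ?thesis using p by (simp add: cont_seminorms_def)
qed

lemma nbhd0_seminorm_ball: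
  assumes "p \<in> cont_seminorms E" "0 < e"
  shows "nbhd0 E {x \<in> carrier E. p x < e}"
proof -
  interpret p: seminormed E p using assms(1) unfolding cont_seminorms_def by unfold_locales blast
  have "openin (lctop E) {x \<in> topspace (lctop E). p x \<in> {..<e}}"
    using assms(1) by (intro openin_continuous_map_preimage[of _ euclideanreal]) (auto simp: cont_seminorms_def)
  then show ?thesis using assms(2) unfolding nbhd0_def by auto
qed

text \<open>
  The semi-norm is the gauge of an absolutely convex neighborhood contained in \<open>N\<close>.
\<close>

lemma nbhd0_contains_seminorm_ball:
  assumes "nbhd0 E N"
  obtains p where "p \<in> cont_seminorms E" "{x \<in> carrier E. p x < 1} \<subseteq> N"
proof -
  obtain A where A: "abs_convex E A" "nbhd0 E A" "A \<subseteq> N" using assms by (rule nbhd0_abs_convex)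
  have hull: "linear_hull E A = carrier E"
  proof
    show "linear_hull E A \<subseteq> carrier E" by (rule linear_hull_closed[OF A(1)])
    show "carrier E \<subseteq> linear_hull E A"
      unfolding linear_hull_eq[OF A(1)] using nbhd0_absorbing[OF A(2)] by blast
  qed
  have sn: "seminorm E (gauge_of E A)" using gauge_seminorm[OF A(1)] by (simp add: seminorm_def hull)
  have "gauge_of E A \<in> cont_seminorms E"
  proof (rule seminorm_continuousI[OF sn])
    fix e :: real assume e: "0 < e"
    have "gauge_of E A x < e" if x: "x \<in> carrier E" "complex_of_real (2/e) \<odot> x \<in> A" for x
    proof -
      have "x = complex_of_real (e/2) \<odot> (complex_of_real (2/e) \<odot> x)" using x(1) e by simp
      then have "gauge_of E A x \<le> e/2" using gauge_leI[OF x(2), of "e/2" x] e by simp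
      then show ?thesis using e by simp
    qed
    then show "nbhd0 E {x \<in> carrier E. gauge_of E A x < e}"
      by (intro nbhd0_mono[OF nbhd0_scale[OF A(2), of "complex_of_real (2/e)"]]) auto
  qed
  moreover have "x \<in> N" if x: "x \<in> carrier E" "gauge_of E A x < 1" for x
  proof -
    obtain b where b: "b \<in> A" "x = complex_of_real 1 \<odot> b"
      using gauge_lessD[OF A(1), of x 1] x by (auto simp: hull)
    then have "x = b" using abs_convexD(1)[OF A(1)] by auto
    then show ?thesis using b(1) A(3) by blast
  qed
  ultimately show thesis using that by blast
qed

sublocale family: seminorm_family E "cont_seminorms E"
  by unfold_locales (simp add: cont_seminorms_def)

lemma vbounded_iff: "vbounded E B \<longleftrightarrow> family.pbounded B"
proof
  assume B: "vbounded E B"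
  have "\<exists>M. \<forall>x\<in>B. p x \<le> M" if p: "p \<in> cont_seminorms E" for p
  proof -
    interpret p: seminormed E p by (rule family.seminormed[OF p])
    have "absorbs E {x \<in> carrier E. p x < 1} B"
      using B nbhd0_seminorm_ball[OF p] by (simp add: vbounded_def)
    then obtain r where r: "0 < r" "\<And>c. r \<le> cmod c \<Longrightarrow> B \<subseteq> (\<lambda>x. c \<odot> x) ` {x \<in> carrier E. p x < 1}"
      by (auto simp: absorbs_def)
    have "B \<subseteq> (\<lambda>x. complex_of_real r \<odot> x) ` {x \<in> carrier E. p x < 1}" using r(1) by (intro r(2)) simp
    then have "p x \<le> r" if "x \<in> B" for x
      using that r(1) by (auto simp: mult_le_cancel_left1 dest!: subsetD)
    then show ?thesis by blast
  qed
  then show "family.pbounded B" using B by (auto simp: vbounded_def family.pbounded_def)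
next
  assume B: "family.pbounded B"
  have "absorbs E N B" if N: "nbhd0 E N" for N
  proof -
    obtain p where p: "p \<in> cont_seminorms E" "{x \<in> carrier E. p x < 1} \<subseteq> N"
      using N by (rule nbhd0_contains_seminorm_ball)
    interpret p: seminormed E p by (rule family.seminormed[OF p(1)])
    obtain M where M: "\<And>x. x \<in> B \<Longrightarrow> p x \<le> M" and BE: "B \<subseteq> carrier E"
      using B p(1) unfolding family.pbounded_def by blast
    have "B \<subseteq> (\<lambda>x. c \<odot> x) ` N" if c: "\<bar>M\<bar> + 1 \<le> cmod c" for c
    proof
      fix x assume x: "x \<in> B"
      have c0: "0 < cmod c" using c by linarith
      have "p x < cmod c" using M[OF x] c by linarith
      then have "p ((1/c) \<odot> x) < 1" using c0 x BE by (auto simp: norm_divide)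
      moreover have "(1/c) \<odot> x \<in> carrier E" using x BE by auto
      ultimately have "(1/c) \<odot> x \<in> N" by (intro subsetD[OF p(2)] CollectI conjI)
      moreover have "x = c \<odot> ((1/c) \<odot> x)" using c0 x BE by auto
      ultimately show "x \<in> (\<lambda>x. c \<odot> x) ` N" by blast
    qed
    then show ?thesis unfolding absorbs_def by (intro exI[of _ "\<bar>M\<bar> + 1"]) auto
  qed
  then show "vbounded E B" using B by (auto simp: vbounded_def family.pbounded_def)
qed

lemma bornology: "bornology_family E (cont_seminorms E)"
  by unfold_locales (rule vbounded_iff)

text \<open>
  Completeness is only needed for sequences: a Cauchy sequence for all continuous semi-norms
  generates a Cauchy filter, and the limit of that filter is the limit of the sequence.
\<close>

lemma complete_bornology:
  assumes "complete_lcs E"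
  shows "complete_bornology_family E (cont_seminorms E)"
proof -
  interpret bornology_family E "cont_seminorms E" by (rule bornology)
  show ?thesis
  proof
    fix x assume x: "x \<in> carrier E" and p0: "\<And>p. p \<in> cont_seminorms E \<Longrightarrow> p x = 0"
    show "x = \<zero>"
    proof (rule ccontr)
      assume "x \<noteq> \<zero>"
      then obtain U where U: "openin (lctop E) U" "\<zero> \<in> U" "x \<notin> U"
        using assms x unfolding complete_lcs_def Hausdorff_space_def
        by (metis M.zero_closed disjnt_iff topspace)
      then have "nbhd0 E U" unfolding nbhd0_def using openin_subset by fastforce
      then obtain p where p: "p \<in> cont_seminorms E" "{x \<in> carrier E. p x < 1} \<subseteq> U"
        by (rule nbhd0_contains_seminorm_ball)
      then show False using p0[OF p(1)] x U(3) by auto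
    qed
  next
    fix s :: "nat \<Rightarrow> 'a" assume s: "\<And>n. s n \<in> carrier E"
      and cauchy: "\<And>p e. p \<in> cont_seminorms E \<Longrightarrow> 0 < e \<Longrightarrow> \<exists>N. \<forall>m\<ge>N. \<forall>n\<ge>N. p (s m \<ominus> s n) < e"
    have "cauchy_filter E (filtermap s sequentially)"
      unfolding cauchy_filter_def
    proof (intro conjI allI impI)
      fix N assume "nbhd0 E N"
      then obtain p where p: "p \<in> cont_seminorms E" "{x \<in> carrier E. p x < 1} \<subseteq> N"
        by (rule nbhd0_contains_seminorm_ball)
      obtain k where k: "\<forall>m\<ge>k. \<forall>n\<ge>k. p (s m \<ominus> s n) < 1" using cauchy[OF p(1), of 1] by auto
      have "s m \<ominus> s n \<in> N" if "m \<ge> k" "n \<ge> k" for m n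
        using k that p(2) s M.minus_closed by blast
      moreover have "eventually (\<lambda>x. x \<in> s ` {k..}) (filtermap s sequentially)"
        unfolding eventually_filtermap eventually_sequentially by auto
      ultimately show "\<exists>A. eventually (\<lambda>x. x \<in> A) (filtermap s sequentially) \<and> (\<forall>x\<in>A. \<forall>y\<in>A. x \<ominus> y \<in> N)"
        by (intro exI[of _ "s ` {k..}"]) auto
    qed (simp_all add: filtermap_bot_iff eventually_filtermap s)
    then obtain x where x: "limitin (lctop E) (\<lambda>y. y) x (filtermap s sequentially)"
      using assms unfolding complete_lcs_def by blast
    have xE: "x \<in> carrier E" using limitin_topspace[OF x] by simp
    have "(\<lambda>n. p (s n \<ominus> x)) \<longlonglongrightarrow> 0" if p: "p \<in> cont_seminorms E" for p
    proof (rule LIMSEQ_I)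
      interpret p: seminormed E p by (rule family.seminormed[OF p])
      fix e :: real assume e: "0 < e"
      obtain U where U: "openin (lctop E) U" "x \<in> U" "\<And>y. y \<in> U \<Longrightarrow> p (y \<ominus> x) < e"
        using nbhd0_translate[OF nbhd0_seminorm_ball[OF p e] xE] by auto
      have "eventually (\<lambda>n. s n \<in> U) sequentially"
        using x U(1,2) unfolding limitin_def eventually_filtermap by blast
      then show "\<exists>N. \<forall>n\<ge>N. norm (p (s n \<ominus> x) - 0) < e"
        using U(3) s xE by (auto simp: eventually_sequentially M.minus_closed)
    qed
    then show "\<exists>x. family.plim s x" using xE unfolding family.plim_def by blast
  qed
qed

end

lemma lc_spaceI: "locally_convex E \<Longrightarrow> lc_space E"
  by unfold_locales (simp_all add: locally_convex_def)

section \<open>The space of continuous linear maps\<close>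

text \<open>
  A neighborhood of zero is controlled by finitely many semi-norms, and a set that is bounded for each
  of them is bounded for all of these at once, by the sum of the bounds.
\<close>

lemma vbounded_seminorm_topology:
  assumes "seminorm_family V P" and G: "G = with_topology V (seminorm_topology V P)"
  shows "vbounded G B \<longleftrightarrow> seminorm_family.pbounded V P B"
proof -
  interpret seminorm_family V P by fact
  have simps: "carrier G = carrier V" "\<zero>\<^bsub>G\<^esub> = \<zero>\<^bsub>V\<^esub>" "smult G = smult V"
    "lctop G = seminorm_topology V P"
    by (simp_all add: G with_topology_def)
  show ?thesis
  proof
    assume B: "vbounded G B"
    have "\<exists>M. \<forall>x\<in>B. p x \<le> M" if p: "p \<in> P" for p
    proof -
      interpret p: seminormed V p by (rule seminormed[OF p])
      let ?N = "{x \<in> carrier V. p (x \<ominus>\<^bsub>V\<^esub> \<zero>\<^bsub>V\<^esub>) < 1}"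
      have "nbhd0 G ?N"
        unfolding nbhd0_def simps using seminorm_topology_ball[OF p, of "\<zero>\<^bsub>V\<^esub>" V 1] by auto
      then have "absorbs G ?N B" using B by (simp add: vbounded_def)
      then obtain r where r: "0 < r" "\<And>c. r \<le> cmod c \<Longrightarrow> B \<subseteq> (\<lambda>x. c \<odot>\<^bsub>V\<^esub> x) ` ?N"
        unfolding absorbs_def simps by blast
      have "B \<subseteq> (\<lambda>x. complex_of_real r \<odot>\<^bsub>V\<^esub> x) ` ?N" using r(1) by (intro r(2)) simp
      then have "p x \<le> r" if "x \<in> B" for x
        using that r(1) by (auto simp: mult_le_cancel_left1 dest!: subsetD)
      then show ?thesis by blast
    qed
    then show "pbounded B" using B by (auto simp: vbounded_def pbounded_def simps)
  next
    assume B: "pbounded B"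
    have "absorbs G N B" if N: "nbhd0 G N" for N
    proof -
      obtain U where U: "openin (seminorm_topology V P) U" "\<zero>\<^bsub>V\<^esub> \<in> U" "U \<subseteq> N"
        using N by (auto simp: nbhd0_def simps)
      obtain Q r where Q: "finite Q" "Q \<subseteq> P" and r: "0 < r"
        and sub: "{y \<in> carrier V. \<forall>p\<in>Q. p (y \<ominus>\<^bsub>V\<^esub> \<zero>\<^bsub>V\<^esub>) < r} \<subseteq> U"
        by (rule seminorm_topology_local[OF cvs _ U(1,2)]) (use seminorms in auto)
      obtain M where M: "\<forall>p\<in>P. 0 \<le> M p" "B \<subseteq> level M" using B by (rule pbounded_subset_level)
      define K where "K = sum M Q"
      have K: "M p \<le> K" if "p \<in> Q" for p
        unfolding K_def using Q M(1) that by (intro member_le_sum) auto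
      have K0: "0 \<le> K" unfolding K_def using Q M(1) by (intro sum_nonneg) auto
      have "B \<subseteq> (\<lambda>x. c \<odot>\<^bsub>V\<^esub> x) ` N" if c: "K / r + 1 \<le> cmod c" for c
      proof
        fix x assume x: "x \<in> B"
        have xV: "x \<in> carrier V" using x M(2) by (auto simp: level_def)
        have c0: "0 < cmod c" using c K0 r by (smt (verit) divide_nonneg_pos)
        have "p ((1/c) \<odot>\<^bsub>V\<^esub> x \<ominus>\<^bsub>V\<^esub> \<zero>\<^bsub>V\<^esub>) < r" if p: "p \<in> Q" for p
        proof -
          have pP: "p \<in> P" using p Q by blast
          interpret p: seminormed V p by (rule seminormed[OF pP])
          have "p x \<le> K" using x M(2) pP K[OF p] by (auto simp: level_def intro: order_trans)
          also have "K < r * cmod c" using c r by (simp add: field_simps)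
          finally show ?thesis using xV c0 by (simp add: norm_divide field_simps)
        qed
        moreover have "(1/c) \<odot>\<^bsub>V\<^esub> x \<in> carrier V" using xV by simp
        ultimately have "(1/c) \<odot>\<^bsub>V\<^esub> x \<in> N" by (intro subsetD[OF U(3)] subsetD[OF sub] CollectI conjI ballI)
        moreover have "x = c \<odot>\<^bsub>V\<^esub> ((1/c) \<odot>\<^bsub>V\<^esub> x)" using c0 xV by simp
        ultimately show "x \<in> (\<lambda>x. c \<odot>\<^bsub>V\<^esub> x) ` N" by blast
      qed
      moreover have "0 < K / r + 1" using K0 r by (simp add: add_nonneg_pos)
      ultimately show ?thesis unfolding absorbs_def simps by blast
    qed
    then show "vbounded G B" using B by (auto simp: vbounded_def pbounded_def simps)
  qed
qed

locale L_b_setup = E: lc_space E + F: lc_space F for E :: "'a lcs" and F :: "'b lcs" +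
  assumes bornological: "bornological E" and complete: "complete_lcs F"
begin

sublocale EB: bornology_family E "cont_seminorms E" by (rule E.bornology)
sublocale FB: complete_bornology_family F "cont_seminorms F" by (rule F.complete_bornology[OF complete])

text \<open>
  This is where \<open>E\<close> has to be bornological: if \<open>u\<close> is bounded on bounded sets and \<open>q\<close> is a continuous
  semi-norm of \<open>F\<close>, then the absolutely convex set of all \<open>x\<close> with \<open>q (u x) \<le> 1/2\<close> absorbs the bounded
  sets, hence is a neighborhood of zero.
\<close>

lemma tc_hom_iff:
  "u \<in> tc_hom E F \<longleftrightarrow> u \<in> linear_maps E F \<and>
     (\<forall>q\<in>cont_seminorms F. \<forall>B. vbounded E B \<longrightarrow> (\<exists>M. \<forall>x\<in>B. q (u x) \<le> M))"
proof
  assume u: "u \<in> tc_hom E F"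
  then have lin: "u \<in> linear_maps E F" and cont: "continuous_map (lctop E) (lctop F) u"
    by (auto simp: tc_hom_def)
  have "\<exists>M. \<forall>x\<in>B. q (u x) \<le> M" if q: "q \<in> cont_seminorms F" and B: "vbounded E B" for q B
  proof -
    interpret q: seminormed F q by (rule F.family.seminormed[OF q])
    have "seminorm E (\<lambda>x. q (u x))"
      using q.triangle linear_mapsD(1-3)[OF lin] by (simp add: seminorm_def)
    moreover have "continuous_map (lctop E) euclideanreal (\<lambda>x. q (u x))"
      using continuous_map_compose[OF cont, of euclideanreal q] q by (simp add: cont_seminorms_def o_def)
    ultimately have qu: "(\<lambda>x. q (u x)) \<in> cont_seminorms E" by (simp add: cont_seminorms_def)
    have "\<forall>p\<in>cont_seminorms E. \<exists>M. \<forall>x\<in>B. p x \<le> M"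
      using B by (simp add: E.vbounded_iff E.family.pbounded_def)
    from bspec[OF this qu] show ?thesis .
  qed
  then show "u \<in> linear_maps E F \<and> (\<forall>q\<in>cont_seminorms F. \<forall>B. vbounded E B \<longrightarrow> (\<exists>M. \<forall>x\<in>B. q (u x) \<le> M))"
    using lin by blast
next
  assume *: "u \<in> linear_maps E F \<and> (\<forall>q\<in>cont_seminorms F. \<forall>B. vbounded E B \<longrightarrow> (\<exists>M. \<forall>x\<in>B. q (u x) \<le> M))"
  then have lin: "u \<in> linear_maps E F" by blast
  note ul = linear_mapsD(1-3)[OF lin]
  have nb: "nbhd0 E {x \<in> carrier E. q (u x) \<le> 1/2}" (is "nbhd0 E ?A") if q: "q \<in> cont_seminorms F" for q
  proof -
    interpret q: seminormed F q by (rule F.family.seminormed[OF q])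
    have "abs_convex E ?A"
      unfolding abs_convex_def
    proof (intro conjI ballI allI impI)
      have "\<zero>\<^bsub>E\<^esub> \<in> ?A" using linear_zero[OF lin E.cvs F.cvs] by simp
      then show "?A \<noteq> {}" by blast
      fix x y a b assume x: "x \<in> ?A" and y: "y \<in> ?A" and ab: "cmod a + cmod b \<le> 1"
      have "q (u (a \<odot>\<^bsub>E\<^esub> x \<oplus>\<^bsub>E\<^esub> b \<odot>\<^bsub>E\<^esub> y)) \<le> cmod a * q (u x) + cmod b * q (u y)"
        using x y q.triangle[of "a \<odot>\<^bsub>F\<^esub> u x" "b \<odot>\<^bsub>F\<^esub> u y"] by (simp add: ul)
      also have "\<dots> \<le> cmod a * (1/2) + cmod b * (1/2)"
        using x y by (intro add_mono mult_left_mono) auto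
      also have "\<dots> \<le> 1/2" using ab by simp
      finally show "a \<odot>\<^bsub>E\<^esub> x \<oplus>\<^bsub>E\<^esub> b \<odot>\<^bsub>E\<^esub> y \<in> ?A" using x y by simp
    qed auto
    moreover have "absorbs E ?A B" if B: "vbounded E B" for B
    proof -
      obtain M where M: "\<And>x. x \<in> B \<Longrightarrow> q (u x) \<le> M" using * q B by blast
      have BE: "B \<subseteq> carrier E" using B by (simp add: vbounded_def)
      have "B \<subseteq> (\<lambda>x. c \<odot>\<^bsub>E\<^esub> x) ` ?A" if c: "2 * \<bar>M\<bar> + 1 \<le> cmod c" for c
      proof
        fix x assume x: "x \<in> B"
        have c0: "0 < cmod c" using c by linarith
        have "2 * q (u x) \<le> cmod c" using M[OF x] c by linarith
        then have "q (u ((1/c) \<odot>\<^bsub>E\<^esub> x)) \<le> 1/2" using c0 x BE by (auto simp: ul norm_divide field_simps)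
        moreover have "(1/c) \<odot>\<^bsub>E\<^esub> x \<in> carrier E" using x BE by auto
        moreover have "x = c \<odot>\<^bsub>E\<^esub> ((1/c) \<odot>\<^bsub>E\<^esub> x)" using c0 x BE by auto
        ultimately show "x \<in> (\<lambda>x. c \<odot>\<^bsub>E\<^esub> x) ` ?A" by blast
      qed
      then show ?thesis unfolding absorbs_def by (intro exI[of _ "2 * \<bar>M\<bar> + 1"]) auto
    qed
    ultimately show ?thesis using bornological unfolding bornological_def by blast
  qed
  have "continuous_map (lctop E) (lctop F) u"
    unfolding continuous_map E.topspace F.topspace
  proof (intro conjI allI impI)
    show "u ` carrier E \<subseteq> carrier F" using ul(1) by blast
    fix U assume U: "openin (lctop F) U"
    show "openin (lctop E) {x \<in> carrier E. u x \<in> U}"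
    proof (subst openin_subopen, intro ballI)
      fix x assume "x \<in> {x \<in> carrier E. u x \<in> U}"
      then have x: "x \<in> carrier E" "u x \<in> U" by auto
      obtain q where q: "q \<in> cont_seminorms F"
        "{z \<in> carrier F. q z < 1} \<subseteq> {z \<in> carrier F. z \<oplus>\<^bsub>F\<^esub> u x \<in> U}"
        using F.nbhd0_if_open[OF U x(2)] by (rule F.nbhd0_contains_seminorm_ball)
      obtain V where V: "openin (lctop E) V" "x \<in> V"
        "\<And>y. y \<in> V \<Longrightarrow> y \<in> carrier E \<and> y \<ominus>\<^bsub>E\<^esub> x \<in> {x \<in> carrier E. q (u x) \<le> 1/2}"
        using E.nbhd0_translate[OF nb[OF q(1)] x(1)] by blast
      have "u y \<in> U" if y: "y \<in> V" for y
      proof -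
        have yE: "y \<in> carrier E" and "q (u (y \<ominus>\<^bsub>E\<^esub> x)) \<le> 1/2" using V(3)[OF y] by auto
        then have "q (u y \<ominus>\<^bsub>F\<^esub> u x) < 1" using x(1) by (simp add: linear_minus[OF lin E.cvs F.cvs])
        then have "u y \<ominus>\<^bsub>F\<^esub> u x \<in> {z \<in> carrier F. z \<oplus>\<^bsub>F\<^esub> u x \<in> U}"
          using yE x(1) ul(1) by (intro subsetD[OF q(2)]) (simp add: F.M.minus_closed)
        then show ?thesis using F.minus_add_cancel[of "u y" "u x"] yE x(1) ul(1) by simp
      qed
      then show "\<exists>T. openin (lctop E) T \<and> x \<in> T \<and> T \<subseteq> {x \<in> carrier E. u x \<in> U}"
        using V by (intro exI[of _ V]) auto
    qed
  qed
  then show "u \<in> tc_hom E F" using lin by (simp add: tc_hom_def)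
qed

lemma tc_hom_closed: "u \<in> tc_hom E F \<Longrightarrow> x \<in> carrier E \<Longrightarrow> u x \<in> carrier F"
  using linear_mapsD(1)[of u E F] by (simp add: tc_hom_def)

definition sup_seminorm :: "('b \<Rightarrow> real) \<Rightarrow> 'a set \<Rightarrow> ('a \<Rightarrow> 'b) \<Rightarrow> real" where
  "sup_seminorm p B u = (SUP e\<in>B. p (u e))"

definition sup_seminorms :: "(('a \<Rightarrow> 'b) \<Rightarrow> real) set" where
  "sup_seminorms = {sup_seminorm p B | p B. p \<in> cont_seminorms F \<and> vbounded E B \<and> B \<noteq> {}}"

lemma sup_seminorm_le_iff:
  assumes "u \<in> tc_hom E F" "p \<in> cont_seminorms F" "vbounded E B" "B \<noteq> {}"
  shows "sup_seminorm p B u \<le> K \<longleftrightarrow> (\<forall>x\<in>B. p (u x) \<le> K)"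
proof -
  have "bdd_above ((\<lambda>x. p (u x)) ` B)"
    using assms(1-3) unfolding tc_hom_iff bdd_above_def by blast
  then show ?thesis unfolding sup_seminorm_def using assms(4) by (simp add: cSUP_le_iff)
qed

lemma le_sup_seminorm:
  assumes "u \<in> tc_hom E F" "p \<in> cont_seminorms F" "vbounded E B" "x \<in> B"
  shows "p (u x) \<le> sup_seminorm p B u"
  using sup_seminorm_le_iff[OF assms(1-3), of "sup_seminorm p B u"] assms(4) by auto

lemma L_b_simps [simp]:
  "carrier (L_b E F) = tc_hom E F"
  "\<zero>\<^bsub>L_b E F\<^esub> = (\<lambda>x\<in>carrier E. \<zero>\<^bsub>F\<^esub>)"
  "f \<oplus>\<^bsub>L_b E F\<^esub> g = (\<lambda>x\<in>carrier E. f x \<oplus>\<^bsub>F\<^esub> g x)"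
  "c \<odot>\<^bsub>L_b E F\<^esub> f = (\<lambda>x\<in>carrier E. c \<odot>\<^bsub>F\<^esub> f x)"
  by (simp_all add: L_b_def with_topology_def hom_module_def)

lemma tc_hom_zero: "(\<lambda>x\<in>carrier E. \<zero>\<^bsub>F\<^esub>) \<in> tc_hom E F"
  unfolding tc_hom_iff
proof (intro conjI ballI allI impI)
  fix q B assume q: "q \<in> cont_seminorms F" and "vbounded E B"
  then have "B \<subseteq> carrier E" by (simp add: vbounded_def)
  then show "\<exists>M. \<forall>x\<in>B. q ((\<lambda>x\<in>carrier E. \<zero>\<^bsub>F\<^esub>) x) \<le> M"
    by (intro exI[of _ "q \<zero>\<^bsub>F\<^esub>"]) auto
qed (rule linear_map_zero[OF E.cvs F.cvs])

lemma tc_hom_add: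
  assumes f: "f \<in> tc_hom E F" and g: "g \<in> tc_hom E F"
  shows "(\<lambda>x\<in>carrier E. f x \<oplus>\<^bsub>F\<^esub> g x) \<in> tc_hom E F"
  unfolding tc_hom_iff
proof (intro conjI ballI allI impI)
  fix q B assume q: "q \<in> cont_seminorms F" and B: "vbounded E B"
  interpret q: seminormed F q by (rule F.family.seminormed[OF q])
  have BE: "B \<subseteq> carrier E" using B by (simp add: vbounded_def)
  obtain M M' where M: "\<And>x. x \<in> B \<Longrightarrow> q (f x) \<le> M" "\<And>x. x \<in> B \<Longrightarrow> q (g x) \<le> M'"
    using f g q B unfolding tc_hom_iff by blast
  have "q (f x \<oplus>\<^bsub>F\<^esub> g x) \<le> M + M'" if x: "x \<in> B" for x
    using q.triangle[of "f x" "g x"] M[OF x] tc_hom_closed[OF f, of x] tc_hom_closed[OF g, of x] x BE by force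
  then show "\<exists>M. \<forall>x\<in>B. q ((\<lambda>x\<in>carrier E. f x \<oplus>\<^bsub>F\<^esub> g x) x) \<le> M"
    using BE by (intro exI[of _ "M + M'"]) auto
qed (use f g in \<open>simp add: tc_hom_def linear_map_add[OF E.cvs F.cvs]\<close>)

lemma tc_hom_smult:
  assumes f: "f \<in> tc_hom E F"
  shows "(\<lambda>x\<in>carrier E. c \<odot>\<^bsub>F\<^esub> f x) \<in> tc_hom E F"
  unfolding tc_hom_iff
proof (intro conjI ballI allI impI)
  fix q B assume q: "q \<in> cont_seminorms F" and B: "vbounded E B"
  interpret q: seminormed F q by (rule F.family.seminormed[OF q])
  have BE: "B \<subseteq> carrier E" using B by (simp add: vbounded_def)
  obtain M where M: "\<And>x. x \<in> B \<Longrightarrow> q (f x) \<le> M" using f q B unfolding tc_hom_iff by blast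
  have "q (c \<odot>\<^bsub>F\<^esub> f x) \<le> cmod c * M" if x: "x \<in> B" for x
    using mult_left_mono[OF M[OF x], of "cmod c"] tc_hom_closed[OF f, of x] x BE by auto
  then show "\<exists>M. \<forall>x\<in>B. q ((\<lambda>x\<in>carrier E. c \<odot>\<^bsub>F\<^esub> f x) x) \<le> M"
    using BE by (intro exI[of _ "cmod c * M"]) auto
qed (use f in \<open>simp add: tc_hom_def linear_map_smult[OF E.cvs F.cvs]\<close>)

lemma complex_vs_hom_module: "complex_vs (hom_module E F (tc_hom E F))"
  by (rule hom_module_complex_vs[OF E.cvs F.cvs])
     (auto simp: tc_hom_zero tc_hom_add tc_hom_smult, simp add: tc_hom_def)

lemma complex_vs_L_b: "complex_vs (L_b E F)"
  by (rule complex_vs_cong[OF complex_vs_hom_module]) (simp_all add: L_b_def with_topology_def)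

sublocale L: lcs_vs "L_b E F"
  by unfold_locales (rule complex_vs_L_b)

lemma minus_L_b:
  assumes "f \<in> tc_hom E F" "g \<in> tc_hom E F" "x \<in> carrier E"
  shows "(f \<ominus>\<^bsub>L_b E F\<^esub> g) x = f x \<ominus>\<^bsub>F\<^esub> g x"
proof -
  have "f \<ominus>\<^bsub>L_b E F\<^esub> g = f \<oplus>\<^bsub>L_b E F\<^esub> (-1) \<odot>\<^bsub>L_b E F\<^esub> g" using assms by (intro L.minus_eq_smult) simp_all
  then show ?thesis
    using assms tc_hom_closed[OF assms(1,3)] tc_hom_closed[OF assms(2,3)] by (simp add: F.minus_eq_smult)
qed

lemma seminorm_sup_seminorm:
  assumes p: "p \<in> cont_seminorms F" and B: "vbounded E B" "B \<noteq> {}"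
  shows "seminorm (L_b E F) (sup_seminorm p B)"
  unfolding seminorm_def
proof (intro conjI ballI allI)
  interpret p: seminormed F p by (rule F.family.seminormed[OF p])
  have BE: "B \<subseteq> carrier E" using B by (simp add: vbounded_def)
  fix f g c assume "f \<in> carrier (L_b E F)"
  then have f: "f \<in> tc_hom E F" by simp
  have nonneg: "0 \<le> sup_seminorm p B f" if f: "f \<in> tc_hom E F" for f
  proof -
    obtain x where x: "x \<in> B" using B(2) by blast
    then have "0 \<le> p (f x)" using tc_hom_closed[OF f] BE by (intro p.nonneg) blast
    then show ?thesis using le_sup_seminorm[OF f p B(1) x] by linarith
  qed
  show "0 \<le> sup_seminorm p B f" by (rule nonneg[OF f])
  have cf: "c \<odot>\<^bsub>L_b E F\<^esub> f \<in> tc_hom E F" if "f \<in> tc_hom E F" for c f using tc_hom_smult[OF that] by simp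
  have le: "sup_seminorm p B (c \<odot>\<^bsub>L_b E F\<^esub> f) \<le> cmod c * sup_seminorm p B f" if f: "f \<in> tc_hom E F" for c f
    unfolding sup_seminorm_le_iff[OF cf[OF f] p B]
  proof
    fix x assume x: "x \<in> B"
    then have "x \<in> carrier E" using BE by blast
    then show "p ((c \<odot>\<^bsub>L_b E F\<^esub> f) x) \<le> cmod c * sup_seminorm p B f"
      using le_sup_seminorm[OF f p B(1) x] tc_hom_closed[OF f] by (simp add: mult_left_mono)
  qed
  show "sup_seminorm p B (c \<odot>\<^bsub>L_b E F\<^esub> f) = cmod c * sup_seminorm p B f"
  proof (rule antisym[OF le[OF f]])
    show "cmod c * sup_seminorm p B f \<le> sup_seminorm p B (c \<odot>\<^bsub>L_b E F\<^esub> f)"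
    proof (cases "c = 0")
      case True
      then show ?thesis using nonneg[OF cf[OF f, of 0]] by simp
    next
      case False
      have "inverse c \<odot>\<^bsub>L_b E F\<^esub> (c \<odot>\<^bsub>L_b E F\<^esub> f) = f"
        using L.smult_smult[of f "inverse c" c] f False by (simp del: L_b_simps(4))
      then show ?thesis using le[OF cf[OF f], of "inverse c" c] False
        by (simp del: L_b_simps(4) add: norm_divide norm_inverse field_simps)
    qed
  qed
  assume "g \<in> carrier (L_b E F)"
  then have g: "g \<in> tc_hom E F" by simp
  have fg: "f \<oplus>\<^bsub>L_b E F\<^esub> g \<in> tc_hom E F" using tc_hom_add[OF f g] by simp
  show "sup_seminorm p B (f \<oplus>\<^bsub>L_b E F\<^esub> g) \<le> sup_seminorm p B f + sup_seminorm p B g"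
    unfolding sup_seminorm_le_iff[OF fg p B]
  proof
    fix x assume x: "x \<in> B"
    then have "x \<in> carrier E" using BE by blast
    then show "p ((f \<oplus>\<^bsub>L_b E F\<^esub> g) x) \<le> sup_seminorm p B f + sup_seminorm p B g"
      using le_sup_seminorm[OF f p B(1) x] le_sup_seminorm[OF g p B(1) x]
        p.triangle[of "f x" "g x"] tc_hom_closed[OF f] tc_hom_closed[OF g] by simp
  qed
qed

lemma sup_seminormI: "p \<in> cont_seminorms F \<Longrightarrow> vbounded E B \<Longrightarrow> B \<noteq> {} \<Longrightarrow> sup_seminorm p B \<in> sup_seminorms"
  by (auto simp: sup_seminorms_def)

sublocale L: seminorm_family "L_b E F" sup_seminorms
  by unfold_locales (auto simp: sup_seminorms_def intro!: seminorm_sup_seminorm)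

lemma vbounded_L_b_iff: "vbounded (L_b E F) D \<longleftrightarrow> L.pbounded D"
proof -
  let ?V = "hom_module E F (tc_hom E F)"
  interpret V: cvs ?V by (rule cvs.intro) (rule complex_vs_hom_module)
  have "seminorm ?V p" if "p \<in> sup_seminorms" for p
    using L.seminorms[OF that] by (simp add: seminorm_def L_b_def with_topology_def)
  then interpret V: seminorm_family ?V sup_seminorms by unfold_locales
  have "sup_seminorms = {(\<lambda>f. SUP e\<in>B. p (f e)) | p B.
          seminorm F p \<and> continuous_map (lctop F) euclideanreal p \<and> vbounded E B \<and> B \<noteq> {}}"
    by (auto simp: sup_seminorms_def cont_seminorms_def sup_seminorm_def[abs_def])
  then have "L_b E F = with_topology ?V (seminorm_topology ?V sup_seminorms)" by (simp add: L_b_def)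
  from vbounded_seminorm_topology[OF V.seminorm_family_axioms this] show ?thesis
    unfolding V.pbounded_def L.pbounded_def by (simp add: hom_module_def)
qed

lemma vbounded_singleton: "x \<in> carrier E \<Longrightarrow> vbounded E {x}"
  by (simp add: E.vbounded_iff E.family.pbounded_singleton)

text \<open>
  The pointwise limit of a Cauchy sequence of \<open>L_b E F\<close> is bounded on bounded sets, hence
  continuous.
\<close>

lemma L_b_complete: "complete_bornology_family (L_b E F) sup_seminorms"
proof
  show "vbounded (L_b E F) D \<longleftrightarrow> L.pbounded D" for D by (rule vbounded_L_b_iff)
next
  fix f assume f: "f \<in> carrier (L_b E F)" and f0: "\<And>p. p \<in> sup_seminorms \<Longrightarrow> p f = 0"
  have "f x = \<zero>\<^bsub>F\<^esub>" if x: "x \<in> carrier E" for x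
  proof (rule FB.separated)
    show "f x \<in> carrier F" using f x tc_hom_closed by simp
    fix p assume p: "p \<in> cont_seminorms F"
    then show "p (f x) = 0"
      using f0[OF sup_seminormI[OF p vbounded_singleton[OF x]]] by (simp add: sup_seminorm_def)
  qed
  moreover have "f \<in> extensional (carrier E)" using f by (auto simp: tc_hom_def dest: linear_mapsD(4))
  ultimately show "f = \<zero>\<^bsub>L_b E F\<^esub>" by (intro extensionalityI[of _ "carrier E"]) auto
next
  fix s :: "nat \<Rightarrow> 'a \<Rightarrow> 'b"
  assume "\<And>n. s n \<in> carrier (L_b E F)"
  then have s: "s n \<in> tc_hom E F" for n by simp
  assume cauchy: "\<And>p e. p \<in> sup_seminorms \<Longrightarrow> 0 < e \<Longrightarrow> \<exists>N. \<forall>m\<ge>N. \<forall>n\<ge>N. p (s m \<ominus>\<^bsub>L_b E F\<^esub> s n) < e"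
  have sc: "s n x \<in> carrier F" if "x \<in> carrier E" for n x using tc_hom_closed[OF s that] .
  have ms: "s m \<ominus>\<^bsub>L_b E F\<^esub> s n \<in> tc_hom E F" for m n
    using L.M.minus_closed[of "s m" "s n"] s by simp
  have unif: "\<exists>N. \<forall>m\<ge>N. \<forall>n\<ge>N. \<forall>x\<in>B. p (s m x \<ominus>\<^bsub>F\<^esub> s n x) < e"
    if p: "p \<in> cont_seminorms F" and B: "vbounded E B" and e: "0 < e" for p B e
  proof (cases "B = {}")
    case False
    then obtain N where N: "\<forall>m\<ge>N. \<forall>n\<ge>N. sup_seminorm p B (s m \<ominus>\<^bsub>L_b E F\<^esub> s n) < e"
      using cauchy[OF sup_seminormI[OF p B] e] by blast
    have "p (s m x \<ominus>\<^bsub>F\<^esub> s n x) < e" if "m \<ge> N" "n \<ge> N" "x \<in> B" for m n x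
    proof -
      have "x \<in> carrier E" using that(3) B by (auto simp: vbounded_def)
      then have "p (s m x \<ominus>\<^bsub>F\<^esub> s n x) \<le> sup_seminorm p B (s m \<ominus>\<^bsub>L_b E F\<^esub> s n)"
        using le_sup_seminorm[OF ms p B that(3), of m n] by (simp only: minus_L_b[OF s s])
      also have "\<dots> < e" using N that(1,2) by blast
      finally show ?thesis .
    qed
    then show ?thesis by blast
  qed simp
  have "\<exists>y. F.family.plim (\<lambda>n. s n x) y" if x: "x \<in> carrier E" for x
  proof (rule FB.seq_complete)
    show "s n x \<in> carrier F" for n using sc[OF x] .
    show "\<exists>N. \<forall>m\<ge>N. \<forall>n\<ge>N. p (s m x \<ominus>\<^bsub>F\<^esub> s n x) < e" if "p \<in> cont_seminorms F" "0 < e" for p e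
      using unif[OF that(1) vbounded_singleton[OF x] that(2)] by simp
  qed
  then obtain l where l: "\<And>x. x \<in> carrier E \<Longrightarrow> F.family.plim (\<lambda>n. s n x) (l x)" by metis
  define f where "f = restrict l (carrier E)"
  have f: "F.family.plim (\<lambda>n. s n x) (f x)" if "x \<in> carrier E" for x using l that by (simp add: f_def)
  have fc: "f x \<in> carrier F" if "x \<in> carrier E" for x using f[OF that] by (simp add: F.family.plim_def)
  have sl: "s n \<in> linear_maps E F" for n using s by (simp add: tc_hom_def)
  have "f \<in> linear_maps E F"
  proof (rule linear_mapsI)
    fix x y c assume x: "x \<in> carrier E"
    show "f x \<in> carrier F" by (rule fc[OF x])
    have "F.family.plim (\<lambda>n. s n (c \<odot>\<^bsub>E\<^esub> x)) (c \<odot>\<^bsub>F\<^esub> f x)"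
      using F.family.plim_smult[OF sc[OF x] f[OF x], of c] x by (simp add: linear_mapsD(3)[OF sl])
    then show "f (c \<odot>\<^bsub>E\<^esub> x) = c \<odot>\<^bsub>F\<^esub> f x"
      by (intro FB.plim_unique[OF sc f]) (use x in simp_all)
    assume y: "y \<in> carrier E"
    have "F.family.plim (\<lambda>n. s n (x \<oplus>\<^bsub>E\<^esub> y)) (f x \<oplus>\<^bsub>F\<^esub> f y)"
      using F.family.plim_add[OF sc[OF x] sc[OF y] f[OF x] f[OF y]] x y by (simp add: linear_mapsD(2)[OF sl])
    then show "f (x \<oplus>\<^bsub>E\<^esub> y) = f x \<oplus>\<^bsub>F\<^esub> f y"
      by (intro FB.plim_unique[OF sc f]) (use x y in simp_all)
  qed (simp add: f_def)
  have lim_le: "p (s m x \<ominus>\<^bsub>F\<^esub> f x) \<le> e"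
    if p: "p \<in> cont_seminorms F" and x: "x \<in> carrier E" and N: "\<forall>n\<ge>N. p (s m x \<ominus>\<^bsub>F\<^esub> s n x) < e" for p x m N e
  proof -
    interpret p: seminormed F p by (rule F.family.seminormed[OF p])
    have "p (s m x \<ominus>\<^bsub>F\<^esub> f x) \<le> e + p (s n x \<ominus>\<^bsub>F\<^esub> f x)" if "n \<ge> N" for n
      using p.triangle_via[OF sc[OF x, of m] sc[OF x, of n] fc[OF x]] N that by force
    moreover have "(\<lambda>n. e + p (s n x \<ominus>\<^bsub>F\<^esub> f x)) \<longlonglongrightarrow> e + 0"
      using f[OF x] p by (intro tendsto_intros) (simp add: F.family.plim_def)
    ultimately have "p (s m x \<ominus>\<^bsub>F\<^esub> f x) \<le> e + 0" by (intro LIMSEQ_le_const) blast+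
    then show ?thesis by simp
  qed
  have fT: "f \<in> tc_hom E F"
    unfolding tc_hom_iff
  proof (intro conjI ballI allI impI)
    fix q B assume q: "q \<in> cont_seminorms F" and B: "vbounded E B"
    interpret q: seminormed F q by (rule F.family.seminormed[OF q])
    have BE: "x \<in> carrier E" if "x \<in> B" for x using B that by (auto simp: vbounded_def)
    obtain N where N: "\<forall>m\<ge>N. \<forall>n\<ge>N. \<forall>x\<in>B. q (s m x \<ominus>\<^bsub>F\<^esub> s n x) < 1" using unif[OF q B, of 1] by auto
    obtain M where M: "\<And>x. x \<in> B \<Longrightarrow> q (s N x) \<le> M" using s[of N] q B unfolding tc_hom_iff by blast
    have "q (f x) \<le> M + 1" if x: "x \<in> B" for x
    proof -
      have "q (s N x \<ominus>\<^bsub>F\<^esub> f x) \<le> 1" using N x by (intro lim_le[OF q BE[OF x], of N]) auto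
      then show ?thesis
        using q.le_add_minus[OF fc[OF BE[OF x]] sc[OF BE[OF x], of N]] M[OF x]
          q.minus_sym[OF fc[OF BE[OF x]] sc[OF BE[OF x], of N]] by linarith
    qed
    then show "\<exists>M. \<forall>x\<in>B. q (f x) \<le> M" by blast
  qed fact
  have "(\<lambda>n. P (s n \<ominus>\<^bsub>L_b E F\<^esub> f)) \<longlonglongrightarrow> 0" if P: "P \<in> sup_seminorms" for P
  proof (rule LIMSEQ_I)
    fix e :: real assume e: "0 < e"
    obtain p B where PB: "P = sup_seminorm p B" and p: "p \<in> cont_seminorms F" and B: "vbounded E B" "B \<noteq> {}"
      using P by (auto simp: sup_seminorms_def)
    obtain N where N: "\<forall>m\<ge>N. \<forall>n\<ge>N. \<forall>x\<in>B. p (s m x \<ominus>\<^bsub>F\<^esub> s n x) < e/2"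
      using unif[OF p B(1), of "e/2"] e by auto
    have sf: "s m \<ominus>\<^bsub>L_b E F\<^esub> f \<in> tc_hom E F" for m using L.M.minus_closed[of "s m" f] s fT by simp
    have "P (s m \<ominus>\<^bsub>L_b E F\<^esub> f) \<le> e/2" if m: "m \<ge> N" for m
      unfolding PB sup_seminorm_le_iff[OF sf p B]
    proof
      fix x assume x: "x \<in> B"
      then have xE: "x \<in> carrier E" using B by (auto simp: vbounded_def)
      show "p ((s m \<ominus>\<^bsub>L_b E F\<^esub> f) x) \<le> e/2"
        unfolding minus_L_b[OF s fT xE] using N m x by (intro lim_le[OF p xE, of N]) auto
    qed
    moreover have "0 \<le> P (s m \<ominus>\<^bsub>L_b E F\<^esub> f)" for m
      using seminormed.nonneg[OF L.seminormed[OF P]] sf by simp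
    ultimately show "\<exists>N. \<forall>m\<ge>N. norm (P (s m \<ominus>\<^bsub>L_b E F\<^esub> f) - 0) < e"
      using e by (intro exI[of _ N]) fastforce
  qed
  then show "\<exists>x. L.plim s x" using fT unfolding L.plim_def by (intro exI[of _ f]) simp
qed

end

section \<open>The internal Hom object\<close>

context L_b_setup
begin

sublocale LB: complete_bornology_family "L_b E F" sup_seminorms
  by (rule L_b_complete)

abbreviation extF :: "('c \<Rightarrow> 'b) \<Rightarrow> (nat \<Rightarrow> 'c) set \<Rightarrow> 'b" where
  "extF \<equiv> extend F (cont_seminorms F)"

abbreviation Ecomp :: "'a set \<Rightarrow> (nat \<Rightarrow> 'a) set nspace" where
  "Ecomp B \<equiv> completion (hull_space E B)"

abbreviation realize_H :: "('a \<Rightarrow> 'b) set \<Rightarrow> (nat \<Rightarrow> 'a \<Rightarrow> 'b) set \<Rightarrow> 'a \<Rightarrow> 'b" where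
  "realize_H \<equiv> realize (L_b E F) sup_seminorms"

abbreviation realize_LF :: "'w nspace \<Rightarrow> 'b set \<Rightarrow> ('w \<Rightarrow> (nat \<Rightarrow> 'b) set) \<Rightarrow> 'w \<Rightarrow> 'b" where
  "realize_LF W \<equiv> realize_L W (realize F (cont_seminorms F))"

abbreviation maps_to_F :: "'a set \<Rightarrow> ('b set, 'b set \<times> 'b set, (nat \<Rightarrow> 'a) set \<Rightarrow> (nat \<Rightarrow> 'b) set) ind" where
  "maps_to_F B \<equiv> ind_L (Ecomp B) (IB F)"

abbreviation realize_maps :: "'a set \<Rightarrow> 'b set \<Rightarrow> ((nat \<Rightarrow> 'a) set \<Rightarrow> (nat \<Rightarrow> 'b) set) \<Rightarrow> (nat \<Rightarrow> 'a) set \<Rightarrow> 'b" where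
  "realize_maps B \<equiv> realize_LF (Ecomp B)"

lemma snspace_hull: "B \<in> disks E \<Longrightarrow> snspace (hull_space E B)"
  by (rule E.snspace_hull_space) simp

lemma snspace_Ecomp: "B \<in> disks E \<Longrightarrow> snspace (Ecomp B)"
  by (rule snspace.snspace_completion[OF snspace_hull])

lemma realized_F: "snspace W \<Longrightarrow> realized_ind (ind_L W (IB F)) (realize_LF W)"
  by (intro realized_ind.realized_ind_L[OF FB.realized_IB FB.ind_object_IB] cvs.cvs)
     (simp add: snspace_def seminormed_def)

lemma hom_le_gauge:
  assumes u: "u \<in> tc_hom E F" and B: "B \<in> disks E" and p: "p \<in> cont_seminorms F"
    and x: "x \<in> linear_hull E B"
  shows "p (u x) \<le> sup_seminorm p B u * gauge_of E B x"
proof -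
  interpret p: seminormed F p by (rule F.family.seminormed[OF p])
  have ul: "u \<in> linear_maps E F" using u by (simp add: tc_hom_def)
  have "seminorm E (\<lambda>x. p (u x))"
    using p.triangle linear_mapsD(1-3)[OF ul] by (simp add: seminorm_def)
  then show ?thesis
    by (rule E.seminorm_le_gauge[rotated]) (use B x le_sup_seminorm[OF u p] in auto)
qed

lemma bounded_map_hom:
  assumes u: "u \<in> tc_hom E F" and B: "B \<in> disks E"
  shows "bounded_map (hull_space E B) F (cont_seminorms F) u"
proof -
  interpret S: snspace "hull_space E B" by (rule snspace_hull[OF B])
  have ul: "u \<in> linear_maps E F" using u by (simp add: tc_hom_def)
  have hull: "x \<in> carrier E" if "x \<in> linear_hull E B" for x
    using that E.linear_hull_closed[of B] B by blast
  show ?thesis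
  proof
    fix p assume "p \<in> cont_seminorms F"
    then show "\<exists>M. \<forall>x\<in>carrier (hull_space E B). p (u x) \<le> M * nrm (hull_space E B) x"
      using hom_le_gauge[OF u B] by auto
  qed (use linear_mapsD(1-3)[OF ul] hull in simp_all)
qed

lemma extF_trn:
  assumes u: "u \<in> tc_hom E F" and B: "B \<in> disks E" and C: "C \<in> disks E" and BC: "B \<subseteq> C"
    and \<eta>: "\<eta> \<in> carrier (Ecomp B)"
  shows "extF u (trn (IB E) (B, C) \<eta>) = extF u \<eta>"
proof -
  interpret B: bounded_map "hull_space E B" F "cont_seminorms F" u by (rule bounded_map_hom[OF u B])
  interpret C: bounded_map "hull_space E C" F "cont_seminorms F" u by (rule bounded_map_hom[OF u C])
  obtain s where s: "s \<in> cauchy_seqs (hull_space E B)" "\<eta> = B.S.cls s" using \<eta> by (rule B.S.completionE)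
  show ?thesis
    unfolding s(2) EB.trn_cls(2)[OF B C BC s(1)]
    by (rule C.extend_eqI[OF EB.trn_cls(1)[OF B C BC s(1)] B.plim_extend[OF s(1)]])
qed

text \<open>
  A bounded map from \<open>V\<close> to \<open>L_b E F\<close> is a bilinear map on \<open>V \<times> E\<close>, which is bounded on \<open>V \<times> E\<^sub>B\<close>
  by definition of the topology of \<open>L_b E F\<close>.
\<close>

lemma bounded_bilinear_extF:
  assumes h: "bounded_map V (L_b E F) sup_seminorms h" and B: "B \<in> disks E"
  shows "bounded_bilinear_map V (Ecomp B) F (cont_seminorms F) (\<lambda>v. extF (h v))"
proof -
  interpret h: bounded_map V "L_b E F" sup_seminorms h by fact
  interpret W: snspace "Ecomp B" by (rule snspace_Ecomp[OF B])
  interpret S: snspace "hull_space E B" by (rule snspace_hull[OF B])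
  have hT: "h v \<in> tc_hom E F" if "v \<in> carrier V" for v using h.closed[OF that] by simp
  note bm = bounded_map_hom[OF hT B]
  note bme = bounded_map.bounded_map_extend[OF bm]
  have hull: "x \<in> carrier E" if "x \<in> linear_hull E B" for x
    using that E.linear_hull_closed[of B] B by blast
  show ?thesis
  proof
    fix v w w' c assume v: "v \<in> carrier V" and w: "w \<in> carrier (Ecomp B)"
    interpret e: bounded_map "Ecomp B" F "cont_seminorms F" "extF (h v)" by (rule bme[OF v])
    show "extF (h v) w \<in> carrier F" by (rule e.closed[OF w])
    show "extF (h v) (c \<odot>\<^bsub>Ecomp B\<^esub> w) = c \<odot>\<^bsub>F\<^esub> extF (h v) w" by (rule e.map_smult[OF w])
    show "extF (h v) (w \<oplus>\<^bsub>Ecomp B\<^esub> w') = extF (h v) w \<oplus>\<^bsub>F\<^esub> extF (h v) w'" if "w' \<in> carrier (Ecomp B)"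
      by (rule e.map_add[OF w that])
    obtain s where s: "s \<in> cauchy_seqs (hull_space E B)" "w = S.cls s" using w by (rule S.completionE)
    have sE: "s n \<in> carrier E" for n using hull S.cauchy_closed[OF s(1)] by simp
    have pl: "F.family.plim (\<lambda>n. h v (s n)) (extF (h v) w)" if "v \<in> carrier V" for v
      unfolding s(2) by (rule bounded_map.plim_extend[OF bm[OF that] s(1)])
    have cl: "h v (s n) \<in> carrier F" if "v \<in> carrier V" for v n
      by (rule tc_hom_closed[OF hT[OF that] sE])
    have "F.family.plim (\<lambda>n. h (c \<odot>\<^bsub>V\<^esub> v) (s n)) (c \<odot>\<^bsub>F\<^esub> extF (h v) w)"
      using F.family.plim_smult[OF cl[OF v] pl[OF v], of c] sE by (simp add: h.map_smult[OF v])
    from bounded_map.extend_eqI[OF bm s(1) this] v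
    show "extF (h (c \<odot>\<^bsub>V\<^esub> v)) w = c \<odot>\<^bsub>F\<^esub> extF (h v) w" by (simp add: s(2))
    fix v' assume v': "v' \<in> carrier V"
    have "F.family.plim (\<lambda>n. h (v \<oplus>\<^bsub>V\<^esub> v') (s n)) (extF (h v) w \<oplus>\<^bsub>F\<^esub> extF (h v') w)"
      using F.family.plim_add[OF cl[OF v] cl[OF v'] pl[OF v] pl[OF v']] sE by (simp add: h.map_add[OF v v'])
    from bounded_map.extend_eqI[OF bm s(1) this] v v'
    show "extF (h (v \<oplus>\<^bsub>V\<^esub> v')) w = extF (h v) w \<oplus>\<^bsub>F\<^esub> extF (h v') w" by (simp add: s(2))
  next
    fix p assume p: "p \<in> cont_seminorms F"
    have Bv: "vbounded E B" "B \<noteq> {}" using B by (auto simp: abs_convex_def)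
    obtain M where M: "0 < M" "\<And>v. v \<in> carrier V \<Longrightarrow> sup_seminorm p B (h v) \<le> M * nrm V v"
      by (rule h.bounded_pos[OF sup_seminormI[OF p Bv]]) blast
    have "p (extF (h v) w) \<le> M * (nrm V v * nrm (Ecomp B) w)"
      if v: "v \<in> carrier V" and w: "w \<in> carrier (Ecomp B)" for v w
    proof -
      have "p (extF (h v) w) \<le> sup_seminorm p B (h v) * nrm (Ecomp B) w"
        by (rule bounded_map.extend_le[OF bm[OF v] p _ w]) (use hom_le_gauge[OF hT[OF v] B p] in simp)
      also have "\<dots> \<le> (M * nrm V v) * nrm (Ecomp B) w"
        using M(2)[OF v] w by (intro mult_right_mono) auto
      finally show ?thesis by (simp add: mult.assoc)
    qed
    then show "\<exists>M. \<forall>v\<in>carrier V. \<forall>w\<in>carrier (Ecomp B). p (extF (h v) w) \<le> M * (nrm V v * nrm (Ecomp B) w)"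
      by blast
  qed
qed

definition ext_map :: "'a set \<Rightarrow> ('a \<Rightarrow> 'b) \<Rightarrow> (nat \<Rightarrow> 'a) set \<Rightarrow> 'b" where
  "ext_map B u = (\<lambda>\<eta>\<in>carrier (Ecomp B). extF u \<eta>)"

text \<open>
  The projection from \<open>IB (L_b E F)\<close> to the maps on \<open>E\<^sub>B\<close>, given by its realization: it restricts a map to
  the linear hull of \<open>B\<close> and extends the restriction to the completion.
\<close>

definition proj :: "'a set \<Rightarrow> ('a \<Rightarrow> 'b) set \<Rightarrow> ('b set \<times> ((nat \<Rightarrow> 'a \<Rightarrow> 'b) set \<Rightarrow> (nat \<Rightarrow> 'a) set \<Rightarrow> (nat \<Rightarrow> 'b) set)) set"
  where "proj B = mor_over (IB (L_b E F)) (maps_to_F B) (realize_maps B)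
    (\<lambda>D \<xi>. ext_map B (realize_H D \<xi>))"

lemma germs_over_ext_map:
  assumes "bounded_map V (L_b E F) sup_seminorms h" and "B \<in> disks E"
  shows "germs_over (maps_to_F B) (realize_maps B) V (\<lambda>v. ext_map B (h v)) \<noteq> {}"
  unfolding ext_map_def by (rule FB.germs_over_ind_L_IB[OF bounded_bilinear_extF[OF assms]])

lemma realize_H_bounded:
  assumes "D \<in> disks (L_b E F)"
  shows "bounded_map (completion (hull_space (L_b E F) D)) (L_b E F) sup_seminorms (realize_H D)"
  by (rule bounded_map.bounded_map_extend[OF LB.inclusion_bounded_map[OF assms]])

lemma proj_apply:
  assumes "B \<in> disks E" "D \<in> disks (L_b E F)"
  shows "proj B D = germs_over (maps_to_F B) (realize_maps B) (spc (IB (L_b E F)) D)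
      (\<lambda>\<xi>. ext_map B (realize_H D \<xi>))"
    and "proj B D \<noteq> {}"
proof -
  show "proj B D = germs_over (maps_to_F B) (realize_maps B) (spc (IB (L_b E F)) D)
      (\<lambda>\<xi>. ext_map B (realize_H D \<xi>))"
    using assms(2) by (simp add: proj_def mor_over_def)
  then show "proj B D \<noteq> {}" using germs_over_ext_map[OF realize_H_bounded[OF assms(2)] assms(1)] by simp
qed

lemma complex_vs_spc: "ind_object X \<Longrightarrow> i \<in> obj (idx X) \<Longrightarrow> complex_vs (spc X i)"
  by (simp add: ind_object_def banach_space_def)

lemma proj_cone:
  "ind_cone (idx (IB E)) (\<lambda>B. ind_L (spc (IB E) B) (IB F)) (ind_L_map (IB E) (IB F)) (IB (L_b E F)) proj"
  unfolding ind_cone_def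
proof (intro conjI ballI)
  fix B assume "B \<in> obj (idx (IB E))"
  then have B: "B \<in> disks E" by simp
  interpret R: realized_ind "maps_to_F B" "realize_maps B"
    by (rule realized_F[OF snspace_Ecomp[OF B]])
  show "proj B \<in> ind_hom (IB (L_b E F)) (ind_L (spc (IB E) B) (IB F))"
    unfolding proj_def IB_simps(8)
  proof (rule R.ind_homI[OF LB.ind_object_IB])
    fix D assume "D \<in> obj (idx (IB (L_b E F)))"
    then show "germs_over (maps_to_F B) (realize_maps B) (spc (IB (L_b E F)) D)
        (\<lambda>\<xi>. ext_map B (realize_H D \<xi>)) \<noteq> {}"
      using germs_over_ext_map[OF realize_H_bounded B] by simp
  next
    fix a \<xi> assume "a \<in> arr (idx (IB (L_b E F)))" "\<xi> \<in> carrier (spc (IB (L_b E F)) (src (idx (IB (L_b E F))) a))"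
    from realized_ind.r_trn[OF LB.realized_IB this]
    show "ext_map B (realize_H (tgt (idx (IB (L_b E F))) a) (trn (IB (L_b E F)) a \<xi>))
        = ext_map B (realize_H (src (idx (IB (L_b E F))) a) \<xi>)" by simp
  qed
next
  fix a assume a: "a \<in> arr (idx (IB E))"
  obtain B C where BC: "a = (B, C)" by (cases a)
  then have B: "B \<in> disks E" and C: "C \<in> disks E" and sub: "B \<subseteq> C" using a by auto
  interpret R: realized_ind "maps_to_F C" "realize_maps C"
    by (rule realized_F[OF snspace_Ecomp[OF C]])
  let ?m = "\<lambda>k. \<lambda>\<eta>\<in>carrier (Ecomp B). k (trn (IB E) a \<eta>)"
  note over = realized_ind.ind_L_map_over[OF FB.realized_IB FB.ind_object_IB EB.ind_object_IB a]
  have "ind_comp (IB (L_b E F)) (maps_to_F B) (ind_L_map (IB E) (IB F) a) (proj C)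
      = mor_over (IB (L_b E F)) (maps_to_F B) (realize_maps B)
          (\<lambda>D \<xi>. ?m (ext_map C (realize_H D \<xi>)))"
    unfolding proj_def
  proof (rule R.ind_comp_over[OF realized_F[OF snspace_Ecomp[OF B]]])
    fix D assume D: "D \<in> obj (idx (IB (L_b E F)))"
    show "complex_vs (spc (IB (L_b E F)) D)" by (rule complex_vs_spc[OF LB.ind_object_IB D])
    show "germs_over (maps_to_F C) (realize_maps C) (spc (IB (L_b E F)) D)
        (\<lambda>\<xi>. ext_map C (realize_H D \<xi>)) \<noteq> {}"
      using germs_over_ext_map[OF realize_H_bounded C] D by simp
  next
    fix j assume "j \<in> obj (idx (maps_to_F C))"
    then have j: "j \<in> obj (idx (IB F))" by simp
    show "ind_L_map (IB E) (IB F) a j \<noteq> {}" by (rule over(2)[OF j])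
    show "ind_L_map (IB E) (IB F) a j \<subseteq> germs_over (maps_to_F B) (realize_maps B)
        (spc (maps_to_F C) j) (\<lambda>u. ?m (realize_maps C j u))"
      using over(1)[OF j] by (simp add: BC)
  qed
  also have "\<dots> = proj B"
    unfolding proj_def
  proof (rule mor_over_cong)
    fix D \<xi> assume "D \<in> obj (idx (IB (L_b E F)))" "\<xi> \<in> carrier (spc (IB (L_b E F)) D)"
    then have u: "realize_H D \<xi> \<in> tc_hom E F" using bounded_map.closed[OF realize_H_bounded] by simp
    show "?m (ext_map C (realize_H D \<xi>)) = ext_map B (realize_H D \<xi>)"
      unfolding ext_map_def
    proof (rule restrict_ext)
      fix \<eta> assume \<eta>: "\<eta> \<in> carrier (Ecomp B)"
      have "trn (IB E) (B, C) \<eta> \<in> carrier (Ecomp C)" by (rule ban_hom_apply[OF EB.trn_ban_hom[OF B C sub] \<eta>])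
      then show "(\<lambda>\<eta>\<in>carrier (Ecomp C). extF (realize_H D \<xi>) \<eta>) (trn (IB E) a \<eta>) = extF (realize_H D \<xi>) \<eta>"
        using extF_trn[OF u B C sub \<eta>] by (simp add: BC)
    qed
  qed
  finally show "ind_comp (IB (L_b E F)) (ind_L (spc (IB E) (src (idx (IB E)) a)) (IB F))
      (ind_L_map (IB E) (IB F) a) (proj (tgt (idx (IB E)) a)) = proj (src (idx (IB E)) a)"
    by (simp add: BC)
qed

lemma proj_comp:
  assumes Z: "ind_object Z" and B: "B \<in> disks E"
    and ne: "\<And>i. i \<in> obj (idx Z) \<Longrightarrow> germs_over (IB (L_b E F)) realize_H (spc Z i) (h i) \<noteq> {}"
  shows "ind_comp Z (maps_to_F B) (proj B) (mor_over Z (IB (L_b E F)) realize_H h)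
    = mor_over Z (maps_to_F B) (realize_maps B) (\<lambda>i z. ext_map B (h i z))"
proof (rule realized_ind.ind_comp_over[OF LB.realized_IB realized_F[OF snspace_Ecomp[OF B]] _ ne])
  show "complex_vs (spc Z i)" if "i \<in> obj (idx Z)" for i by (rule complex_vs_spc[OF Z that])
  fix D assume "D \<in> obj (idx (IB (L_b E F)))"
  then have D: "D \<in> disks (L_b E F)" by simp
  show "proj B D \<noteq> {}" by (rule proj_apply[OF B D])
  show "proj B D \<subseteq> germs_over (maps_to_F B) (realize_maps B) (spc (IB (L_b E F)) D)
      (\<lambda>\<xi>. ext_map B (realize_H D \<xi>))" by (simp only: proj_apply[OF B D] order_refl)
qed

end

text \<open>
  A cone over the spaces of maps on the completions of the \<open>E\<^sub>B\<close>, given by its realizations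
  \<open>k B i : Z\<^sub>i \<rightarrow> (E\<^sub>B \<rightarrow> F)\<close>.
\<close>

locale L_b_cone = L_b_setup E F for E :: "'a lcs" and F :: "'b lcs" +
  fixes Z :: "('p, 'q, 'u) ind" and k :: "'a set \<Rightarrow> 'p \<Rightarrow> 'u \<Rightarrow> (nat \<Rightarrow> 'a) set \<Rightarrow> 'b"
  assumes Z: "ind_object Z"
    and k_ne: "B \<in> disks E \<Longrightarrow> i \<in> obj (idx Z)
      \<Longrightarrow> germs_over (maps_to_F B) (realize_maps B) (spc Z i) (k B i) \<noteq> {}"
    and k_trn: "B \<in> disks E \<Longrightarrow> a \<in> arr (idx Z) \<Longrightarrow> z \<in> carrier (spc Z (src (idx Z) a))
      \<Longrightarrow> k B (tgt (idx Z) a) (trn Z a z) = k B (src (idx Z) a) z"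
    and k_restrict: "B \<in> disks E \<Longrightarrow> C \<in> disks E \<Longrightarrow> B \<subseteq> C \<Longrightarrow> i \<in> obj (idx Z)
      \<Longrightarrow> z \<in> carrier (spc Z i) \<Longrightarrow> \<eta> \<in> carrier (Ecomp B)
      \<Longrightarrow> k C i z (trn (IB E) (B, C) \<eta>) = k B i z \<eta>"
begin

lemma Z_snspace: "i \<in> obj (idx Z) \<Longrightarrow> snspace (spc Z i)"
  using Z by (simp add: ind_object_def banach_snspace)

lemma k_bilinear:
  assumes "B \<in> disks E" "i \<in> obj (idx Z)"
  shows "bounded_bilinear_map (spc Z i) (Ecomp B) F (cont_seminorms F) (k B i)"
proof -
  obtain C f where "(C, f) \<in> germs_over (maps_to_F B) (realize_maps B) (spc Z i) (k B i)"
    using k_ne[OF assms] by auto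
  then show ?thesis by (rule FB.bounded_bilinear_map_if_germ[OF Z_snspace[OF assms(2)] snspace_Ecomp[OF assms(1)]])
qed

lemma k_extensional:
  assumes "B \<in> disks E" "i \<in> obj (idx Z)" "z \<in> carrier (spc Z i)"
  shows "k B i z \<in> extensional (carrier (Ecomp B))"
proof -
  obtain C f where "(C, f) \<in> germs_over (maps_to_F B) (realize_maps B) (spc Z i) (k B i)"
    using k_ne[OF assms(1,2)] by auto
  then have "k B i z = realize_maps B C (f z)" using assms(3) by (simp add: germs_over_def)
  then show ?thesis by (simp add: realize_L_def)
qed

lemma disk_of_vbounded:
  assumes "vbounded E A"
  obtains B where "B \<in> disks E" "A \<subseteq> B"
proof -
  have "E.family.pbounded A" using assms by (simp add: E.vbounded_iff)
  then show ?thesis using that by (rule EB.disk_cofinal) blast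
qed

definition disk_at :: "'a \<Rightarrow> 'a set" where
  "disk_at x = (SOME B. B \<in> disks E \<and> x \<in> B)"

lemma disk_at: "x \<in> carrier E \<Longrightarrow> disk_at x \<in> disks E \<and> x \<in> disk_at x"
  unfolding disk_at_def by (rule someI_ex) (metis disk_of_vbounded insert_subset vbounded_singleton)

definition emb :: "'a set \<Rightarrow> 'a \<Rightarrow> (nat \<Rightarrow> 'a) set" where
  "emb B = snspace.embed (hull_space E B)"

text \<open>
  Every element of \<open>E\<close> lies in a disk, so the maps \<open>k B i z\<close> on the completions of the \<open>E\<^sub>B\<close> define a map on \<open>E\<close>. Two disks
  lie in a common one, which makes the value independent of the disk.
\<close>

definition glue :: "'p \<Rightarrow> 'u \<Rightarrow> 'a \<Rightarrow> 'b" where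
  "glue i z = (\<lambda>x\<in>carrier E. k (disk_at x) i z (emb (disk_at x) x))"

lemma emb_closed: "B \<in> disks E \<Longrightarrow> x \<in> linear_hull E B \<Longrightarrow> emb B x \<in> carrier (Ecomp B)"
  unfolding emb_def by (rule snspace.embed_closed[OF snspace_hull]) simp_all

lemma glue_eq:
  assumes B: "B \<in> disks E" and i: "i \<in> obj (idx Z)" and z: "z \<in> carrier (spc Z i)"
    and x: "x \<in> linear_hull E B"
  shows "glue i z x = k B i z (emb B x)"
proof -
  have xE: "x \<in> carrier E" using x E.linear_hull_closed[of B] B by blast
  let ?D = "disk_at x"
  have D: "?D \<in> disks E" "x \<in> linear_hull E ?D"
    using disk_at[OF xE] E.subset_linear_hull[of ?D] by blast+
  obtain C where C: "C \<in> disks E" "B \<subseteq> C" "?D \<subseteq> C" using EB.disk_Un[OF B D(1)] by blast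
  have "glue i z x = k ?D i z (emb ?D x)" using xE by (simp add: glue_def)
  also have "\<dots> = k C i z (emb C x)"
    using k_restrict[OF D(1) C(1,3) i z emb_closed[OF D]] EB.trn_embed[OF D(1) C(1,3) D(2)]
    by (simp add: emb_def)
  also have "\<dots> = k B i z (emb B x)"
    using k_restrict[OF B C(1,2) i z emb_closed[OF B x]] EB.trn_embed[OF B C(1,2) x]
    by (simp add: emb_def)
  finally show ?thesis .
qed

lemma glue_bound:
  assumes B: "vbounded E A" and i: "i \<in> obj (idx Z)" and p: "p \<in> cont_seminorms F"
  shows "\<exists>M\<ge>0. \<forall>z\<in>carrier (spc Z i). \<forall>x\<in>A. p (glue i z x) \<le> M * nrm (spc Z i) z"
proof -
  obtain B where B: "B \<in> disks E" "A \<subseteq> B" using assms(1) by (rule disk_of_vbounded)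
  have acB: "abs_convex E B" using B by simp
  interpret b: bounded_bilinear_map "spc Z i" "Ecomp B" F "cont_seminorms F" "k B i" by (rule k_bilinear[OF B(1) i])
  interpret S: snspace "hull_space E B" by (rule snspace_hull[OF B(1)])
  obtain M where M: "\<forall>z\<in>carrier (spc Z i). \<forall>w\<in>carrier (Ecomp B). p (k B i z w) \<le> M * (nrm (spc Z i) z * nrm (Ecomp B) w)"
    using b.bounded[OF p] by blast
  have "p (glue i z x) \<le> \<bar>M\<bar> * nrm (spc Z i) z" if z: "z \<in> carrier (spc Z i)" and x: "x \<in> A" for z x
  proof -
    have xB: "x \<in> linear_hull E B" "x \<in> B" using x B(2) E.subset_linear_hull by blast+
    have n: "0 \<le> nrm (Ecomp B) (emb B x)" "nrm (Ecomp B) (emb B x) \<le> 1"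
      using E.gauge_le_oneI[OF acB xB(2)] S.nrm_embed[of x] E.gauge_nonneg[OF acB xB(1)] xB(1) by (simp_all add: emb_def)
    have "p (glue i z x) \<le> M * (nrm (spc Z i) z * nrm (Ecomp B) (emb B x))"
      using M z emb_closed[OF B(1) xB(1)] by (simp add: glue_eq[OF B(1) i z xB(1)])
    also have "\<dots> \<le> \<bar>M\<bar> * (nrm (spc Z i) z * 1)"
      using n z b.V.nonneg[OF z] by (intro mult_mono) (auto intro: mult_left_le)
    finally show ?thesis by simp
  qed
  then show ?thesis by (intro exI[of _ "\<bar>M\<bar>"]) simp
qed

lemma glue_tc_hom:
  assumes i: "i \<in> obj (idx Z)" and z: "z \<in> carrier (spc Z i)"
  shows "glue i z \<in> tc_hom E F"
  unfolding tc_hom_iff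
proof (intro conjI ballI allI impI)
  fix p B assume "p \<in> cont_seminorms F" "vbounded E B"
  then show "\<exists>M. \<forall>x\<in>B. p (glue i z x) \<le> M" using glue_bound[OF _ i, of B p] z by blast
next
  show "glue i z \<in> linear_maps E F"
  proof (rule linear_mapsI)
    fix x y c assume x: "x \<in> carrier E"
    note D = disk_at[OF x]
    \<comment> \<open>On the hull of a single disk, \<open>glue i z\<close> is the linear map \<open>k B i z\<close>.\<close>
    {
      fix B assume B: "B \<in> disks E" "x \<in> linear_hull E B"
      interpret b: bounded_bilinear_map "spc Z i" "Ecomp B" F "cont_seminorms F" "k B i"
        by (rule k_bilinear[OF B(1) i])
      interpret S: snspace "hull_space E B" by (rule snspace_hull[OF B(1)])
      have "glue i z x \<in> carrier F"
        using b.closed[OF z emb_closed[OF B]] by (simp add: glue_eq[OF B(1) i z B(2)])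
      moreover have "glue i z (c \<odot>\<^bsub>E\<^esub> x) = c \<odot>\<^bsub>F\<^esub> glue i z x"
        using glue_eq[OF B(1) i z, of "c \<odot>\<^bsub>E\<^esub> x"] S.smult_closed[of x c] B(2) S.embed_smult[of x c]
          b.smult_right[OF z emb_closed[OF B], of c]
        by (simp add: glue_eq[OF B(1) i z B(2)] emb_def)
      moreover have "glue i z (x \<oplus>\<^bsub>E\<^esub> y) = glue i z x \<oplus>\<^bsub>F\<^esub> glue i z y" if y: "y \<in> linear_hull E B"
        using glue_eq[OF B(1) i z, of "x \<oplus>\<^bsub>E\<^esub> y"] S.M.a_closed[of x y] B(2) y S.embed_add[of x y]
          b.add_right[OF z emb_closed[OF B] emb_closed[OF B(1) y]]
        by (simp add: glue_eq[OF B(1) i z B(2)] glue_eq[OF B(1) i z y] emb_def)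
      ultimately have "glue i z x \<in> carrier F" "glue i z (c \<odot>\<^bsub>E\<^esub> x) = c \<odot>\<^bsub>F\<^esub> glue i z x"
        "y \<in> linear_hull E B \<Longrightarrow> glue i z (x \<oplus>\<^bsub>E\<^esub> y) = glue i z x \<oplus>\<^bsub>F\<^esub> glue i z y" by blast+
    } note lin = this
    show "glue i z x \<in> carrier F" "glue i z (c \<odot>\<^bsub>E\<^esub> x) = c \<odot>\<^bsub>F\<^esub> glue i z x"
      using lin(1,2)[of "disk_at x"] D E.subset_linear_hull by blast+
    assume y: "y \<in> carrier E"
    obtain B where B: "B \<in> disks E" "disk_at x \<union> disk_at y \<subseteq> B"
      using EB.disk_Un D disk_at[OF y] by meson
    then have "x \<in> linear_hull E B" "y \<in> linear_hull E B"
      using D disk_at[OF y] E.subset_linear_hull[of B] by blast+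
    then show "glue i z (x \<oplus>\<^bsub>E\<^esub> y) = glue i z x \<oplus>\<^bsub>F\<^esub> glue i z y" using lin(3)[OF B(1)] by blast
  qed (simp add: glue_def)
qed

text \<open>
  A bound of \<open>k B i\<close> on the product of the unit balls is a bound of \<open>glue i\<close> for the semi-norm of uniform
  convergence on \<open>B\<close>. Linearity in \<open>z\<close> holds pointwise.
\<close>

lemma glue_bounded_map:
  assumes i: "i \<in> obj (idx Z)"
  shows "bounded_map (spc Z i) (L_b E F) sup_seminorms (glue i)"
proof -
  interpret V: snspace "spc Z i" by (rule Z_snspace[OF i])
  show ?thesis
  proof
    fix z z' c assume z: "z \<in> carrier (spc Z i)"
    show "glue i z \<in> carrier (L_b E F)" using glue_tc_hom[OF i z] by simp
    have hull: "x \<in> linear_hull E (disk_at x)" "disk_at x \<in> disks E" if "x \<in> carrier E" for x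
      using disk_at[OF that] E.subset_linear_hull by blast+
    show "glue i (c \<odot>\<^bsub>spc Z i\<^esub> z) = c \<odot>\<^bsub>L_b E F\<^esub> glue i z"
      unfolding L_b_simps
    proof (subst glue_def, rule restrict_ext)
      fix x assume x: "x \<in> carrier E"
      interpret b: bounded_bilinear_map "spc Z i" "Ecomp (disk_at x)" F "cont_seminorms F" "k (disk_at x) i"
        by (rule k_bilinear[OF hull(2)[OF x] i])
      show "k (disk_at x) i (c \<odot>\<^bsub>spc Z i\<^esub> z) (emb (disk_at x) x) = c \<odot>\<^bsub>F\<^esub> glue i z x"
        using b.smult_left[OF z emb_closed[OF hull(2)[OF x] hull(1)[OF x]]] x by (simp add: glue_def)
    qed
    assume z': "z' \<in> carrier (spc Z i)"
    show "glue i (z \<oplus>\<^bsub>spc Z i\<^esub> z') = glue i z \<oplus>\<^bsub>L_b E F\<^esub> glue i z'"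
      unfolding L_b_simps
    proof (subst glue_def, rule restrict_ext)
      fix x assume x: "x \<in> carrier E"
      interpret b: bounded_bilinear_map "spc Z i" "Ecomp (disk_at x)" F "cont_seminorms F" "k (disk_at x) i"
        by (rule k_bilinear[OF hull(2)[OF x] i])
      show "k (disk_at x) i (z \<oplus>\<^bsub>spc Z i\<^esub> z') (emb (disk_at x) x) = glue i z x \<oplus>\<^bsub>F\<^esub> glue i z' x"
        using b.add_left[OF z z' emb_closed[OF hull(2)[OF x] hull(1)[OF x]]] x by (simp add: glue_def)
    qed
  next
    fix P assume "P \<in> sup_seminorms"
    then obtain p B where P: "P = sup_seminorm p B" and p: "p \<in> cont_seminorms F" and B: "vbounded E B" "B \<noteq> {}"
      by (auto simp: sup_seminorms_def)
    obtain M where "\<forall>z\<in>carrier (spc Z i). \<forall>x\<in>B. p (glue i z x) \<le> M * nrm (spc Z i) z"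
      using glue_bound[OF B(1) i p] by blast
    then show "\<exists>M. \<forall>z\<in>carrier (spc Z i). P (glue i z) \<le> M * nrm (spc Z i) z"
      unfolding P using sup_seminorm_le_iff[OF glue_tc_hom[OF i] p B] by blast
  qed
qed

lemma ext_map_glue:
  assumes B: "B \<in> disks E" and i: "i \<in> obj (idx Z)" and z: "z \<in> carrier (spc Z i)"
  shows "ext_map B (glue i z) = k B i z"
proof (rule extensionalityI)
  show "ext_map B (glue i z) \<in> extensional (carrier (Ecomp B))" by (simp add: ext_map_def)
  show "k B i z \<in> extensional (carrier (Ecomp B))" by (rule k_extensional[OF B i z])
  interpret u: bounded_map "hull_space E B" F "cont_seminorms F" "glue i z"
    by (rule bounded_map_hom[OF glue_tc_hom[OF i z] B])
  fix \<eta> assume \<eta>: "\<eta> \<in> carrier (Ecomp B)"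
  have "k B i z \<eta> = extF (glue i z) \<eta>"
    by (rule u.extend_unique[OF bounded_bilinear_map.bounded_map_right[OF k_bilinear[OF B i] z] _ \<eta>])
       (use glue_eq[OF B i z] in \<open>simp add: emb_def\<close>)
  then show "ext_map B (glue i z) \<eta> = k B i z \<eta>" using \<eta> by (simp add: ext_map_def)
qed

text \<open>Continuous linear maps on \<open>E\<close> are determined by their extensions, since disks cover \<open>E\<close>.\<close>

lemma eq_glue_if_ext_map:
  assumes u: "u \<in> tc_hom E F" and i: "i \<in> obj (idx Z)" and z: "z \<in> carrier (spc Z i)"
    and eq: "\<And>B. B \<in> disks E \<Longrightarrow> ext_map B u = k B i z"
  shows "u = glue i z"
proof (rule extensionalityI)
  show "u \<in> extensional (carrier E)" using u linear_mapsD(4) by (auto simp: tc_hom_def)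
  show "glue i z \<in> extensional (carrier E)" by (simp add: glue_def)
  fix x assume x: "x \<in> carrier E"
  have D: "disk_at x \<in> disks E" "x \<in> linear_hull E (disk_at x)"
    using disk_at[OF x] E.subset_linear_hull by blast+
  interpret u: bounded_map "hull_space E (disk_at x)" F "cont_seminorms F" u by (rule bounded_map_hom[OF u D(1)])
  have "u x = ext_map (disk_at x) u (emb (disk_at x) x)"
    using u.extend_embed[of x] D(2) emb_closed[OF D] by (simp add: ext_map_def emb_def)
  then show "u x = glue i z x" using eq[OF D(1)] x by (simp add: glue_def)
qed

lemma unique_factorization:
  "\<exists>!\<phi>. \<phi> \<in> ind_hom Z (IB (L_b E F)) \<and> (\<forall>B\<in>disks E. ind_comp Z (maps_to_F B) (proj B) \<phi>
      = mor_over Z (maps_to_F B) (realize_maps B) (k B))"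
proof (rule ex1I)
  interpret H: realized_ind "IB (L_b E F)" realize_H by (rule LB.realized_IB)
  have ne: "germs_over (IB (L_b E F)) realize_H (spc Z i) (glue i) \<noteq> {}" if "i \<in> obj (idx Z)" for i
    by (rule LB.germs_over_IB[OF glue_bounded_map[OF that]])
  let ?\<phi> = "mor_over Z (IB (L_b E F)) realize_H glue"
  have "?\<phi> \<in> ind_hom Z (IB (L_b E F))"
  proof (rule H.ind_homI[OF Z ne])
    fix a z assume a: "a \<in> arr (idx Z)" and z: "z \<in> carrier (spc Z (src (idx Z) a))"
    show "glue (tgt (idx Z) a) (trn Z a z) = glue (src (idx Z) a) z"
      unfolding glue_def by (rule restrict_ext) (use k_trn[OF _ a z] disk_at in auto)
  qed
  moreover have "ind_comp Z (maps_to_F B) (proj B) ?\<phi>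
      = mor_over Z (maps_to_F B) (realize_maps B) (k B)" if B: "B \<in> disks E" for B
  proof -
    have "ind_comp Z (maps_to_F B) (proj B) ?\<phi>
        = mor_over Z (maps_to_F B) (realize_maps B) (\<lambda>i z. ext_map B (glue i z))"
      by (rule proj_comp[OF Z B]) (rule ne)
    also have "\<dots> = mor_over Z (maps_to_F B) (realize_maps B) (k B)"
      by (rule mor_over_cong) (rule ext_map_glue[OF B])
    finally show ?thesis .
  qed
  ultimately show "?\<phi> \<in> ind_hom Z (IB (L_b E F)) \<and> (\<forall>B\<in>disks E. ind_comp Z (maps_to_F B) (proj B) ?\<phi>
      = mor_over Z (maps_to_F B) (realize_maps B) (k B))" by blast
  fix \<phi> assume \<phi>: "\<phi> \<in> ind_hom Z (IB (L_b E F)) \<and> (\<forall>B\<in>disks E. ind_comp Z (maps_to_F B) (proj B) \<phi>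
      = mor_over Z (maps_to_F B) (realize_maps B) (k B))"
  then have "\<phi> \<in> ind_hom Z (IB (L_b E F))" by blast
  then obtain h where h: "\<phi> = mor_over Z (IB (L_b E F)) realize_H h"
    and "\<forall>i\<in>obj (idx Z). germs_over (IB (L_b E F)) realize_H (spc Z i) (h i) \<noteq> {}"
    by (rule H.ind_homE[OF Z])
  then have hne: "germs_over (IB (L_b E F)) realize_H (spc Z i) (h i) \<noteq> {}" if "i \<in> obj (idx Z)" for i
    using that by blast
  show "\<phi> = ?\<phi>"
    unfolding h
  proof (rule mor_over_cong)
    fix i z assume i: "i \<in> obj (idx Z)" and z: "z \<in> carrier (spc Z i)"
    show "h i z = glue i z"
    proof (rule eq_glue_if_ext_map[OF _ i z])
      obtain D f where f: "(D, f) \<in> germs_over (IB (L_b E F)) realize_H (spc Z i) (h i)" using hne[OF i] by auto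
      then have D: "D \<in> disks (L_b E F)" and fz: "f z \<in> carrier (completion (hull_space (L_b E F) D))"
        and "h i z = realize_H D (f z)"
        using z by (auto simp: germs_over_def germs_iff intro: ban_hom_apply)
      then show "h i z \<in> tc_hom E F" using bounded_map.closed[OF realize_H_bounded[OF D] fz] by simp
      fix B assume B: "B \<in> disks E"
      have "ind_comp Z (maps_to_F B) (proj B) \<phi>
          = mor_over Z (maps_to_F B) (realize_maps B) (\<lambda>i z. ext_map B (h i z))"
        unfolding h by (rule proj_comp[OF Z B]) (rule hne)
      then have "mor_over Z (maps_to_F B) (realize_maps B) (k B)
          = mor_over Z (maps_to_F B) (realize_maps B) (\<lambda>i z. ext_map B (h i z))"
        using \<phi> B by (simp only:)
      from fun_cong[OF this, of i] i
      have "germs_over (maps_to_F B) (realize_maps B) (spc Z i) (k B i)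
          = germs_over (maps_to_F B) (realize_maps B) (spc Z i) (\<lambda>z. ext_map B (h i z))"
        by (simp add: mor_over_def)
      from germs_over_eqD[OF this k_ne[OF B i] z] show "ext_map B (h i z) = k B i z" by simp
    qed
  qed
qed

end

context L_b_setup
begin

text \<open>
  By the description of \<open>ind_L_map\<close> on realizations, the cone condition says that \<open>k C i z\<close>
  restricts to \<open>k B i z\<close> along the transition map for \<open>B \<subseteq> C\<close>.
\<close>

lemma cone_realization:
  fixes Z :: "('p, 'q, 'u) ind"
  assumes Z: "ind_object Z"
    and cone: "ind_cone (idx (IB E)) (\<lambda>B. ind_L (spc (IB E) B) (IB F)) (ind_L_map (IB E) (IB F)) Z \<sigma>"
  obtains k where "L_b_cone E F Z k"
    "\<And>B. B \<in> disks E \<Longrightarrow> \<sigma> B = mor_over Z (maps_to_F B) (realize_maps B) (k B)"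
proof -
  have "\<forall>B\<in>disks E. \<exists>h. \<sigma> B = mor_over Z (maps_to_F B) (realize_maps B) h \<and>
      (\<forall>i\<in>obj (idx Z). germs_over (maps_to_F B) (realize_maps B) (spc Z i) (h i) \<noteq> {}) \<and>
      (\<forall>a\<in>arr (idx Z). \<forall>z\<in>carrier (spc Z (src (idx Z) a)). h (tgt (idx Z) a) (trn Z a z) = h (src (idx Z) a) z)"
  proof
    fix B assume B: "B \<in> disks E"
    have "\<sigma> B \<in> ind_hom Z (maps_to_F B)" using cone B by (simp add: ind_cone_def)
    then obtain h where "\<sigma> B = mor_over Z (maps_to_F B) (realize_maps B) h"
      "\<forall>i\<in>obj (idx Z). germs_over (maps_to_F B) (realize_maps B) (spc Z i) (h i) \<noteq> {}"
      "\<forall>a\<in>arr (idx Z). \<forall>z\<in>carrier (spc Z (src (idx Z) a)). h (tgt (idx Z) a) (trn Z a z) = h (src (idx Z) a) z"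
      by (rule realized_ind.ind_homE[OF realized_F[OF snspace_Ecomp[OF B]] Z])
    then show "\<exists>h. \<sigma> B = mor_over Z (maps_to_F B) (realize_maps B) h \<and>
      (\<forall>i\<in>obj (idx Z). germs_over (maps_to_F B) (realize_maps B) (spc Z i) (h i) \<noteq> {}) \<and>
      (\<forall>a\<in>arr (idx Z). \<forall>z\<in>carrier (spc Z (src (idx Z) a)). h (tgt (idx Z) a) (trn Z a z) = h (src (idx Z) a) z)"
      by blast
  qed
  from bchoice[OF this] obtain k where k: "\<forall>B\<in>disks E.
      \<sigma> B = mor_over Z (maps_to_F B) (realize_maps B) (k B) \<and>
      (\<forall>i\<in>obj (idx Z). germs_over (maps_to_F B) (realize_maps B) (spc Z i) (k B i) \<noteq> {}) \<and>
      (\<forall>a\<in>arr (idx Z). \<forall>z\<in>carrier (spc Z (src (idx Z) a)). k B (tgt (idx Z) a) (trn Z a z) = k B (src (idx Z) a) z)"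
    ..
  have \<sigma>: "\<sigma> B = mor_over Z (maps_to_F B) (realize_maps B) (k B)"
    if "B \<in> disks E" for B using bspec[OF k that] by blast
  have ne: "germs_over (maps_to_F B) (realize_maps B) (spc Z i) (k B i) \<noteq> {}"
    if "B \<in> disks E" "i \<in> obj (idx Z)" for B i using bspec[OF k that(1)] that(2) by blast
  have tr: "k B (tgt (idx Z) a) (trn Z a z) = k B (src (idx Z) a) z"
    if "B \<in> disks E" "a \<in> arr (idx Z)" "z \<in> carrier (spc Z (src (idx Z) a))" for B a z
    using bspec[OF k that(1)] that(2,3) by blast
  have "k C i z (trn (IB E) (B, C) \<eta>) = k B i z \<eta>"
    if B: "B \<in> disks E" and C: "C \<in> disks E" and sub: "B \<subseteq> C" and i: "i \<in> obj (idx Z)"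
      and z: "z \<in> carrier (spc Z i)" and \<eta>: "\<eta> \<in> carrier (Ecomp B)" for B C i z \<eta>
  proof -
    let ?m = "\<lambda>k. \<lambda>\<eta>\<in>carrier (Ecomp B). k (trn (IB E) (B, C) \<eta>)"
    have a: "(B, C) \<in> arr (idx (IB E))" using B C sub by simp
    note over = realized_ind.ind_L_map_over[OF FB.realized_IB FB.ind_object_IB EB.ind_object_IB a]
    have "\<sigma> B = ind_comp Z (maps_to_F B) (ind_L_map (IB E) (IB F) (B, C)) (\<sigma> C)"
      using cone a unfolding ind_cone_def by (auto dest!: conjunct2 bspec)
    also have "\<dots> = mor_over Z (maps_to_F B) (realize_maps B) (\<lambda>i z. ?m (k C i z))"
      unfolding \<sigma>[OF C]
    proof (rule realized_ind.ind_comp_over[OF realized_F[OF snspace_Ecomp[OF C]] realized_F[OF snspace_Ecomp[OF B]] _ ne[OF C]])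
      show "complex_vs (spc Z i)" if "i \<in> obj (idx Z)" for i by (rule complex_vs_spc[OF Z that])
      fix j assume "j \<in> obj (idx (maps_to_F C))"
      then have j: "j \<in> obj (idx (IB F))" by simp
      show "ind_L_map (IB E) (IB F) (B, C) j \<noteq> {}" by (rule over(2)[OF j])
      show "ind_L_map (IB E) (IB F) (B, C) j \<subseteq> germs_over (maps_to_F B) (realize_maps B)
          (spc (maps_to_F C) j) (\<lambda>u. ?m (realize_maps C j u))"
        using over(1)[OF j] by simp
    qed
    finally have "germs_over (maps_to_F B) (realize_maps B) (spc Z i) (k B i)
        = germs_over (maps_to_F B) (realize_maps B) (spc Z i) (\<lambda>z. ?m (k C i z))"
      unfolding \<sigma>[OF B] using i by (auto simp: mor_over_def dest!: fun_cong[of _ _ i])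
    from germs_over_eqD[OF this ne[OF B i] z] have "k B i z = ?m (k C i z)" .
    then show ?thesis using \<eta> by simp
  qed
  then have "L_b_cone E F Z k" using Z ne tr by unfold_locales
  then show thesis using \<sigma> by (rule that)
qed

lemma is_internal_hom_IB: "is_internal_hom (U :: ('p, 'q, 'u) ind itself) (IB E) (IB F) (IB (L_b E F))"
  unfolding is_internal_hom_def is_ind_limit_def
proof (intro exI[of _ proj] conjI allI impI)
  show "ind_object (IB (L_b E F))" by (rule LB.ind_object_IB)
  show "ind_cone (idx (IB E)) (\<lambda>B. ind_L (spc (IB E) B) (IB F)) (ind_L_map (IB E) (IB F)) (IB (L_b E F)) proj"
    by (rule proj_cone)
  fix Z :: "('p, 'q, 'u) ind" and \<sigma>
  assume "ind_object Z \<and> ind_cone (idx (IB E)) (\<lambda>B. ind_L (spc (IB E) B) (IB F)) (ind_L_map (IB E) (IB F)) Z \<sigma>"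
  then obtain k where k: "L_b_cone E F Z k"
    and \<sigma>: "\<And>B. B \<in> disks E \<Longrightarrow> \<sigma> B = mor_over Z (maps_to_F B) (realize_maps B) (k B)"
    using cone_realization by blast
  have "(\<forall>B\<in>obj (idx (IB E)). ind_comp Z (ind_L (spc (IB E) B) (IB F)) (proj B) \<phi> = \<sigma> B) \<longleftrightarrow>
      (\<forall>B\<in>disks E. ind_comp Z (maps_to_F B) (proj B) \<phi>
        = mor_over Z (maps_to_F B) (realize_maps B) (k B))" for \<phi>
    using \<sigma> by simp
  then show "\<exists>!\<phi>. \<phi> \<in> ind_hom Z (IB (L_b E F)) \<and>
      (\<forall>B\<in>obj (idx (IB E)). ind_comp Z (ind_L (spc (IB E) B) (IB F)) (proj B) \<phi> = \<sigma> B)"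
    using L_b_cone.unique_factorization[OF k] by simp
qed

end

theorem proposition1p13:
  fixes E :: "'a lcs" and F :: "'b lcs" and U :: "('p, 'q, 'u) ind itself"
  assumes "locally_convex E" and "locally_convex F"
    and "bornological E" and "complete_lcs F"
  shows "\<exists>H :: (('a \<Rightarrow> 'b) set, ('a \<Rightarrow> 'b) set \<times> ('a \<Rightarrow> 'b) set, (nat \<Rightarrow> 'a \<Rightarrow> 'b) set) ind.
           is_internal_hom U (IB E) (IB F) H \<and> IB (L_b E F) \<simeq>\<^sub>I H"
proof -
  interpret L_b_setup E F
    by (intro L_b_setup.intro lc_spaceI L_b_setup_axioms.intro assms)
  show ?thesis
    using is_internal_hom_IB realized_ind.ind_iso_refl[OF LB.realized_IB LB.ind_object_IB] by blast
qed

end
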